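(* Let $\mathcal{H}(\cdot\,;u)=H_u$, $u\in U$, be a smooth family of $\mathsf{SO}(3)$-invariant Hamiltonians, where $U\subset\mathbb{R}^d$ is open and $0\in U$. Suppose that $H_0$ has at $(0,s_e)\in\mathfrak{so}(3)^*\times\mathcal{S}$ a non-degenerate relative equilibrium with zero momentum which is an equilibrium, so that the associated function $h_0$ on $\mathfrak{so}(3)^*$ has zero linear part at $0$. Suppose that, in suitable orthonormal coordinates $\mu=(x,y,z)$ on $\mathfrak{so}(3)^*\simeq\mathbb{R}^3$, $h_0(x,y,z)=ax^2+by^2+cz^2+O(3)$ (up to an additive constant) with $a>b>c$. Let $\mathcal{G}$ be the family of functions on $\mathfrak{so}(3)^*$ with parameter $\boldsymbol{\alpha}=(\alpha,\beta,\gamma)\in\mathbb{R}^3$, $$\mathcal{G}(x,y,z;\alpha,\beta,\gamma)=G_{\boldsymbol\alpha}(x,y,z)=ax^2+by^2+cz^2+\alpha x+\beta y+\gamma z .$$ Then there exist a neighbourhood $U'$ of $0$ in $U$, a neighbourhood $M$ of $0$ in $\mathfrak{so}(3)^*$, and a smooth map $$\Phi:M\times U'\longrightarrow \mathfrak{so}(3)^*\times\mathbb{R}^3,\qquad \Phi(\mu,u)=(\Phi_1(\mu,u),\varphi(u)),$$ with $\varphi(0)=0$, such that for all $(\mu,u)\in M\times U'$, $$(\mu,u)\in\mathcal{R}(\mathcal{H})\iff \Phi(\mu,u)\in\mathcal{R}(\mathcal{G}).$$ In particular, if for each $u\in U'$ one defines $\Phi_u(\mu):=\Phi_1(\mu,u)$,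 then $\Phi_u$ is a diffeomorphism (from $M$ onto its image) which identifies the set $\mathcal{R}(H_u)$ with the set $\mathcal{R}(G_{\varphi(u)})$, i.e. $\Phi_u(\mathcal{R}(H_u)\cap M)=\mathcal{R}(G_{\varphi(u)})\cap\Phi_u(M)$.
   Context: Setting. $(\mathcal{P},\omega)$ is a symplectic manifold with a free Hamiltonian action of $\mathsf{SO}(3)$ and equivariant momentum map $\mathbf{J}:\mathcal{P}\to\mathfrak{so}(3)^*$, studied near a point $p_e$ with $\mathbf{J}(p_e)=0$. All statements are local, so by the Marle–Guillemin–Sternberg normal form $\mathcal{P}$ is taken to be an $\mathsf{SO}(3)$-invariant neighbourhood of the orbit of $p_e$ in $\mathsf{SO}(3)\times\mathfrak{so}(3)^*\times\mathcal{S}$, where $\mathcal{S}$ (a slice to the orbit inside $\mathbf{J}^{-1}(0)$) is a symplectic manifold, the action is $g'\cdot(g,\rho,v)=(g'g,\rho,v)$ and $\mathbf{J}(g,\rho,v)=\mathrm{Coad}_g\rho$. Thus $\mathcal{P}/\mathsf{SO}(3)\simeq\mathfrak{so}(3)^*\times\mathcal{S}$ (locally), and an invariant Hamiltonian $H$ is identified with a function $H(\mu,s)$ on $\mathfrak{so}(3)^*\times\mathcal{S}$. The orbit momentum map is $\mathbf{j}(\mu,s)=\mathbf{j}(\mu)=\|\mu\|^2$, where with coordinates $\mu=(x,y,z)\in\mathbb{R}^3\simeq\mathfrak{so}(3)^*$ one takes $\|\mu\|^2=\tfrac12(x^2+y^2+z^2)$. A zero-momentum relative equilibrium is a point $(0,s_e)$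 with $d_sH(0,s_e)=0$; it is non-degenerate if $d_s^2H(0,s_e)$ is non-degenerate; it is an equilibrium if also $D_\mu H(0,s_e)=0$. A family $\mathcal{H}$ is a smooth function on $\mathcal{P}\times U$, invariant under $\mathsf{SO}(3)$ (acting trivially on $U$), $\mathcal{H}(z;u)=H_u(z)$. For such a family with $H_0$ having a non-degenerate relative equilibrium at $(0,s_e)$, the implicit function theorem gives a unique smooth $s=s(\mu,u)$ near $(0,0)$ with $s(0,0)=s_e$ and $d_sH_u(\mu,s(\mu,u))=0$; put $h_u(\mu)=H_u(\mu,s(\mu,u))$, a smooth family of functions defined near $0\in\mathfrak{so}(3)^*$. $\mathcal{R}(H_u)$ is the set of $\mu$ (near $0$) at which the $2\times3$ Jacobian matrix of $(h_u,\mathbf{j}):\mathfrak{so}(3)^*\to\mathbb{R}^2$ has rank at most $1$, and $\mathcal{R}(\mathcal{H})=\{(\mu,u):\mu\in\mathcal{R}(H_u)\}$. Similarly $\mathcal{R}(G_{\boldsymbol\alpha})$ is the set of $\mu\in\mathbb{R}^3$ at which the Jacobian matrix of $(G_{\boldsymbol\alpha},\mathbf{j})$ has rank at most $1$, and $\mathcal{R}(\mathcal{G})=\{(\mu,\boldsymbol\alpha):\mu\in\mathcal{R}(G_{\boldsymbol\alpha})\}$. *)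

theory Defs
  imports "HOL-Analysis.Analysis" "HOL-Library.Landau_Symbols"
begin

section \<open>Smooth maps\<close>

text \<open>On an open set, \<open>higher_differentiable_on W f k\<close> is the usual notion of a \<open>C\<^sup>k\<close> map
  (in finite dimensions).\<close>

primrec higher_differentiable_on ::
    "'a::real_normed_vector set \<Rightarrow> ('a \<Rightarrow> 'b::real_normed_vector) \<Rightarrow> nat \<Rightarrow> bool" where
  "higher_differentiable_on W f 0 \<longleftrightarrow> continuous_on W f"
| "higher_differentiable_on W f (Suc k) \<longleftrightarrow>
     (\<forall>x\<in>W. f differentiable (at x)) \<and>
     (\<forall>v. higher_differentiable_on W (\<lambda>x. frechet_derivative f (at x) v) k)"

text \<open>Smoothness on an arbitrary subset \<open>X\<close>: near each of its points the map is the restriction of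
  a \<open>C\<^sup>\<infinity>\<close> map defined on an open subset of the ambient space.  For an open \<open>X\<close> this is ordinary
  smoothness, and for an embedded submanifold it is smoothness in the sense of manifolds.\<close>

definition smooth_on ::
    "'a::real_normed_vector set \<Rightarrow> ('a \<Rightarrow> 'b::real_normed_vector) \<Rightarrow> bool" where
  "smooth_on X f \<longleftrightarrow>
     (\<forall>x\<in>X. \<exists>W g. open W \<and> x \<in> W \<and> (\<forall>k. higher_differentiable_on W g k) \<and>
                  (\<forall>y\<in>X \<inter> W. g y = f y))"

definition diffeo_onto_image ::
    "'a::real_normed_vector set \<Rightarrow> ('a \<Rightarrow> 'a) \<Rightarrow> bool" where
  "diffeo_onto_image M f \<longleftrightarrow>
     inj_on f M \<and> open (f ` M) \<and> smooth_on M f \<and> smooth_on (f ` M) (inv_into M f)"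


section \<open>Symplectic manifolds\<close>

text \<open>The manifold is the whole type \<open>'s\<close> (Hausdorff and second countable where it is used).
  A chart is a pair of a domain and a coordinate map.  Charts take values in a linear subspace \<open>V\<close>
  of a Euclidean space, not in a Euclidean space type, because such a type has positive dimension,
  whereas the slice may be a single point.\<close>

type_synonym ('s, 'e) chart = "'s set \<times> ('s \<Rightarrow> 'e)"

abbreviation cdom :: "('s, 'e) chart \<Rightarrow> 's set" where
  "cdom c \<equiv> fst c"

abbreviation cmap :: "('s, 'e) chart \<Rightarrow> 's \<Rightarrow> 'e" where
  "cmap c \<equiv> snd c"

abbreviation cimg :: "('s, 'e) chart \<Rightarrow> 'e set" where
  "cimg c \<equiv> cmap c ` cdom c"

abbreviation cinv :: "('s, 'e) chart \<Rightarrow> 'e \<Rightarrow> 's" where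
  "cinv c \<equiv> inv_into (cdom c) (cmap c)"

definition smooth_atlas ::
    "'e::euclidean_space set \<Rightarrow> ('s::topological_space, 'e) chart set \<Rightarrow> bool" where
  "smooth_atlas V A \<longleftrightarrow>
     subspace V \<and> (\<Union>c\<in>A. cdom c) = UNIV \<and>
     (\<forall>c\<in>A. open (cdom c) \<and> openin (top_of_set V) (cimg c) \<and>
            homeomorphism (cdom c) (cimg c) (cmap c) (cinv c)) \<and>
     (\<forall>c\<in>A. \<forall>c'\<in>A. smooth_on (cmap c ` (cdom c \<inter> cdom c')) (cmap c' \<circ> cinv c))"

text \<open>A symplectic form is given by its coordinate expressions: \<open>\<omega> c x\<close> is the form at the point
  with coordinate \<open>x\<close> in the chart \<open>c\<close>.  Only the restriction of \<open>\<omega> c x\<close> to \<open>V \<times> V\<close> is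
  relevant.  The last two clauses are the coordinate expression of \<open>d\<omega> = 0\<close> (on the constant
  vector fields \<open>v\<^sub>1, v\<^sub>2, v\<^sub>3\<close>) and the transformation rule under a change of charts.\<close>

definition symplectic_form ::
    "'e::euclidean_space set \<Rightarrow> ('s::topological_space, 'e) chart set
     \<Rightarrow> (('s, 'e) chart \<Rightarrow> 'e \<Rightarrow> 'e \<Rightarrow> 'e \<Rightarrow> real) \<Rightarrow> bool" where
  "symplectic_form V A \<omega> \<longleftrightarrow>
     (\<forall>c\<in>A. \<forall>x\<in>cimg c. bilinear (\<omega> c x) \<and> (\<forall>v\<in>V. \<omega> c x v v = 0) \<and>
        (\<forall>v\<in>V. (\<forall>w\<in>V. \<omega> c x v w = 0) \<longrightarrow> v = 0)) \<and>
     (\<forall>c\<in>A. \<forall>v\<in>V. \<forall>w\<in>V. smooth_on (cimg c) (\<lambda>x. \<omega> c x v w)) \<and>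
     (\<forall>c\<in>A. \<forall>x\<in>cimg c. \<forall>v\<^sub>1\<in>V. \<forall>v\<^sub>2\<in>V. \<forall>v\<^sub>3\<in>V.
        deriv (\<lambda>t. \<omega> c (x + t *\<^sub>R v\<^sub>1) v\<^sub>2 v\<^sub>3) 0 +
        deriv (\<lambda>t. \<omega> c (x + t *\<^sub>R v\<^sub>2) v\<^sub>3 v\<^sub>1) 0 +
        deriv (\<lambda>t. \<omega> c (x + t *\<^sub>R v\<^sub>3) v\<^sub>1 v\<^sub>2) 0 = 0) \<and>
     (\<forall>c\<in>A. \<forall>c'\<in>A. \<forall>x\<in>cmap c ` (cdom c \<inter> cdom c'). \<forall>L.
        ((cmap c' \<circ> cinv c) has_derivative L) (at x within cmap c ` (cdom c \<inter> cdom c')) \<longrightarrow>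
        (\<forall>v\<in>V. \<forall>w\<in>V. \<omega> c x v w = \<omega> c' (cmap c' (cinv c x)) (L v) (L w)))"


section \<open>Invariant Hamiltonians on the normal form\<close>

definition SO3 :: "(real^3^3) set" where
  "SO3 = {g. orthogonal_matrix g \<and> det g = 1}"

text \<open>Phase space: an open subset of \<open>SO(3) \<times> so(3)\<^sup>* \<times> S\<close>, with \<open>so(3)\<^sup>*\<close> identified with
  \<open>\<real>\<^sup>3\<close>, invariant under \<open>g' \<cdot> (g, \<rho>, v) = (g' g, \<rho>, v)\<close> and containing the orbit
  \<open>SO(3) \<times> {0} \<times> {s\<^sub>e}\<close>, on which the momentum \<open>Coad\<^sub>g \<rho>\<close> vanishes.\<close>

definition phase_space ::
    "((real^3^3) \<times> (real^3) \<times> 's::topological_space) set \<Rightarrow> 's \<Rightarrow> bool" where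
  "phase_space P s\<^sub>e \<longleftrightarrow>
     openin (top_of_set (SO3 \<times> UNIV \<times> UNIV)) P \<and>
     (\<forall>g'\<in>SO3. \<forall>(g, \<rho>, v)\<in>P. (g' ** g, \<rho>, v) \<in> P) \<and>
     (\<forall>g\<in>SO3. (g, 0, s\<^sub>e) \<in> P)"

definition invariant_family ::
    "('s::topological_space, 'e::euclidean_space) chart set
     \<Rightarrow> ((real^3^3) \<times> (real^3) \<times> 's) set \<Rightarrow> (real^'d) set
     \<Rightarrow> (real^'d \<Rightarrow> (real^3^3) \<times> (real^3) \<times> 's \<Rightarrow> real) \<Rightarrow> bool" where
  "invariant_family A P U H \<longleftrightarrow>
     (\<forall>c\<in>A. smooth_on
        {(g, \<rho>, x, u). x \<in> cimg c \<and> (g, \<rho>, cinv c x) \<in> P \<and> u \<in> U}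
        (\<lambda>(g, \<rho>, x, u). H u (g, \<rho>, cinv c x))) \<and>
     (\<forall>u\<in>U. \<forall>g'\<in>SO3. \<forall>(g, \<rho>, v)\<in>P. H u (g' ** g, \<rho>, v) = H u (g, \<rho>, v))"

text \<open>The function \<open>H\<^sub>u(\<mu>, s)\<close> on the quotient \<open>P/SO(3)\<close>, an open subset of
  \<open>so(3)\<^sup>* \<times> S\<close>; each group orbit is represented by its point with \<open>g = 1\<close>.\<close>

definition reduced_space :: "((real^3^3) \<times> (real^3) \<times> 's) set \<Rightarrow> ((real^3) \<times> 's) set" where
  "reduced_space P = {(\<mu>, s). (mat 1, \<mu>, s) \<in> P}"

definition reduced ::
    "(real^'d \<Rightarrow> (real^3^3) \<times> (real^3) \<times> 's \<Rightarrow> real) \<Rightarrow> real^'d \<Rightarrow> real^3 \<Rightarrow> 's \<Rightarrow> real" where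
  "reduced H u \<mu> s = H u (mat 1, \<mu>, s)"

text \<open>\<open>d f(s) = 0\<close> for a function \<open>f\<close> defined near \<open>s\<close> on the manifold.  The derivative is taken
  within the chart image, that is, along \<open>V\<close>.\<close>

definition critical_point ::
    "('s, 'e::euclidean_space) chart set \<Rightarrow> ('s \<Rightarrow> real) \<Rightarrow> 's \<Rightarrow> bool" where
  "critical_point A f s \<longleftrightarrow>
     (\<forall>c\<in>A. s \<in> cdom c \<longrightarrow>
        ((\<lambda>x. f (cinv c x)) has_derivative (\<lambda>_. 0)) (at (cmap c s) within cimg c))"

text \<open>Second derivative of \<open>f\<close> at \<open>s\<close> in the chart \<open>c\<close>, in the directions \<open>v\<close> and \<open>w\<close>.\<close>

definition hessian ::
    "('s, 'e::euclidean_space) chart \<Rightarrow> ('s \<Rightarrow> real) \<Rightarrow> 's \<Rightarrow> 'e \<Rightarrow> 'e \<Rightarrow> real" where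
  "hessian c f s v w =
     deriv (\<lambda>t. deriv (\<lambda>r. f (cinv c (cmap c s + t *\<^sub>R v + r *\<^sub>R w))) 0) 0"

definition nondegenerate_hessian ::
    "'e::euclidean_space set \<Rightarrow> ('s, 'e) chart set \<Rightarrow> ('s \<Rightarrow> real) \<Rightarrow> 's \<Rightarrow> bool" where
  "nondegenerate_hessian V A f s \<longleftrightarrow>
     (\<forall>c\<in>A. s \<in> cdom c \<longrightarrow>
        (\<forall>v\<in>V. (\<forall>w\<in>V. hessian c f s v w = 0) \<longrightarrow> v = 0))"

text \<open>The following three notions concern the point \<open>(0, s\<^sub>e)\<close> and the Hamiltonian
  \<open>F = H\<^sub>0\<close> on the quotient.\<close>

definition zero_momentum_rel_equilibrium ::
    "('s, 'e::euclidean_space) chart set \<Rightarrow> (real^3 \<Rightarrow> 's \<Rightarrow> real) \<Rightarrow> 's \<Rightarrow> bool" where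
  "zero_momentum_rel_equilibrium A F s\<^sub>e \<longleftrightarrow> critical_point A (F 0) s\<^sub>e"

definition nondegenerate_rel_equilibrium ::
    "'e::euclidean_space set \<Rightarrow> ('s, 'e) chart set \<Rightarrow> (real^3 \<Rightarrow> 's \<Rightarrow> real) \<Rightarrow> 's \<Rightarrow> bool" where
  "nondegenerate_rel_equilibrium V A F s\<^sub>e \<longleftrightarrow>
     zero_momentum_rel_equilibrium A F s\<^sub>e \<and> nondegenerate_hessian V A (F 0) s\<^sub>e"

definition zero_momentum_equilibrium ::
    "('s, 'e::euclidean_space) chart set \<Rightarrow> (real^3 \<Rightarrow> 's \<Rightarrow> real) \<Rightarrow> 's \<Rightarrow> bool" where
  "zero_momentum_equilibrium A F s\<^sub>e \<longleftrightarrow>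
     zero_momentum_rel_equilibrium A F s\<^sub>e \<and>
     ((\<lambda>\<mu>. F \<mu> s\<^sub>e) has_derivative (\<lambda>_. 0)) (at 0)"

text \<open>The function \<open>s(\<mu>, u)\<close> of the implicit function theorem, on an open neighbourhood \<open>N\<close> of
  \<open>(0, 0)\<close>.\<close>

definition critical_branch ::
    "('s::topological_space, 'e::euclidean_space) chart set
     \<Rightarrow> ((real^3^3) \<times> (real^3) \<times> 's) set \<Rightarrow> (real^'d) set
     \<Rightarrow> (real^'d \<Rightarrow> (real^3^3) \<times> (real^3) \<times> 's \<Rightarrow> real) \<Rightarrow> 's
     \<Rightarrow> ((real^3) \<times> (real^'d)) set \<Rightarrow> ((real^3) \<times> (real^'d) \<Rightarrow> 's) \<Rightarrow> bool" where
  "critical_branch A P U H s\<^sub>e N s \<longleftrightarrow>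
     open N \<and> (0, 0) \<in> N \<and> continuous_on N s \<and>
     (\<forall>c\<in>A. smooth_on {p \<in> N. s p \<in> cdom c} (cmap c \<circ> s)) \<and>
     s (0, 0) = s\<^sub>e \<and>
     (\<forall>(\<mu>, u)\<in>N. u \<in> U \<and> (\<mu>, s (\<mu>, u)) \<in> reduced_space P \<and>
        critical_point A (reduced H u \<mu>) (s (\<mu>, u)))"

definition hfun ::
    "(real^'d \<Rightarrow> (real^3^3) \<times> (real^3) \<times> 's \<Rightarrow> real) \<Rightarrow> ((real^3) \<times> (real^'d) \<Rightarrow> 's)
     \<Rightarrow> real^'d \<Rightarrow> real^3 \<Rightarrow> real" where
  "hfun H s u \<mu> = reduced H u \<mu> (s (\<mu>, u))"


section \<open>The sets of relative equilibria\<close>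

definition orbit_momentum :: "real^3 \<Rightarrow> real" where
  "orbit_momentum \<mu> = ((\<mu>$1)\<^sup>2 + (\<mu>$2)\<^sup>2 + (\<mu>$3)\<^sup>2) / 2"

definition singular_set :: "(real^3 \<Rightarrow> real) \<Rightarrow> (real^3) set" where
  "singular_set f =
     {\<mu>. rank (jacobian (\<lambda>\<nu>. vector [f \<nu>, orbit_momentum \<nu>] :: real^2) (at \<mu>)) \<le> 1}"

definition R_H ::
    "(real^'d \<Rightarrow> (real^3^3) \<times> (real^3) \<times> 's \<Rightarrow> real)
     \<Rightarrow> ((real^3) \<times> (real^'d)) set \<Rightarrow> ((real^3) \<times> (real^'d) \<Rightarrow> 's) \<Rightarrow> real^'d \<Rightarrow> (real^3) set" where
  "R_H H N s u = {\<mu>. (\<mu>, u) \<in> N \<and> \<mu> \<in> singular_set (hfun H s u)}"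

definition R_H_family ::
    "(real^'d \<Rightarrow> (real^3^3) \<times> (real^3) \<times> 's \<Rightarrow> real)
     \<Rightarrow> ((real^3) \<times> (real^'d)) set \<Rightarrow> ((real^3) \<times> (real^'d) \<Rightarrow> 's)
     \<Rightarrow> ((real^3) \<times> (real^'d)) set" where
  "R_H_family H N s = {(\<mu>, u). \<mu> \<in> R_H H N s u}"

text \<open>Orthonormal coordinates on \<open>so(3)\<^sup>*\<close> are given by an orthonormal frame \<open>e\<close>:
  \<open>x = \<mu> \<bullet> e 1\<close>, \<open>y = \<mu> \<bullet> e 2\<close>, \<open>z = \<mu> \<bullet> e 3\<close>.\<close>

definition orthonormal_frame :: "(3 \<Rightarrow> real^3) \<Rightarrow> bool" where
  "orthonormal_frame e \<longleftrightarrow> (\<forall>i j. e i \<bullet> e j = (if i = j then 1 else 0))"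

definition quadratic_part :: "real \<Rightarrow> real \<Rightarrow> real \<Rightarrow> (3 \<Rightarrow> real^3) \<Rightarrow> real^3 \<Rightarrow> real" where
  "quadratic_part a b c e \<mu> = a * (\<mu> \<bullet> e 1)\<^sup>2 + b * (\<mu> \<bullet> e 2)\<^sup>2 + c * (\<mu> \<bullet> e 3)\<^sup>2"

definition G_fun ::
    "real \<Rightarrow> real \<Rightarrow> real \<Rightarrow> (3 \<Rightarrow> real^3) \<Rightarrow> real^3 \<Rightarrow> real^3 \<Rightarrow> real" where
  "G_fun a b c e \<alpha> \<mu> =
     quadratic_part a b c e \<mu> + \<alpha>$1 * (\<mu> \<bullet> e 1) + \<alpha>$2 * (\<mu> \<bullet> e 2) + \<alpha>$3 * (\<mu> \<bullet> e 3)"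

definition R_G :: "real \<Rightarrow> real \<Rightarrow> real \<Rightarrow> (3 \<Rightarrow> real^3) \<Rightarrow> real^3 \<Rightarrow> (real^3) set" where
  "R_G a b c e \<alpha> = singular_set (G_fun a b c e \<alpha>)"

definition R_G_family ::
    "real \<Rightarrow> real \<Rightarrow> real \<Rightarrow> (3 \<Rightarrow> real^3) \<Rightarrow> ((real^3) \<times> (real^3)) set" where
  "R_G_family a b c e = {(\<mu>, \<alpha>). \<mu> \<in> R_G a b c e \<alpha>}"

end

theory Submission
  imports Defs
begin

text \<open>Let \<open>F\<^sub>u\<close> be the gradient of \<open>h\<^sub>u\<close> in the given orthonormal coordinates, and
  \<open>d = (2a, 2b, 2c)\<close>.  The Jacobian of \<open>(f, \<bold>j)\<close> has rank at most 1 at \<open>\<mu>\<close> exactly when the gradient of \<open>f\<close>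
  at \<open>\<mu>\<close> and \<open>\<mu>\<close> itself are linearly dependent.  Hence \<open>\<R>(H\<^sub>u)\<close> is the set where \<open>F\<^sub>u(\<mu>)\<close> and \<open>\<mu>\<close> are
  dependent, and \<open>\<R>(G\<^sub>\<alpha>)\<close> the set where \<open>(d\<^sub>i \<nu>\<^sub>i + \<alpha>\<^sub>i)\<^sub>i\<close> and \<open>\<nu>\<close> are.  Dependence of a pair of vectors
  survives two kinds of operations, both of which may vary smoothly with \<open>(\<mu>, u)\<close>: the same invertible
  matrix may be applied to both vectors, and the pair may be replaced by two independent linear
  combinations of it.  It is therefore enough to turn the pair \<open>(F\<^sub>u(\<mu>), \<mu>)\<close> into a pair of the second
  form.

  The main step (\<open>row_splitting\<close>) produces, for each \<open>i\<close>, a row vector \<open>b\<^sub>i(\<mu>, u)\<close> near the \<open>i\<close>-th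
  unit vector with
  \<open>b\<^sub>i \<bullet> F\<^sub>u(\<mu>) = \<alpha>\<^sub>i(u) + l\<^sub>i(\<mu>, u) (b\<^sub>i \<bullet> \<mu>)\<close>, where \<open>l\<^sub>i\<close> is near \<open>d\<^sub>i\<close>.  The point is that \<open>\<alpha>\<^sub>i\<close> does not depend
  on \<open>\<mu>\<close>.  It comes from points \<open>C(l, u)\<close>, one for each \<open>l\<close> near \<open>d\<^sub>i\<close>, at which
  \<open>F\<^sub>u(C) - l C = \<alpha>\<^sub>i(u) e\<^sub>i\<close> (\<open>singular_direction_curve\<close>): by Hadamard's lemma
  \<open>F\<^sub>u(\<mu>) - l \<mu> = \<alpha>\<^sub>i(u) e\<^sub>i + (A - l) (\<mu> - C)\<close> for a matrix \<open>A(\<mu>, l, u)\<close>, and \<open>b\<^sub>i\<close>, \<open>l\<^sub>i\<close> solve \<open>b A = l b\<close>,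
  \<open>b\<^sub>i = 1\<close>.  The equation for \<open>C\<close> cuts out the critical level of a function of two variables with a
  nondegenerate saddle; \<open>\<alpha>\<^sub>i(u)\<close> is its critical value and \<open>C\<close> one of the two branches.

  With \<open>B\<close> the matrix of rows \<open>b\<^sub>i\<close> and \<open>\<nu> = B \<mu>\<close>, the pair becomes \<open>((\<alpha>\<^sub>i + l\<^sub>i \<nu>\<^sub>i)\<^sub>i, \<nu>)\<close>.  Linear combinations
  of the two columns act on the \<open>l\<^sub>i\<close> by Moebius transformations, and one of these sends the three numbers
  \<open>l\<^sub>i(\<mu>, u)\<close> to the three distinct numbers \<open>d\<^sub>i\<close>; this is where three degrees of freedom meet three
  eigenvalues.  A rescaling of the coordinates then restores \<open>\<alpha>\<^sub>i\<close> exactly (\<open>normal_form\<close>).  The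
  resulting change of coordinates is tangent to the identity at \<open>0\<close> for \<open>u = 0\<close>, hence a
  diffeomorphism on a small ball for all small \<open>u\<close> (\<open>near_identity_family_diffeo\<close>).

  The branch \<open>s(\<mu>, u)\<close> comes from the implicit function theorem in one chart around \<open>s\<^sub>e\<close>.\<close>

section \<open>Maps of class \<open>C\<^sup>k\<close> on open sets\<close>

abbreviation Ck_on :: "'a::real_normed_vector set \<Rightarrow> ('a \<Rightarrow> 'b::real_normed_vector) \<Rightarrow> nat \<Rightarrow> bool" where
  "Ck_on \<equiv> higher_differentiable_on"

lemma Ck_cong:
  assumes "open W" "Ck_on W f k" "\<And>x. x \<in> W \<Longrightarrow> f x = g x"
  shows "Ck_on W g k"
  using assms(2,3)
proof (induction k arbitrary: f g)
  case 0
  then show ?case by (simp cong: continuous_on_cong)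
next
  case (Suc k)
  have D: "(g has_derivative frechet_derivative f (at x)) (at x)" if "x \<in> W" for x
    using Suc.prems that \<open>open W\<close>
    by (auto simp: frechet_derivative_works intro: has_derivative_transform_within_open)
  show ?case
    unfolding higher_differentiable_on.simps
  proof (intro conjI ballI allI)
    fix x assume "x \<in> W" then show "g differentiable (at x)" using D differentiable_def by blast
  next
    fix v
    show "Ck_on W (\<lambda>x. frechet_derivative g (at x) v) k"
    proof (rule Suc.IH)
      show "Ck_on W (\<lambda>x. frechet_derivative f (at x) v) k"
        using Suc.prems by simp
      show "frechet_derivative f (at x) v = frechet_derivative g (at x) v" if "x \<in> W" for x
        using frechet_derivative_at[OF D[OF that]] by simp
    qed
  qed
qed

lemma Ck_SucI:
  assumes "open W" "\<And>x. x \<in> W \<Longrightarrow> (f has_derivative f' x) (at x)"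
    and "\<And>v. Ck_on W (\<lambda>x. f' x v) k"
  shows "Ck_on W f (Suc k)"
  unfolding higher_differentiable_on.simps
proof (intro conjI ballI allI)
  fix x assume "x \<in> W" then show "f differentiable (at x)" using assms differentiable_def by blast
next
  fix v
  show "Ck_on W (\<lambda>x. frechet_derivative f (at x) v) k"
    by (rule Ck_cong[OF assms(1) assms(3)[of v]])
      (use frechet_derivative_at[OF assms(2)] in auto)
qed

lemma Ck_SucD:
  assumes "Ck_on W f (Suc k)" "x \<in> W"
  shows "(f has_derivative frechet_derivative f (at x)) (at x)"
  using assms by (simp add: frechet_derivative_works)

lemma Ck_mono:
  assumes "Ck_on W f k" "W' \<subseteq> W"
  shows "Ck_on W' f k"
  using assms by (induction k arbitrary: f) (auto intro: continuous_on_subset)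

lemma Ck_lower:
  assumes "Ck_on W f (Suc k)"
  shows "Ck_on W f k"
  using assms
proof (induction k arbitrary: f)
  case 0
  then show ?case
    by (simp add: continuous_at_imp_continuous_on differentiable_imp_continuous_within)
next
  case (Suc k)
  then show ?case by simp
qed

lemma Ck_imp_continuous_on: "Ck_on W f k \<Longrightarrow> continuous_on W f"
  by (cases k) (simp_all add: continuous_at_imp_continuous_on differentiable_imp_continuous_within)

lemma Ck_const: "open W \<Longrightarrow> Ck_on W (\<lambda>x. c) k"
proof (induction k arbitrary: c)
  case (Suc k)
  then show ?case by (intro Ck_SucI[where f' = "\<lambda>x v. 0"]) auto
qed simp

lemma Ck_bounded_linear:
  assumes "open W" "bounded_linear f"
  shows "Ck_on W f k"
proof (cases k)
  case 0
  then show ?thesis using assms by (simp add: linear_continuous_on)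
next
  case (Suc m)
  show ?thesis
    unfolding Suc by (rule Ck_SucI[OF assms(1) bounded_linear_imp_has_derivative[OF assms(2)] Ck_const[OF assms(1)]])
qed

lemma Ck_add:
  assumes "open W" "Ck_on W f k" "Ck_on W g k"
  shows "Ck_on W (\<lambda>x. f x + g x) k"
  using assms(2,3)
proof (induction k arbitrary: f g)
  case 0
  then show ?case by (auto intro: continuous_intros)
next
  case (Suc k)
  show ?case
    by (rule Ck_SucI[OF \<open>open W\<close>, where f' = "\<lambda>x v. frechet_derivative f (at x) v + frechet_derivative g (at x) v"])
      (use Suc in \<open>auto intro!: has_derivative_add Ck_SucD[of W _ k]\<close>)
qed

lemma Ck_sum:
  assumes "open W" "\<And>i. i \<in> I \<Longrightarrow> Ck_on W (f i) k"
  shows "Ck_on W (\<lambda>x. \<Sum>i\<in>I. f i x) k"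
  using assms(2)
  by (induction I rule: infinite_finite_induct) (auto intro: Ck_add Ck_const assms(1))

lemma Ck_bilinear:
  assumes bl: "bounded_bilinear pr"
    and "open W" "Ck_on W f k" "Ck_on W g k"
  shows "Ck_on W (\<lambda>x. pr (f x) (g x)) k"
  using assms(3,4)
proof (induction k arbitrary: f g)
  case 0
  then show ?case by (auto intro: bounded_bilinear.continuous_on[OF bl])
next
  case (Suc k)
  show ?case
  proof (rule Ck_SucI[OF \<open>open W\<close>])
    show "((\<lambda>x. pr (f x) (g x)) has_derivative
        (\<lambda>v. pr (f x) (frechet_derivative g (at x) v) + pr (frechet_derivative f (at x) v) (g x))) (at x)"
      if "x \<in> W" for x
      using Suc.prems that by (intro bounded_bilinear.FDERIV[OF bl] Ck_SucD)
    show "Ck_on W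
        (\<lambda>x. pr (f x) (frechet_derivative g (at x) v) + pr (frechet_derivative f (at x) v) (g x)) k" for v
      using Suc.prems Ck_lower[OF Suc.prems(1)] Ck_lower[OF Suc.prems(2)]
      by (intro Ck_add Suc.IH assms(2)) auto
  qed
qed

text \<open>The derivative of a composition is expanded in the basis of the middle space, so that the
  induction on \<open>k\<close> meets only products of functions of lower class.\<close>

lemma Ck_compose:
  fixes f :: "'a::real_normed_vector \<Rightarrow> 'b::euclidean_space"
    and g :: "'b \<Rightarrow> 'c::real_normed_vector"
  assumes "open S" "open T" "f ` S \<subseteq> T"
    and "Ck_on S f k" "Ck_on T g k"
  shows "Ck_on S (\<lambda>x. g (f x)) k"
  using assms(4,5)
proof (induction k arbitrary: g)
  case 0
  then show ?case using assms(3) by (auto intro: continuous_on_compose2)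
next
  case (Suc k)
  have fT: "f x \<in> T" if "x \<in> S" for x using that assms(3) by auto
  let ?Df = "\<lambda>x. frechet_derivative f (at x)" and ?Dg = "\<lambda>y. frechet_derivative g (at y)"
  have dg: "(g has_derivative ?Dg (f x)) (at (f x))" if "x \<in> S" for x
    using Suc.prems(2) fT[OF that] by (rule Ck_SucD)
  have "Ck_on S (\<lambda>x. \<Sum>b\<in>Basis. (?Df x v \<bullet> b) *\<^sub>R ?Dg (f x) b) k" for v
  proof (intro Ck_sum Ck_bilinear[OF bounded_bilinear_scaleR] \<open>open S\<close>
      Ck_bilinear[OF bounded_bilinear_inner] Ck_const)
    show "Ck_on S (\<lambda>x. ?Df x v) k" using Suc.prems by simp
    show "Ck_on S (\<lambda>x. ?Dg (f x) b) k" for b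
      using Suc.prems(2) Ck_lower[OF Suc.prems(1)] by (intro Suc.IH) auto
  qed
  moreover have "(\<Sum>b\<in>Basis. (?Df x v \<bullet> b) *\<^sub>R ?Dg (f x) b) = ?Dg (f x) (?Df x v)"
    if "x \<in> S" for x v
  proof -
    interpret bounded_linear "?Dg (f x)" using dg[OF that] has_derivative_bounded_linear by blast
    have "?Dg (f x) (?Df x v) = ?Dg (f x) (\<Sum>b\<in>Basis. (?Df x v \<bullet> b) *\<^sub>R b)"
      by (simp add: euclidean_representation)
    then show ?thesis by (simp add: sum scaleR)
  qed
  ultimately have "Ck_on S (\<lambda>x. ?Dg (f x) (?Df x v)) k" for v
    by (rule Ck_cong[OF \<open>open S\<close>])
  moreover have "((\<lambda>x. g (f x)) has_derivative (\<lambda>v. ?Dg (f x) (?Df x v))) (at x)" if "x \<in> S" for x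
    using has_derivative_compose[OF Ck_SucD[OF Suc.prems(1) that] dg[OF that]] .
  ultimately show ?case
    by (intro Ck_SucI[OF \<open>open S\<close>]) auto
qed

lemma Ck_Pair:
  assumes "open W" "Ck_on W f k" "Ck_on W g k"
  shows "Ck_on W (\<lambda>x. (f x, g x)) k"
  using assms(2,3)
proof (induction k arbitrary: f g)
  case 0
  then show ?case by (auto intro: continuous_intros)
next
  case (Suc k)
  show ?case
    by (rule Ck_SucI[OF \<open>open W\<close>, where f' = "\<lambda>x v. (frechet_derivative f (at x) v, frechet_derivative g (at x) v)"])
      (use Suc in \<open>auto intro!: has_derivative_Pair Ck_SucD[of W _ k]\<close>)
qed

lemma Ck_inverse:
  fixes f :: "'a::real_normed_vector \<Rightarrow> real"
  assumes "open W" "Ck_on W f k" "\<And>x. x \<in> W \<Longrightarrow> f x \<noteq> 0"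
  shows "Ck_on W (\<lambda>x. inverse (f x)) k"
  using assms(2)
proof (induction k)
  case 0
  then show ?case using assms(3) by (auto intro!: continuous_intros)
next
  case (Suc k)
  note I = Suc.IH[OF Ck_lower[OF Suc.prems]]
  show ?case
  proof (rule Ck_SucI[OF \<open>open W\<close>])
    show "((\<lambda>x. inverse (f x)) has_derivative
        (\<lambda>v. (- 1) * ((inverse (f x) * inverse (f x)) * frechet_derivative f (at x) v))) (at x)"
      if "x \<in> W" for x
      using Deriv.has_derivative_inverse[OF assms(3)[OF that] Ck_SucD[OF Suc.prems that]]
      by (rule has_derivative_eq_rhs) (simp add: fun_eq_iff)
    show "Ck_on W
        (\<lambda>x. (- 1) * ((inverse (f x) * inverse (f x)) * frechet_derivative f (at x) v)) k" for v
      using Suc.prems I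
      by (intro Ck_bilinear[OF bounded_bilinear_mult] Ck_const \<open>open W\<close>) auto
  qed
qed

lemma linear_basis_sum:
  fixes f :: "'a::euclidean_space \<Rightarrow> 'b::real_vector"
  assumes "linear f"
  shows "(\<Sum>b\<in>Basis. (w \<bullet> b) *\<^sub>R f b) = f w"
proof -
  have "f w = f (\<Sum>b\<in>Basis. (w \<bullet> b) *\<^sub>R b)"
    by (simp add: euclidean_representation)
  then show ?thesis by (simp add: linear_sum[OF assms] linear_cmul[OF assms])
qed

lemma norm_linear_le_basis_sum:
  fixes L :: "'a::euclidean_space \<Rightarrow> 'b::real_normed_vector"
  assumes "linear L"
  shows "norm (L w) \<le> norm w * (\<Sum>b\<in>Basis. norm (L b))"
proof -
  have "norm (L w) = norm (\<Sum>b\<in>Basis. (w \<bullet> b) *\<^sub>R L b)" by (simp add: linear_basis_sum[OF assms])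
  also have "\<dots> \<le> (\<Sum>b\<in>Basis. norm ((w \<bullet> b) *\<^sub>R L b))" by (rule norm_sum)
  also have "\<dots> \<le> (\<Sum>b\<in>Basis. norm w * norm (L b))"
    by (intro sum_mono) (simp add: Basis_le_norm mult_right_mono)
  finally show ?thesis by (simp add: sum_distrib_left)
qed

text \<open>The inverses of the operators \<open>L y\<close> are bounded uniformly near \<open>x\<close>.\<close>

lemma continuous_linear_family_bounded_below:
  fixes L :: "'a::real_normed_vector \<Rightarrow> 'b::euclidean_space \<Rightarrow> 'b"
  assumes lin: "\<forall>\<^sub>F y in nhds x. linear (L y)" and inj: "inj (L x)"
    and cont: "\<And>b. isCont (\<lambda>y. L y b) x"
  obtains C where "C > 0" "\<forall>\<^sub>F y in nhds x. \<forall>w. norm w \<le> C * norm (L y w)"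
proof -
  have linx: "linear (L x)" using lin by (rule eventually_nhds_x_imp_x)
  obtain B where B: "B > 0" "\<And>w. B * norm w \<le> norm (L x w)"
    using linear_inj_bounded_below_pos[OF linx inj] by blast
  have cL: "((\<lambda>y. L y b) \<longlongrightarrow> L x b) (nhds x)" for b
    using cont[of b] tendsto_at_iff_tendsto_nhds[of "\<lambda>y. L y b" x] by (simp add: isCont_def)
  have "((\<lambda>y. \<Sum>b\<in>Basis. norm (L y b - L x b)) \<longlongrightarrow> (\<Sum>b\<in>(Basis::'b set). norm (L x b - L x b))) (nhds x)"
    by (intro tendsto_intros cL)
  then have "\<forall>\<^sub>F y in nhds x. (\<Sum>b\<in>Basis. norm (L y b - L x b)) < B / 2"
    using B(1) by (intro order_tendstoD) auto
  with lin have "\<forall>\<^sub>F y in nhds x. \<forall>w. norm w \<le> (2 / B) * norm (L y w)"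
  proof eventually_elim
    fix y assume s: "(\<Sum>b\<in>Basis. norm (L y b - L x b)) < B / 2" and y: "linear (L y)"
    show "\<forall>w. norm w \<le> (2 / B) * norm (L y w)"
    proof
      fix w
      have "norm (L y w - L x w) \<le> norm w * (\<Sum>b\<in>Basis. norm (L y b - L x b))"
        using norm_linear_le_basis_sum[OF linear_compose_sub[OF y linx]] .
      also have "\<dots> \<le> norm w * (B / 2)" using s by (intro mult_left_mono) auto
      finally have "norm (L y w - L x w) \<le> norm w * (B / 2)" .
      moreover have "norm (L x w) \<le> norm (L y w) + norm (L y w - L x w)"
        by (metis add.commute norm_minus_commute norm_triangle_sub)
      ultimately have "B / 2 * norm w \<le> norm (L y w)" using B(2)[of w] by (simp add: algebra_simps)
      then show "norm w \<le> (2 / B) * norm (L y w)"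
        using B(1) by (simp add: field_simps)
    qed
  qed
  with B(1) show thesis by (intro that[of "2 / B"]) auto
qed

text \<open>The solution of a linear system is as smooth as the system.  A derivative of \<open>J\<close> solves a linear
  system with the same operator \<open>L\<close>, whose right-hand side involves \<open>J\<close> itself and first derivatives
  of \<open>L\<close> and \<open>v\<close>; induction on \<open>k\<close> therefore closes.  This is what makes the inverse function theorem smooth.\<close>

lemma Ck_linear_solution:
  fixes L :: "'a::real_normed_vector \<Rightarrow> 'b::euclidean_space \<Rightarrow> 'b"
  assumes "open W"
    and lin: "\<And>x. x \<in> W \<Longrightarrow> linear (L x)" and inj: "\<And>x. x \<in> W \<Longrightarrow> inj (L x)"
    and "\<And>b. Ck_on W (\<lambda>x. L x b) k"
    and "Ck_on W v k" and "\<And>x. x \<in> W \<Longrightarrow> L x (J x) = v x"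
  shows "Ck_on W J k"
proof -
  have evW: "\<forall>\<^sub>F y in nhds x. y \<in> W" if "x \<in> W" for x
    using that \<open>open W\<close> by (rule eventually_nhds_in_open[rotated])
  have contL: "isCont (\<lambda>y. L y b) x" if "x \<in> W" for x b
    using Ck_imp_continuous_on[OF assms(4)[of b]] that \<open>open W\<close> by (simp add: continuous_on_eq_continuous_at)
  have surjL: "surj (L x)" if "x \<in> W" for x
    using linear_injective_imp_surjective[OF lin[OF that] inj[OF that]] by simp
  note rep = linear_basis_sum[OF lin]
  have bdd: "\<exists>C>0. \<forall>\<^sub>F y in nhds x. \<forall>w. norm w \<le> C * norm (L y w)" if "x \<in> W" for x
    by (rule continuous_linear_family_bounded_below[OF _ inj[OF that] contL[OF that]])
      (use eventually_mono[OF evW[OF that] lin] in auto)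
  show ?thesis
    using assms(4-6)
  proof (induction k arbitrary: v J)
    case 0
    have "isCont J x" if x: "x \<in> W" for x
    proof -
      obtain C where C: "\<forall>\<^sub>F y in nhds x. \<forall>w. norm w \<le> C * norm (L y w)" using bdd[OF x] by blast
      let ?G = "\<lambda>y. C * norm (v y - (\<Sum>b\<in>Basis. (J x \<bullet> b) *\<^sub>R L y b))"
      have "isCont v x"
        using 0(2) x \<open>open W\<close> by (simp add: continuous_on_eq_continuous_at)
      then have "isCont ?G x" by (intro continuous_intros contL x)
      then have "(?G \<longlongrightarrow> 0) (at x)" using 0(3)[OF x] rep[OF x] by (simp add: isCont_def)
      moreover have "\<forall>\<^sub>F y in nhds x. norm (J y - J x) \<le> ?G y"
        using C evW[OF x]
      proof eventually_elim
        case (elim y)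
        have "L y (J y - J x) = v y - L y (J x)"
          using 0(3)[OF elim(2)] linear_diff[OF lin[OF elim(2)]] by simp
        then show ?case
          using elim(1)[rule_format, of "J y - J x"] by (simp add: rep[OF elim(2)])
      qed
      then have "\<forall>\<^sub>F y in at x. norm (J y - J x) \<le> ?G y" by (simp add: eventually_at_filter eventually_mono)
      ultimately have "((\<lambda>y. J y - J x) \<longlongrightarrow> 0) (at x)"
        by (rule Lim_null_comparison[rotated])
      then show "isCont J x" by (simp add: isCont_def LIM_zero_iff)
    qed
    then show ?case by (simp add: continuous_on_eq_continuous_at[OF \<open>open W\<close>])
  next
    case (Suc k)
    let ?dL = "\<lambda>x b. frechet_derivative (\<lambda>x. L x b) (at x)"
    let ?R' = "\<lambda>x h. frechet_derivative v (at x) h + (-1) *\<^sub>R (\<Sum>b\<in>Basis. (J x \<bullet> b) *\<^sub>R ?dL x b h)"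
    define J' where "J' = (\<lambda>x h. inv (L x) (?R' x h))"
    have dL: "((\<lambda>x. L x b) has_derivative ?dL x b) (at x)" if "x \<in> W" for x b
      using Suc.prems(1)[of b] that by (rule Ck_SucD)
    have dv: "(v has_derivative frechet_derivative v (at x)) (at x)" if "x \<in> W" for x
      using Suc.prems(2) that by (rule Ck_SucD)
    have L_J': "L x (J' x h) = ?R' x h" if "x \<in> W" for x h
      unfolding J'_def
      using surjL[OF that] by (rule surj_f_inv_f)
    have blJ': "bounded_linear (J' x)" if "x \<in> W" for x
    proof -
      have "bounded_linear (inv (L x))"
        unfolding linear_conv_bounded_linear[symmetric]
        by (rule linearI; rule inv_f_eq[OF inj[OF that]])
          (use surjL[OF that] in
            \<open>simp_all add: linear_add[OF lin[OF that]] linear_cmul[OF lin[OF that]] surj_f_inv_f\<close>)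
      moreover have "bounded_linear (?R' x)"
        using dL[OF that] dv[OF that]
        by (intro bounded_linear_intros) (auto intro: has_derivative_bounded_linear)
      ultimately show ?thesis unfolding J'_def by (rule bounded_linear_compose)
    qed
    have "(J has_derivative J' x) (at x)" if x: "x \<in> W" for x
    proof -
      obtain C where C: "\<forall>\<^sub>F y in nhds x. \<forall>w. norm w \<le> C * norm (L y w)" using bdd[OF x] by blast
      \<comment> \<open>The error \<open>?e\<close> of the linear approximation is mapped by \<open>L y\<close> to \<open>?G\<close>, whose derivative vanishes
        at \<open>x\<close> by the choice of \<open>J'\<close>; the uniform bound on the inverses carries this back to \<open>?e\<close>.\<close>
      let ?e = "\<lambda>y. J y - J x - J' x (y - x)"
      let ?G = "\<lambda>y. v y - (\<Sum>b\<in>Basis. ((J x + J' x (y - x)) \<bullet> b) *\<^sub>R L y b)"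
      have dJ': "((\<lambda>y. J' x (y - x)) has_derivative J' x) (at x)"
        by (rule bounded_linear.has_derivative[OF blJ'[OF x]]) (auto intro!: derivative_eq_intros)
      have "(?G has_derivative (\<lambda>h. frechet_derivative v (at x) h -
          (\<Sum>b\<in>Basis. (J x \<bullet> b) *\<^sub>R ?dL x b h + (J' x h \<bullet> b) *\<^sub>R L x b))) (at x)"
        using linear_0[OF bounded_linear.linear[OF blJ'[OF x]]]
        by (auto intro!: derivative_eq_intros dv dL dJ' x simp: fun_eq_iff)
      then have dG: "(?G has_derivative (\<lambda>h. 0)) (at x)"
        using L_J'[OF x] by (simp add: sum.distrib rep[OF x])
      have J'0: "J' x 0 = 0" using blJ'[OF x] by (simp add: bounded_linear.linear linear_0)
      have G0: "?G x = 0" by (simp add: J'0 rep[OF x] Suc.prems(3)[OF x])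
      have le: "\<forall>\<^sub>F y in nhds x. norm (?e y) \<le> C * norm (?G y)"
        using C evW[OF x]
      proof eventually_elim
        case (elim y)
        have "?G y = L y (?e y)"
          using Suc.prems(3)[OF elim(2)] lin[OF elim(2)]
          by (simp add: rep[OF elim(2)] linear_diff linear_add)
        then show ?case using elim(1) by simp
      qed
      have "((\<lambda>y. C * (norm (?G y) / norm (y - x))) \<longlongrightarrow> C * 0) (at x)"
        using dG G0 by (intro tendsto_mult_left) (simp add: has_derivative_iff_norm)
      then have lim: "((\<lambda>y. C * (norm (?G y) / norm (y - x))) \<longlongrightarrow> 0) (at x)" by simp
      have "\<forall>\<^sub>F y in at x. norm (norm (?e y) / norm (y - x)) \<le> C * (norm (?G y) / norm (y - x))"
        using le unfolding eventually_at_filter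
        by eventually_elim (simp add: divide_right_mono)
      then have "((\<lambda>y. norm (?e y) / norm (y - x)) \<longlongrightarrow> 0) (at x)"
        by (rule Lim_null_comparison[OF _ lim])
      then show ?thesis using blJ'[OF x] by (simp add: has_derivative_iff_norm)
    qed
    moreover have "Ck_on W (\<lambda>x. J' x h) k" for h
    proof (rule Suc.IH[OF Ck_lower[OF Suc.prems(1)] _ L_J'])
      show "Ck_on W (\<lambda>x. ?R' x h) k"
      proof (intro Ck_add Ck_sum Ck_bilinear[OF bounded_bilinear_scaleR] \<open>open W\<close>
          Ck_bilinear[OF bounded_bilinear_inner] Ck_const)
        show "Ck_on W (\<lambda>x. frechet_derivative v (at x) h) k" using Suc.prems by simp
        show "Ck_on W (\<lambda>x. ?dL x b h) k" for b
          using Suc.prems(1)[of b] by simp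
        show "Ck_on W J k"
          by (rule Suc.IH[OF Ck_lower[OF Suc.prems(1)] Ck_lower[OF Suc.prems(2)] Suc.prems(3)])
      qed
    qed
    ultimately show ?case by (intro Ck_SucI[OF \<open>open W\<close>])
  qed
qed

section \<open>Germs of smooth maps\<close>

text \<open>Smoothness near a point.  Statements about germs, combined with \<open>eventually\<close> in \<open>nhds\<close>, spare
  every construction below the bookkeeping of its domain; domains are chosen once, at the end.\<close>

definition smooth_at :: "('a::real_normed_vector \<Rightarrow> 'b::real_normed_vector) \<Rightarrow> 'a \<Rightarrow> bool" where
  "smooth_at f x \<longleftrightarrow> (\<exists>W. open W \<and> x \<in> W \<and> (\<forall>k. Ck_on W f k))"

named_theorems smooth_intros

lemma smooth_atI:
  "open W \<Longrightarrow> x \<in> W \<Longrightarrow> (\<And>k. Ck_on W f k) \<Longrightarrow> smooth_at f x"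
  unfolding smooth_at_def by blast

lemma smooth_atE:
  assumes "smooth_at f x"
  obtains W where "open W" "x \<in> W" "\<And>k. Ck_on W f k"
  using assms unfolding smooth_at_def by blast

lemma smooth_at_common_domain:
  assumes "smooth_at f x" "smooth_at g x"
  obtains W where "open W" "x \<in> W" "\<And>k. Ck_on W f k" "\<And>k. Ck_on W g k"
proof -
  obtain U where U: "open U" "x \<in> U" "\<And>k. Ck_on U f k"
    using smooth_atE[OF assms(1)] by metis
  obtain V where V: "open V" "x \<in> V" "\<And>k. Ck_on V g k"
    using smooth_atE[OF assms(2)] by metis
  show thesis
    by (rule that[of "U \<inter> V", OF _ _ Ck_mono[OF U(3)] Ck_mono[OF V(3)]]) (use U V in auto)
qed

lemma smooth_at_cong:
  assumes "smooth_at f x" "\<forall>\<^sub>F y in nhds x. f y = g y"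
  shows "smooth_at g x"
proof -
  obtain U where U: "open U" "x \<in> U" "\<And>k. Ck_on U f k"
    using smooth_atE[OF assms(1)] by metis
  obtain V where V: "open V" "x \<in> V" "\<And>y. y \<in> V \<Longrightarrow> f y = g y"
    using assms(2) unfolding eventually_nhds by blast
  show ?thesis
    by (rule smooth_atI[of "U \<inter> V", OF _ _ Ck_cong[OF _ Ck_mono[OF U(3)]]]) (use U V in auto)
qed

lemma eventually_smooth_at:
  assumes "smooth_at f x" shows "\<forall>\<^sub>F y in nhds x. smooth_at f y"
  using assms unfolding smooth_at_def eventually_nhds by blast

lemma smooth_at_const [smooth_intros]: "smooth_at (\<lambda>x. c) x"
  by (rule smooth_atI[of UNIV]) (auto intro: Ck_const)

lemma smooth_at_bounded_linear: "bounded_linear f \<Longrightarrow> smooth_at f x"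
  by (rule smooth_atI[of UNIV]) (auto intro: Ck_bounded_linear)

lemma smooth_at_compose:
  fixes f :: "'a::real_normed_vector \<Rightarrow> 'b::euclidean_space"
  assumes "smooth_at g (f x)" "smooth_at f x"
  shows "smooth_at (\<lambda>x. g (f x)) x"
proof -
  obtain S where S: "open S" "x \<in> S" "\<And>k. Ck_on S f k"
    using smooth_atE[OF assms(2)] by metis
  obtain T where T: "open T" "f x \<in> T" "\<And>k. Ck_on T g k"
    using smooth_atE[OF assms(1)] by metis
  have "continuous_on S f" using S(3)[of 0] by simp
  then have o: "open (S \<inter> f -` T)" using S(1) T(1) by (simp add: continuous_open_preimage)
  show ?thesis
    by (rule smooth_atI[OF o _ Ck_compose[OF o T(1) _ Ck_mono[OF S(3)] T(3)]])
      (use S T in auto)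
qed

text \<open>For a linear outer map the middle space may be any normed space.\<close>

lemma smooth_at_linear_image:
  assumes "bounded_linear h" "smooth_at f x"
  shows "smooth_at (\<lambda>x. h (f x)) x"
proof -
  obtain W where W: "open W" "x \<in> W" "\<And>k. Ck_on W f k"
    using smooth_atE[OF assms(2)] by metis
  have "Ck_on W (\<lambda>x. h (f x)) k" for k
    using W(3)
  proof (induction k arbitrary: f)
    case 0
    have "continuous_on W f" using 0[of 0] by simp
    then show ?case using bounded_linear.continuous_on[OF assms(1)] by simp
  next
    case (Suc k)
    show ?case
    proof (rule Ck_SucI[OF W(1)])
      show "((\<lambda>x. h (f x)) has_derivative (\<lambda>v. h (frechet_derivative f (at x) v))) (at x)" if "x \<in> W" for x
        using bounded_linear.has_derivative[OF assms(1) Ck_SucD[OF Suc.prems that]] .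
      show "Ck_on W (\<lambda>x. h (frechet_derivative f (at x) v)) k" for v
        using Suc.prems[of "Suc _"] by (intro Suc.IH) simp
    qed
  qed
  then show ?thesis using W by (intro smooth_atI)
qed

lemma smooth_at_ident [smooth_intros]: "smooth_at (\<lambda>x. x) x"
  by (rule smooth_at_bounded_linear) simp

lemmas smooth_at_linear_images [smooth_intros] =
  smooth_at_linear_image[OF bounded_linear_fst] smooth_at_linear_image[OF bounded_linear_snd]
  smooth_at_linear_image[OF bounded_linear_vec_nth]

lemma smooth_at_add [smooth_intros]:
  "smooth_at f x \<Longrightarrow> smooth_at g x \<Longrightarrow> smooth_at (\<lambda>x. f x + g x) x"
  by (erule (1) smooth_at_common_domain, rule smooth_atI[OF _ _ Ck_add])

lemma smooth_at_minus [smooth_intros]: "smooth_at f x \<Longrightarrow> smooth_at (\<lambda>x. - f x) x"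
  by (rule smooth_at_linear_image[OF bounded_linear_minus[OF bounded_linear_ident]])

lemma smooth_at_diff [smooth_intros]:
  "smooth_at f x \<Longrightarrow> smooth_at g x \<Longrightarrow> smooth_at (\<lambda>x. f x - g x) x"
  using smooth_at_add[of f x "\<lambda>x. - g x"] smooth_at_minus[of g] by simp

lemma smooth_at_sum [smooth_intros]:
  "(\<And>i. i \<in> I \<Longrightarrow> smooth_at (f i) x) \<Longrightarrow> smooth_at (\<lambda>x. \<Sum>i\<in>I. f i x) x"
  by (induction I rule: infinite_finite_induct) (auto intro: smooth_intros)

lemma smooth_at_bilinear:
  assumes "bounded_bilinear pr" "smooth_at f x" "smooth_at g x"
  shows "smooth_at (\<lambda>x. pr (f x) (g x)) x"
  using assms(2,3)
  by (rule smooth_at_common_domain) (rule smooth_atI[OF _ _ Ck_bilinear[OF assms(1)]])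

lemmas smooth_at_products [smooth_intros] =
  smooth_at_bilinear[OF bounded_bilinear_scaleR] smooth_at_bilinear[OF bounded_bilinear_inner]
  smooth_at_bilinear[OF bounded_bilinear_mult]

lemma smooth_at_Pair [smooth_intros]:
  "smooth_at f x \<Longrightarrow> smooth_at g x \<Longrightarrow> smooth_at (\<lambda>x. (f x, g x)) x"
  by (erule (1) smooth_at_common_domain, rule smooth_atI[OF _ _ Ck_Pair])

lemma smooth_at_imp_isCont: "smooth_at f x \<Longrightarrow> isCont f x"
  by (elim smooth_atE) (metis continuous_on_eq_continuous_at higher_differentiable_on.simps(1))

lemma smooth_at_imp_tendsto: "smooth_at f x \<Longrightarrow> (f \<longlongrightarrow> f x) (nhds x)"
  using smooth_at_imp_isCont[of f x] tendsto_at_iff_tendsto_nhds[of f x] by (simp add: isCont_def)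

lemma smooth_at_eventually:
  assumes "smooth_at f x" "\<forall>\<^sub>F y in nhds (f x). P y"
  shows "\<forall>\<^sub>F x in nhds x. P (f x)"
  using smooth_at_imp_tendsto[OF assms(1)] assms(2) by (rule eventually_compose_filterlim[rotated])

lemma eventually_along_smooth:
  assumes "smooth_at f x" "\<forall>\<^sub>F y in nhds y0. P y" "f x = y0"
  shows "\<forall>\<^sub>F x in nhds x. P (f x)"
  using smooth_at_eventually[OF assms(1)] assms(2,3) by simp

lemma smooth_on_if_smooth_at: "(\<And>x. x \<in> X \<Longrightarrow> smooth_at f x) \<Longrightarrow> smooth_on X f"
  unfolding smooth_on_def smooth_at_def by blast

lemma smooth_at_inverse [smooth_intros]:
  fixes f :: "'a::real_normed_vector \<Rightarrow> real"
  assumes "smooth_at f x" "f x \<noteq> 0"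
  shows "smooth_at (\<lambda>x. inverse (f x)) x"
proof -
  obtain W where W: "open W" "x \<in> W" "\<And>k. Ck_on W f k"
    using smooth_atE[OF assms(1)] by metis
  have "continuous_on W f" using W(3)[of 0] by simp
  then have o: "open (W \<inter> f -` (- {0}))" using W(1) by (rule continuous_open_preimage) auto
  show ?thesis
    by (rule smooth_atI[OF o _ Ck_inverse[OF o Ck_mono[OF W(3)]]])
      (use W assms in auto)
qed

lemma smooth_at_divide [smooth_intros]:
  fixes f :: "'a::real_normed_vector \<Rightarrow> real"
  shows "smooth_at f x \<Longrightarrow> smooth_at g x \<Longrightarrow> g x \<noteq> 0 \<Longrightarrow> smooth_at (\<lambda>x. f x / g x) x"
  unfolding divide_inverse by (intro smooth_intros)

lemma smooth_at_vec_lambda [smooth_intros]: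
  fixes f :: "'a::real_normed_vector \<Rightarrow> 'n::finite \<Rightarrow> real"
  assumes "\<And>i. smooth_at (\<lambda>x. f x i) x"
  shows "smooth_at (\<lambda>x. \<chi> i. f x i) x"
proof -
  have "smooth_at (\<lambda>x. \<Sum>i\<in>UNIV. f x i *\<^sub>R axis i (1::real)) x"
    using assms by (intro smooth_intros)
  moreover have "(\<lambda>x. \<Sum>i\<in>UNIV. f x i *\<^sub>R axis i (1::real)) = (\<lambda>x. \<chi> i. f x i)"
    by (auto simp: fun_eq_iff vec_eq_iff axis_def if_distrib cong: if_cong)
  ultimately show ?thesis by simp
qed

lemma smooth_at_if [smooth_intros]:
  "(P \<Longrightarrow> smooth_at f x) \<Longrightarrow> (\<not> P \<Longrightarrow> smooth_at g x) \<Longrightarrow> smooth_at (\<lambda>x. if P then f x else g x) x"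
  by (cases P) simp_all

lemma smooth_at_imp_has_derivative:
  "smooth_at f x \<Longrightarrow> (f has_derivative frechet_derivative f (at x)) (at x)"
  by (elim smooth_atE) (rule Ck_SucD)

lemma has_derivative_on_line:
  assumes "smooth_at f (0, 0)"
  shows "((\<lambda>t. f (t *\<^sub>R v, 0)) has_derivative (\<lambda>s. frechet_derivative f (at (0, 0)) (s *\<^sub>R v, 0))) (at 0)"
  using smooth_at_imp_has_derivative[OF assms]
  by (intro has_derivative_compose[where g = f and f = "\<lambda>t. (t *\<^sub>R v, 0)"]) (auto intro!: derivative_eq_intros)

lemma smooth_at_linear_family:
  fixes g :: "'a::real_normed_vector \<Rightarrow> 'b::euclidean_space \<Rightarrow> 'c::real_normed_vector"
  assumes "\<And>b. smooth_at (\<lambda>x. g x b) x" "smooth_at v x" "\<forall>\<^sub>F y in nhds x. linear (g y)"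
  shows "smooth_at (\<lambda>x. g x (v x)) x"
proof (rule smooth_at_cong)
  show "smooth_at (\<lambda>x. \<Sum>b\<in>Basis. (v x \<bullet> b) *\<^sub>R g x b) x"
    using assms by (intro smooth_intros)
  show "\<forall>\<^sub>F y in nhds x. (\<Sum>b\<in>Basis. (v y \<bullet> b) *\<^sub>R g y b) = g y (v y)"
    using assms(3) by eventually_elim (rule linear_basis_sum)
qed

lemma smooth_at_frechet_derivative:
  fixes f :: "'a::euclidean_space \<Rightarrow> 'b::real_normed_vector"
  assumes "smooth_at f x" "smooth_at v x"
  shows "smooth_at (\<lambda>x. frechet_derivative f (at x) (v x)) x"
proof (rule smooth_at_linear_family)
  show "smooth_at (\<lambda>x. frechet_derivative f (at x) b) x" for b
    using assms(1) by (elim smooth_atE) (metis smooth_atI higher_differentiable_on.simps(2))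
  show "\<forall>\<^sub>F y in nhds x. linear (frechet_derivative f (at y))"
    using eventually_smooth_at[OF assms(1)]
    by eventually_elim (use smooth_at_imp_has_derivative has_derivative_linear in blast)
qed fact

section \<open>Hadamard's lemma and the implicit function theorem\<close>

lemma Ck_integral:
  fixes f :: "'a::euclidean_space \<times> real \<Rightarrow> 'b::euclidean_space"
  assumes "open X" "convex X" and W: "open W" "X \<times> {0..1} \<subseteq> W"
    and "\<And>k. Ck_on W f k"
  shows "Ck_on X (\<lambda>x. integral {0..1} (\<lambda>t. f (x, t))) k"
  using assms(5)
proof (induction k arbitrary: f)
  case 0
  have "continuous_on (X \<times> cbox 0 1) (\<lambda>(x, t). f (x, t))"
    using 0[of 0] W(2) by (auto intro: continuous_on_subset)
  from integral_continuous_on_param[OF this] show ?case by simp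
next
  case (Suc k)
  let ?D = "\<lambda>v z. frechet_derivative f (at z) (v, 0)"
  have hdD: "Ck_on W (?D v) j" for v j
    using Suc.prems[of "Suc j"] by simp
  have df: "((\<lambda>x. f (x, t)) has_derivative (\<lambda>v. ?D v (x, t))) (at x)" if "x \<in> X" "t \<in> {0..1}" for x t
  proof -
    have "(x, t) \<in> W" using that W(2) by auto
    from Ck_SucD[OF Suc.prems this] show ?thesis
      by (rule has_derivative_compose[rotated]) (auto intro!: derivative_eq_intros)
  qed
  have bl: "bounded_linear (\<lambda>v. ?D v (x, t))" if "x \<in> X" "t \<in> {0..1}" for x t
    using df[OF that] by (rule has_derivative_bounded_linear)
  have cont: "continuous_on (X \<times> cbox 0 1) (\<lambda>(x, t). Blinfun (\<lambda>v. ?D v (x, t)))"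
  proof (rule continuous_on_blinfun_componentwise)
    fix i :: 'a
    have "continuous_on (X \<times> cbox 0 1) (?D i)"
      using hdD[of i 0] W(2) by (auto intro: continuous_on_subset)
    then show "continuous_on (X \<times> cbox 0 1) (\<lambda>z. blinfun_apply (case z of (x, t) \<Rightarrow> Blinfun (\<lambda>v. ?D v (x, t))) i)"
      by (rule continuous_on_eq) (auto simp: bounded_linear_Blinfun_apply bl)
  qed
  have contx: "continuous_on (cbox 0 1) (\<lambda>t. f (x, t))" if "x \<in> X" for x
    using Suc.prems[of 0] W(2) that
    by (auto intro!: continuous_on_compose2[of W f] continuous_intros)
  have der: "((\<lambda>x. integral {0..1} (\<lambda>t. f (x, t))) has_derivative
      (\<lambda>v. integral {0..1} (\<lambda>t. ?D v (x, t)))) (at x)" if x: "x \<in> X" for x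
  proof -
    have "((\<lambda>x. integral (cbox 0 1) (\<lambda>t. f (x, t))) has_derivative
        integral (cbox 0 1) (\<lambda>t. Blinfun (\<lambda>v. ?D v (x, t)))) (at x within X)"
      using contx
      by (intro leibniz_rule cont x assms(2))
        (auto simp: bounded_linear_Blinfun_apply bl
          intro: has_derivative_at_withinI[OF df] integrable_continuous_real)
    moreover have "blinfun_apply (integral (cbox 0 1) (\<lambda>t. Blinfun (\<lambda>v. ?D v (x, t)))) v =
        integral {0..1} (\<lambda>t. ?D v (x, t))" for v
    proof -
      have "continuous_on (cbox 0 1) (\<lambda>t. Blinfun (\<lambda>v. ?D v (x, t)))"
        using continuous_on_compose2[OF cont continuous_on_Pair[OF continuous_on_const continuous_on_id], of x "cbox 0 1"] x
        by auto
      then have "(\<lambda>t. Blinfun (\<lambda>v. ?D v (x, t))) integrable_on cbox 0 1"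
        by (rule integrable_continuous)
      then have "blinfun_apply (integral (cbox 0 1) (\<lambda>t. Blinfun (\<lambda>v. ?D v (x, t)))) v =
          integral (cbox 0 1) (\<lambda>t. blinfun_apply (Blinfun (\<lambda>v. ?D v (x, t))) v)"
        by (rule blinfun_apply_integral)
      also have "\<dots> = integral (cbox 0 1) (\<lambda>t. ?D v (x, t))"
        by (intro integral_cong) (auto simp: bounded_linear_Blinfun_apply bl x)
      finally show ?thesis by simp
    qed
    ultimately show ?thesis
      using at_within_open[OF x assms(1)] by (auto elim: has_derivative_eq_rhs simp: fun_eq_iff)
  qed
  show ?case
    by (rule Ck_SucI[OF assms(1) der Suc.IH[OF hdD]])
qed

lemma Ck_Union:
  assumes "\<And>W. W \<in> \<W> \<Longrightarrow> open W" "\<And>W. W \<in> \<W> \<Longrightarrow> Ck_on W f k"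
  shows "Ck_on (\<Union>\<W>) f k"
  using assms
proof (induction k arbitrary: f)
  case 0
  then show ?case by (simp add: continuous_on_open_Union)
next
  case (Suc k)
  show ?case
    unfolding higher_differentiable_on.simps
  proof (intro conjI allI ballI Suc.IH)
    show "f differentiable at x" if "x \<in> \<Union>\<W>" for x
      using that Suc.prems(2) by auto
  qed (use Suc.prems in auto)
qed

lemma smooth_at_integral:
  fixes f :: "'a::euclidean_space \<times> real \<Rightarrow> 'b::euclidean_space"
  assumes "\<And>t. t \<in> {0..1} \<Longrightarrow> smooth_at f (x, t)"
  shows "smooth_at (\<lambda>x. integral {0..1} (\<lambda>t. f (x, t))) x"
proof -
  let ?\<W> = "{W. open W \<and> (\<forall>k. Ck_on W f k)}"
  have loc: "Ck_on (\<Union>?\<W>) f k" for k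
    by (rule Ck_Union) auto
  have o: "open (\<Union>?\<W>)" by (rule open_Union) auto
  have "{x} \<times> {0..1} \<subseteq> \<Union>?\<W>"
  proof clarify
    fix t :: real assume "t \<in> {0..1}"
    then show "(x, t) \<in> \<Union>?\<W>" using assms[of t] unfolding smooth_at_def by auto
  qed
  then obtain X where X: "open X" "x \<in> X" "X \<times> {0..1} \<subseteq> \<Union>?\<W>"
    using Elementary_Topology.tube_lemma[OF compact_Icc o, of x 0 1] by (elim impE exE conjE meta_impE) auto
  then obtain e where e: "e > 0" "ball x e \<subseteq> X" by (meson openE)
  have sub: "ball x e \<times> {0..1} \<subseteq> \<Union>?\<W>" using e(2) X(3) by (rule order_trans[OF Sigma_mono[OF _ order_refl]])
  show ?thesis
    by (rule smooth_atI[of "ball x e", OF _ _ Ck_integral[OF _ _ o sub loc]]) (use e in auto)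
qed

lemma eventually_nhds_product_ball:
  fixes x\<^sub>0 :: "'x::real_normed_vector" and u\<^sub>0 :: "'p::real_normed_vector"
  assumes "\<forall>\<^sub>F z in nhds (x\<^sub>0, u\<^sub>0). P z"
  obtains e where "e > 0" "\<And>x u. x \<in> ball x\<^sub>0 e \<Longrightarrow> u \<in> ball u\<^sub>0 e \<Longrightarrow> P (x, u)"
proof -
  obtain S where S: "open S" "(x\<^sub>0, u\<^sub>0) \<in> S" "\<And>z. z \<in> S \<Longrightarrow> P z"
    using assms unfolding eventually_nhds by blast
  obtain A B where AB: "open A" "open B" "(x\<^sub>0, u\<^sub>0) \<in> A \<times> B" "A \<times> B \<subseteq> S"
    by (rule open_prod_elim[OF S(1,2)])
  obtain d where d: "d > 0" "ball x\<^sub>0 d \<subseteq> A" using AB(1,3) by (auto elim: openE)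
  obtain e where e: "e > 0" "ball u\<^sub>0 e \<subseteq> B" using AB(2,3) by (auto elim: openE)
  show thesis
  proof (rule that[of "min d e"])
    fix x u assume "x \<in> ball x\<^sub>0 (min d e)" "u \<in> ball u\<^sub>0 (min d e)"
    then have "(x, u) \<in> A \<times> B" using d(2) e(2) by (auto simp: subset_eq)
    then show "P (x, u)" using AB(4) S(3) by blast
  qed (use d e in simp)
qed

text \<open>\<open>g (x, q)\<close> is the average of the partial derivative of \<open>G\<close> over the segment from \<open>(0, q)\<close> to
  \<open>(x, q)\<close>.  It is written through its values on the basis so that it is linear for every argument,
  also outside the domain of \<open>G\<close>.\<close>

lemma smooth_hadamard:
  fixes G :: "'x::euclidean_space \<times> 'q::euclidean_space \<Rightarrow> 'y::euclidean_space"
  assumes "smooth_at G (0, q\<^sub>0)"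
  obtains g where "\<And>v. smooth_at (\<lambda>z. g z v) (0, q\<^sub>0)" "\<And>z. linear (g z)"
    "\<forall>\<^sub>F (x, q) in nhds (0, q\<^sub>0). G (x, q) = G (0, q) + g (x, q) x"
    "\<And>v. g (0, q\<^sub>0) v = frechet_derivative G (at (0, q\<^sub>0)) (v, 0)"
proof -
  define D where "D = (\<lambda>b z. frechet_derivative G (at z) (b, 0))"
  define g where "g = (\<lambda>z v. \<Sum>b\<in>Basis. (v \<bullet> b) *\<^sub>R integral {0..1} (\<lambda>t. D b (t *\<^sub>R fst z, snd z)))"
  obtain W where W: "open W" "(0, q\<^sub>0) \<in> W" "\<And>k. Ck_on W G k"
    using smooth_atE[OF assms] by metis
  have sW: "smooth_at G z" if "z \<in> W" for z using W that by (intro smooth_atI)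
  have D: "smooth_at (D b) z" if "z \<in> W" for b z
    unfolding D_def by (intro smooth_at_frechet_derivative sW that smooth_intros)
  have "smooth_at (\<lambda>z. g z v) (0, q\<^sub>0)" for v
    unfolding g_def
  proof (intro smooth_intros)
    fix b
    have "smooth_at (\<lambda>z. D b (snd z *\<^sub>R fst (fst z), snd (fst z))) ((0, q\<^sub>0), t)" for t
      by (rule smooth_at_compose[of "D b"]) (auto intro!: smooth_intros D W)
    then have "smooth_at (\<lambda>z. integral {0..1} (\<lambda>t. (\<lambda>z. D b (snd z *\<^sub>R fst (fst z), snd (fst z))) (z, t))) (0, q\<^sub>0)"
      by (intro smooth_at_integral)
    then show "smooth_at (\<lambda>z. integral {0..1} (\<lambda>t. D b (t *\<^sub>R fst z, snd z))) (0, q\<^sub>0)" by simp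
  qed
  moreover have "linear (g z)" for z
    unfolding g_def by (rule linearI) (auto simp: inner_add_left scaleR_add_left sum.distrib scaleR_sum_right)
  moreover have "\<forall>\<^sub>F (x, q) in nhds (0, q\<^sub>0). G (x, q) = G (0, q) + g (x, q) x"
  proof -
    obtain e where e: "e > 0" "\<And>x q. x \<in> ball 0 e \<Longrightarrow> q \<in> ball q\<^sub>0 e \<Longrightarrow> (x, q) \<in> W"
      using eventually_nhds_product_ball[OF eventually_nhds_in_open[OF W(1,2)]] by metis
    have "G (x, q) = G (0, q) + g (x, q) x" if "x \<in> ball 0 e" "q \<in> ball q\<^sub>0 e" for x q
    proof -
      have in_W: "(t *\<^sub>R x, q) \<in> W" if t: "t \<in> {0..1}" for t
      proof -
        have "norm (t *\<^sub>R x) \<le> norm x" using t by (simp add: mult_left_le_one_le)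
        then show ?thesis using \<open>x \<in> ball 0 e\<close> \<open>q \<in> ball q\<^sub>0 e\<close> e(2) by auto
      qed
      have dG: "((\<lambda>t. G (t *\<^sub>R x, q)) has_vector_derivative (\<Sum>b\<in>Basis. (x \<bullet> b) *\<^sub>R D b (t *\<^sub>R x, q))) (at t within {0..1})"
        if t: "t \<in> {0..1}" for t
      proof -
        note d = smooth_at_imp_has_derivative[OF sW[OF in_W[OF t]]]
        have "((\<lambda>t. G (t *\<^sub>R x, q)) has_derivative (\<lambda>s. frechet_derivative G (at (t *\<^sub>R x, q)) (s *\<^sub>R x, 0))) (at t)"
          by (rule has_derivative_compose[where f = "\<lambda>t. (t *\<^sub>R x, q)", OF _ d]) (auto intro!: derivative_eq_intros)
        moreover have "frechet_derivative G (at (t *\<^sub>R x, q)) (s *\<^sub>R x, 0) = s *\<^sub>R (\<Sum>b\<in>Basis. (x \<bullet> b) *\<^sub>R D b (t *\<^sub>R x, q))" for s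
        proof -
          have l: "linear (frechet_derivative G (at (t *\<^sub>R x, q)))" using d by (rule has_derivative_linear)
          have "linear (\<lambda>v. D v (t *\<^sub>R x, q))"
            unfolding D_def using linear_compose[OF _ l, of "\<lambda>v. (v, 0)"]
            by (simp add: o_def linear_iff)
          from linear_basis_sum[OF this] show ?thesis
            using linear_cmul[OF l, of s "(x, 0)"] by (simp add: D_def)
        qed
        ultimately show ?thesis by (simp add: has_vector_derivative_def has_derivative_at_withinI)
      qed
      have cD: "continuous_on {0..1} (\<lambda>t. D b (t *\<^sub>R x, q))" for b
      proof (intro continuous_at_imp_continuous_on ballI)
        fix t :: real assume "t \<in> {0..1}"
        then have "smooth_at (D b) (t *\<^sub>R x, q)" by (intro D in_W)
        then have "smooth_at (\<lambda>t. D b (t *\<^sub>R x, q)) t"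
          by (rule smooth_at_compose) (intro smooth_intros)
        then show "isCont (\<lambda>t. D b (t *\<^sub>R x, q)) t" by (rule smooth_at_imp_isCont)
      qed
      have "((\<lambda>t. \<Sum>b\<in>Basis. (x \<bullet> b) *\<^sub>R D b (t *\<^sub>R x, q)) has_integral (G (1 *\<^sub>R x, q) - G (0 *\<^sub>R x, q))) {0..1}"
        by (rule fundamental_theorem_of_calculus) (use dG in auto)
      then have "G (x, q) - G (0, q) = integral {0..1} (\<lambda>t. \<Sum>b\<in>Basis. (x \<bullet> b) *\<^sub>R D b (t *\<^sub>R x, q))"
        by (simp add: integral_unique)
      also have "\<dots> = g (x, q) x"
        unfolding g_def
        by (subst integral_sum) (auto intro!: integrable_continuous_real continuous_intros cD)
      finally show ?thesis by (simp add: algebra_simps)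
    qed
    moreover have "\<forall>\<^sub>F z in nhds (0, q\<^sub>0). z \<in> ball 0 e \<times> ball q\<^sub>0 e"
      by (intro eventually_nhds_in_open open_Times) (use e in auto)
    ultimately show ?thesis by (auto elim!: eventually_mono)
  qed
  moreover have "g (0, q\<^sub>0) v = frechet_derivative G (at (0, q\<^sub>0)) (v, 0)" for v
  proof -
    have l: "linear (frechet_derivative G (at (0, q\<^sub>0)))"
      using smooth_at_imp_has_derivative[OF assms] by (rule has_derivative_linear)
    have "linear (\<lambda>v. D v (0, q\<^sub>0))"
      unfolding D_def using linear_compose[OF _ l, of "\<lambda>v. (v, 0)"]
      by (simp add: o_def linear_iff)
    from linear_basis_sum[OF this] show ?thesis by (simp add: g_def D_def)
  qed
  ultimately show thesis by (rule that)
qed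

text \<open>The \<open>C\<^sup>1\<close> inverse function theorem provides \<open>g\<close>; its derivative solves a linear system with
  coefficients \<open>Df (g y)\<close>, so \<open>g\<close> gains one degree of differentiability after the other.\<close>

lemma smooth_local_inverse:
  fixes f :: "'a::euclidean_space \<Rightarrow> 'a"
  assumes "smooth_at f x\<^sub>0" "inj (frechet_derivative f (at x\<^sub>0))"
  obtains g where "smooth_at g (f x\<^sub>0)" "g (f x\<^sub>0) = x\<^sub>0" "\<forall>\<^sub>F y in nhds (f x\<^sub>0). f (g y) = y"
proof -
  obtain W where W: "open W" "x\<^sub>0 \<in> W" "\<And>k. Ck_on W f k"
    using smooth_atE[OF assms(1)] by metis
  let ?D = "\<lambda>x. frechet_derivative f (at x)"
  have der: "(f has_derivative ?D x) (at x)" if "x \<in> W" for x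
    using W(3) that by (rule Ck_SucD)
  have bl: "bounded_linear (?D x)" if "x \<in> W" for x
    using der[OF that] by (rule has_derivative_bounded_linear)
  define f' where "f' = (\<lambda>x. Blinfun (?D x))"
  have f': "blinfun_apply (f' x) = ?D x" if "x \<in> W" for x
    unfolding f'_def using bl[OF that] by (rule bounded_linear_Blinfun_apply)
  have "continuous_on W f'"
  proof (rule continuous_on_blinfun_componentwise)
    fix i :: 'a
    have "continuous_on W (\<lambda>x. ?D x i)" using W(3)[of "Suc 0"] by simp
    then show "continuous_on W (\<lambda>x. blinfun_apply (f' x) i)"
      by (rule continuous_on_eq) (simp add: f')
  qed
  moreover have "(f has_derivative blinfun_apply (f' x)) (at x)" if "x \<in> W" for x
    using der[OF that] by (simp add: f'[OF that])
  moreover obtain h where h: "linear h" "h \<circ> ?D x\<^sub>0 = id"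
    using linear_injective_left_inverse[OF _ assms(2)] bl[OF W(2)] by (metis bounded_linear.linear)
  have "Blinfun h o\<^sub>L f' x\<^sub>0 = id_blinfun"
    using h by (intro blinfun_eqI) (simp add: f'[OF W(2)] bounded_linear_Blinfun_apply linear_conv_bounded_linear pointfree_idE)
  ultimately obtain U' V g g' where *: "open U'" "U' \<subseteq> W" "x\<^sub>0 \<in> U'" "open V" "f x\<^sub>0 \<in> V" "homeomorphism U' V f g"
    "\<And>y. y \<in> V \<Longrightarrow> (g has_derivative (g' y)) (at y)"
    "\<And>y. y \<in> V \<Longrightarrow> g' y = inv (blinfun_apply (f' (g y)))"
    "\<And>y. y \<in> V \<Longrightarrow> bij (blinfun_apply (f' (g y)))"
    using inverse_function_theorem[OF W(1) _ _ W(2), of f f'] by metis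
  have gV: "g y \<in> U'" "f (g y) = y" if "y \<in> V" for y
    using *(6) that by (auto simp: homeomorphism_def)
  have gW: "g y \<in> W" if "y \<in> V" for y using gV(1)[OF that] *(2) by auto
  have "Ck_on V g k" for k
  proof (induction k)
    case 0
    then show ?case using *(6) by (simp add: homeomorphism_def)
  next
    case (Suc k)
    have "Ck_on V (\<lambda>y. g' y v) k" for v
    proof (rule Ck_linear_solution[OF *(4)])
      fix y assume y: "y \<in> V"
      show "linear (?D (g y))" using bl[OF gW[OF y]] by (rule bounded_linear.linear)
      show "inj (?D (g y))" using *(9)[OF y] by (simp add: f' gW y bij_is_inj)
      show "?D (g y) (g' y v) = v"
        using *(9)[OF y] *(8)[OF y] by (simp add: f' gW y surj_f_inv_f bij_is_surj)
    next
      show "Ck_on V (\<lambda>y. ?D (g y) b) k" for b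
        by (rule Ck_compose[OF *(4) W(1) _ Suc.IH, of "\<lambda>x. ?D x b"]) (use gW W(3)[of "Suc k"] in auto)
      show "Ck_on V (\<lambda>y. v) k" by (rule Ck_const[OF *(4)])
    qed
    then show ?case by (intro Ck_SucI[OF *(4,7)])
  qed
  then have "smooth_at g (f x\<^sub>0)" using *(4,5) by (intro smooth_atI)
  moreover have "g (f x\<^sub>0) = x\<^sub>0" using *(3,6) by (simp add: homeomorphism_def)
  moreover have "\<forall>\<^sub>F y in nhds (f x\<^sub>0). f (g y) = y"
    using *(4,5) gV(2) unfolding eventually_nhds by blast
  ultimately show thesis by (rule that)
qed

text \<open>Nondegeneracy is expressed by derivatives along lines: in the applications the restriction of
  \<open>f\<close> to a line is an explicit function, while its full derivative is unwieldy.\<close>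

lemma smooth_implicit_function:
  fixes f :: "'x::euclidean_space \<times> 'p::euclidean_space \<Rightarrow> 'x"
  assumes sm: "smooth_at f (x\<^sub>0, p\<^sub>0)" and f0: "f (x\<^sub>0, p\<^sub>0) = 0"
    and nd: "\<And>v. ((\<lambda>t. f (x\<^sub>0 + t *\<^sub>R v, p\<^sub>0)) has_vector_derivative 0) (at 0) \<Longrightarrow> v = 0"
  obtains g where "smooth_at g p\<^sub>0" "g p\<^sub>0 = x\<^sub>0" "\<forall>\<^sub>F p in nhds p\<^sub>0. f (g p, p) = 0"
proof -
  define F where "F = (\<lambda>z. (f z, snd z))"
  let ?D = "frechet_derivative f (at (x\<^sub>0, p\<^sub>0))"
  have df: "(f has_derivative ?D) (at (x\<^sub>0, p\<^sub>0))" using sm by (rule smooth_at_imp_has_derivative)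
  have smF: "smooth_at F (x\<^sub>0, p\<^sub>0)" unfolding F_def by (intro smooth_intros sm)
  have "(F has_derivative (\<lambda>h. (?D h, snd h))) (at (x\<^sub>0, p\<^sub>0))"
    unfolding F_def by (auto intro!: derivative_eq_intros df)
  then have DF: "frechet_derivative F (at (x\<^sub>0, p\<^sub>0)) = (\<lambda>h. (?D h, snd h))"
    by (rule frechet_derivative_at[symmetric])
  have l: "linear ?D" using df by (rule has_derivative_linear)
  have ker: "v = 0" if "?D (v, 0) = 0" for v
  proof (rule nd)
    have "((\<lambda>t. f (x\<^sub>0 + t *\<^sub>R v, p\<^sub>0)) has_derivative (\<lambda>s. ?D (s *\<^sub>R v, 0))) (at 0)"
      by (rule has_derivative_compose[of "\<lambda>t. (x\<^sub>0 + t *\<^sub>R v, p\<^sub>0)" _ _ _ f]) (auto intro!: derivative_eq_intros simp: df)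
    moreover have "?D (s *\<^sub>R v, 0) = 0" for s
      using linear_cmul[OF l, of s "(v, 0)"] that by simp
    ultimately show "((\<lambda>t. f (x\<^sub>0 + t *\<^sub>R v, p\<^sub>0)) has_vector_derivative 0) (at 0)"
      by (simp add: has_vector_derivative_def)
  qed
  have "inj (frechet_derivative F (at (x\<^sub>0, p\<^sub>0)))"
    unfolding linear_injective_0[OF has_derivative_linear[OF smooth_at_imp_has_derivative[OF smF]]]
    using ker by (auto simp: DF zero_prod_def)
  then obtain G where G: "smooth_at G (0, p\<^sub>0)" "G (0, p\<^sub>0) = (x\<^sub>0, p\<^sub>0)" "\<forall>\<^sub>F y in nhds (0, p\<^sub>0). F (G y) = y"
    using smooth_local_inverse[OF smF] f0 by (auto simp: F_def)
  show thesis
  proof (rule that[of "\<lambda>p. fst (G (0, p))"])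
    have sP: "smooth_at (\<lambda>p. (0::'x, p)) p\<^sub>0" by (intro smooth_intros)
    show "smooth_at (\<lambda>p. fst (G (0, p))) p\<^sub>0"
      by (intro smooth_intros smooth_at_compose[OF _ sP, of G] G(1))
    show "fst (G (0, p\<^sub>0)) = x\<^sub>0" using G(2) by simp
    have "\<forall>\<^sub>F p in nhds p\<^sub>0. F (G (0, p)) = (0, p)"
      using smooth_at_eventually[OF sP, of "\<lambda>y. F (G y) = y"] G(3) by simp
    then show "\<forall>\<^sub>F p in nhds p\<^sub>0. f (fst (G (0, p)), p) = 0"
      by eventually_elim (metis F_def fst_conv prod.collapse snd_conv)
  qed
qed

section \<open>Splitting off one row\<close>

text \<open>Hadamard's lemma with a moving base point \<open>c\<close>, applied once to \<open>F\<close> and once more to the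
  resulting matrix \<open>A\<close>; \<open>Q\<close> is the quadratic remainder.\<close>

lemma smooth_second_order_hadamard:
  fixes F :: "'x::euclidean_space \<times> 'p::euclidean_space \<Rightarrow> 'y::euclidean_space"
  assumes "smooth_at F (0, p\<^sub>0)"
  obtains A Q where
    "\<And>v. smooth_at (\<lambda>z. A z v) (0, 0, p\<^sub>0)" "\<And>z. linear (A z)"
    "\<forall>\<^sub>F (x, c, u) in nhds (0, 0, p\<^sub>0). F (c + x, u) = F (c, u) + A (x, c, u) x"
    "\<And>v. A (0, 0, p\<^sub>0) v = frechet_derivative F (at (0, p\<^sub>0)) (v, 0)"
    "\<And>v. smooth_at (\<lambda>(z, v). Q z v) ((0, 0, p\<^sub>0), v)"
    "\<And>z t v. Q z (t *\<^sub>R v) = t\<^sup>2 *\<^sub>R (Q z v :: 'y)"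
    "\<forall>\<^sub>F (x, c, u) in nhds (0, 0, p\<^sub>0). \<forall>m v. x = m *\<^sub>R v \<longrightarrow> A (x, c, u) v = A (0, c, u) v + m *\<^sub>R Q (x, c, u) v"
proof -
  let ?G = "\<lambda>z. F (fst (snd z) + fst z, snd (snd z))"
  have sm: "smooth_at ?G (0, 0, p\<^sub>0)"
    by (rule smooth_at_compose[of F]) (auto intro!: smooth_intros assms)
  show thesis
  proof (rule smooth_hadamard[OF sm])
    fix A assume A: "\<And>v. smooth_at (\<lambda>z. A z v) (0, 0, p\<^sub>0)" "\<And>z. linear (A z)"
      "\<forall>\<^sub>F (x, q) in nhds (0, 0, p\<^sub>0). ?G (x, q) = ?G (0, q) + A (x, q) x"
      "\<And>v. A (0, 0, p\<^sub>0) v = frechet_derivative ?G (at (0, 0, p\<^sub>0)) (v, 0)"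
    have ex: "\<exists>h. (\<forall>v. smooth_at (\<lambda>z. h z v) (0, 0, p\<^sub>0)) \<and> (\<forall>z. linear (h z)) \<and>
      (\<forall>\<^sub>F (x, q) in nhds (0, 0, p\<^sub>0). A (x, q) b = A (0, q) b + h (x, q) x)" (is "\<exists>h. ?P b h") for b
      by (rule smooth_hadamard[OF A(1)[of b]]) (intro exI conjI allI)
    define h where "h = (\<lambda>b. SOME h. ?P b h)"
    have "?P b (h b)" for b unfolding h_def using ex[of b] by (rule someI_ex)
    then have h: "\<And>b v. smooth_at (\<lambda>z. h b z v) (0, 0, p\<^sub>0)" "\<And>b z. linear (h b z)"
      "\<And>b. \<forall>\<^sub>F (x, q) in nhds (0, 0, p\<^sub>0). A (x, q) b = A (0, q) b + h b (x, q) x"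
      by blast+
    define Q where "Q = (\<lambda>z v. \<Sum>b\<in>Basis. (v \<bullet> b) *\<^sub>R h b z v)"
    show thesis
    proof (rule that[OF A(1,2)])
      show "\<forall>\<^sub>F (x, c, u) in nhds (0, 0, p\<^sub>0). F (c + x, u) = F (c, u) + A (x, c, u) x"
        using A(3) by (simp add: case_prod_unfold)
      show "A (0, 0, p\<^sub>0) v = frechet_derivative F (at (0, p\<^sub>0)) (v, 0)" for v
      proof -
        let ?D = "\<lambda>z. frechet_derivative F (at (0, p\<^sub>0)) (fst (snd z) + fst z, snd (snd z))"
        have DG: "(?G has_derivative ?D) (at (0, 0, p\<^sub>0))"
          using smooth_at_imp_has_derivative[OF assms]
          by (intro has_derivative_compose[where g = F and f = "\<lambda>z. (fst (snd z) + fst z, snd (snd z))"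
                and f' = "\<lambda>z. (fst (snd z) + fst z, snd (snd z))"])
            (auto intro!: derivative_intros)
        have "A (0, 0, p\<^sub>0) v = ?D (v, 0)"
          unfolding A(4) by (rule fun_cong[OF frechet_derivative_at[OF DG], symmetric])
        also have "?D (v, 0) = frechet_derivative F (at (0, p\<^sub>0)) (v, 0)" by simp
        finally show ?thesis .
      qed
      show "smooth_at (\<lambda>(z, v). Q z v) ((0, 0, p\<^sub>0), v)" for v
      proof -
        have s: "smooth_at fst ((0::'x, 0::'x, p\<^sub>0), v)" "smooth_at snd ((0::'x, 0::'x, p\<^sub>0), v)"
          by (rule smooth_at_bounded_linear, rule bounded_linear_fst bounded_linear_snd)+
        have "smooth_at (\<lambda>z. h b (fst z) w) ((0, 0, p\<^sub>0), v)" for b w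
          by (rule smooth_at_compose[OF _ s(1), of "\<lambda>z. h b z w"]) (simp add: h(1))
        then have "smooth_at (\<lambda>z. h b (fst z) (snd z)) ((0, 0, p\<^sub>0), v)" for b
          by (rule smooth_at_linear_family[OF _ s(2)]) (simp add: h(2))
        then show ?thesis
          unfolding Q_def case_prod_unfold by (intro smooth_intros s)
      qed
      show "Q z (t *\<^sub>R v) = t\<^sup>2 *\<^sub>R Q z v" for z t v
        by (simp add: Q_def linear_cmul[OF h(2)] scaleR_sum_right power2_eq_square mult_ac)
      have "\<forall>\<^sub>F z in nhds (0, 0, p\<^sub>0). \<forall>b\<in>Basis. A z b = A (0, snd z) b + h b z (fst z)"
        by (intro eventually_ball_finite ballI) (use h(3) in \<open>auto simp: case_prod_unfold\<close>)
      then show "\<forall>\<^sub>F (x, c, u) in nhds (0, 0, p\<^sub>0). \<forall>m v. x = m *\<^sub>R v \<longrightarrow> A (x, c, u) v = A (0, c, u) v + m *\<^sub>R Q (x, c, u) v"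
      proof eventually_elim
        case (elim z)
        obtain x c u where z: "z = (x, c, u)" by (cases z) auto
        have "A (x, c, u) v = A (0, c, u) v + m *\<^sub>R Q (x, c, u) v" if "x = m *\<^sub>R v" for m v
        proof -
          have "A (x, c, u) v = (\<Sum>b\<in>Basis. (v \<bullet> b) *\<^sub>R A z b)"
            using linear_basis_sum[OF A(2)[of z], of v] by (simp add: z)
          also have "\<dots> = (\<Sum>b\<in>Basis. (v \<bullet> b) *\<^sub>R A (0, c, u) b) + (\<Sum>b\<in>Basis. (v \<bullet> b) *\<^sub>R h b z x)"
            using elim by (simp add: z scaleR_add_right sum.distrib)
          also have "\<dots> = A (0, c, u) v + m *\<^sub>R Q (x, c, u) v"
            using linear_basis_sum[OF A(2)[of "(0, c, u)"], of v]
            by (simp add: Q_def that z linear_cmul[OF h(2)] scaleR_sum_right mult.commute)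
          finally show ?thesis .
        qed
        then show ?case by (simp add: z)
      qed
    qed
  qed
qed

lemma has_vector_derivative_vec_nth:
  "(f has_vector_derivative f') F \<Longrightarrow> ((\<lambda>t. f t $ i) has_vector_derivative f' $ i) F"
  by (rule bounded_linear.has_vector_derivative[OF bounded_linear_vec_nth])

lemma vector_derivative_zeroD:
  fixes f :: "real \<Rightarrow> real"
  assumes "(f has_vector_derivative 0) (at x)" "(f has_real_derivative D) (at x)"
  shows "D = 0"
  using DERIV_unique[OF assms(2), of 0] assms(1) by (simp add: has_real_derivative_iff_has_vector_derivative)

lemma left_eigenvector_from_columns:
  fixes L :: "real^'n \<Rightarrow> real^'n"
  assumes "linear L" and col: "\<And>k. b \<bullet> L (axis k 1) = l * b $ k"
  shows "b \<bullet> L v = l * (b \<bullet> v)"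
proof -
  have "linear (\<lambda>v. b \<bullet> L v)" "linear (\<lambda>v. l * (b \<bullet> v))"
    using assms(1) by (auto simp: linear_iff inner_add_right algebra_simps)
  then show ?thesis
  proof (rule linear_eq_stdbasis[THEN fun_cong])
    fix e :: "real^'n" assume "e \<in> Basis"
    then obtain k where k: "e = axis k 1" by (auto simp: Basis_vec_def)
    show "b \<bullet> L e = l * (b \<bullet> e)" by (simp add: k col inner_axis)
  qed
qed

text \<open>Why the curve exists: the equations with index \<open>j \<noteq> i\<close> of \<open>F (C, u) - l C = \<alpha> e\<^sub>i\<close> can be solved
  for \<open>C\<^sub>j\<close> in terms of \<open>t = C\<^sub>i\<close> and \<open>l\<close>, and the remaining component becomes a function \<open>K(t, l, u)\<close> with
  \<open>K(t, l, 0) = t (d\<^sub>i - l) + O(t\<^sup>2)\<close>.  Its critical point at \<open>(0, d\<^sub>i)\<close> is a nondegenerate saddle and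
  persists for small \<open>u\<close>; \<open>\<alpha>(u)\<close> is the critical value.  The critical level consists of two curves
  that cross at the critical point, and \<open>C\<close> is the one that is a graph over the \<open>l\<close>-axis.  On it the
  value \<open>\<alpha>\<close> does not depend on \<open>l\<close>, which is the purpose of the construction.

  The proof does not introduce \<open>K\<close>.  It finds the critical point \<open>(c, l)\<close> together with a left null vector
  \<open>b\<close> of \<open>D\<^sub>\<mu>F - l\<close>, and then the branch after the blow-up \<open>C = c + m \<sigma>\<close> with \<open>m\<close> the distance of the
  eigenvalue parameter from \<open>l\<close>.\<close>

lemma singular_direction_curve:
  fixes F :: "(real^'n) \<times> 'p::euclidean_space \<Rightarrow> real^'n" and d :: "'n \<Rightarrow> real"
  assumes sm: "smooth_at F (0, 0)" and F0: "F (0, 0) = 0"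
    and DF: "\<And>v. frechet_derivative F (at (0, 0)) (v, 0) = (\<chi> j. d j * v $ j)"
    and dist: "\<And>j. j \<noteq> i \<Longrightarrow> d j \<noteq> d i"
  obtains C \<alpha> where
    "smooth_at C (d i, 0)" "C (d i, 0) = 0" "smooth_at \<alpha> 0" "\<alpha> 0 = 0"
    "\<forall>\<^sub>F (l, u) in nhds (d i, 0). F (C (l, u), u) - l *\<^sub>R C (l, u) = \<alpha> u *\<^sub>R axis i (1::real)"
    "\<And>v. ((\<lambda>t. C (d i + t * v, 0)) has_vector_derivative 0) (at 0)"
proof (rule smooth_second_order_hadamard[OF sm])
  fix A Q
  assume AQ: "\<And>v. smooth_at (\<lambda>z. A z v) (0, 0, 0)" "\<And>z. linear (A z)"
    "\<forall>\<^sub>F (x, c, u) in nhds (0, 0, 0). F (c + x, u) = F (c, u) + A (x, c, u) x"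
    "\<And>v. A (0, 0, 0) v = frechet_derivative F (at (0, 0)) (v, 0)"
    "\<And>v. smooth_at (\<lambda>(z, v). Q z v) ((0, 0, 0), v)"
    "\<And>z t v. Q z (t *\<^sub>R v) = t\<^sup>2 *\<^sub>R (Q z v :: real^'n)"
    "\<forall>\<^sub>F (x, c, u) in nhds (0, 0, 0). \<forall>m v. x = m *\<^sub>R v \<longrightarrow> A (x, c, u) v = A (0, c, u) v + m *\<^sub>R Q (x, c, u) v"
  have A0: "A (0, 0, 0) v = (\<chi> j. d j * v $ j)" for v using AQ(4) DF by simp
  have sF: "smooth_at (\<lambda>z. F (f z)) z" if "smooth_at f z" "f z = (0, 0)" for f :: "'z::real_normed_vector \<Rightarrow> _" and z
    using smooth_at_compose[of F f z] that sm by simp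
  have sA: "smooth_at (\<lambda>z. A (f z) (v z)) z"
    if "smooth_at f z" "f z = (0, 0, 0)" "smooth_at v z" for f :: "'z::real_normed_vector \<Rightarrow> _" and v z
  proof (rule smooth_at_linear_family[OF _ that(3)])
    show "smooth_at (\<lambda>z. A (f z) b) z" for b using smooth_at_compose[of "\<lambda>z. A z b" f z] that AQ(1) by simp
  qed (simp add: AQ(2))
  have sQ: "smooth_at (\<lambda>z. Q (f z) (v z)) z"
    if "smooth_at f z" "f z = (0, 0, 0)" "smooth_at v z" for f :: "'z::real_normed_vector \<Rightarrow> _" and v z
    using smooth_at_compose[of "\<lambda>(z, v). Q z v" "\<lambda>z. (f z, v z)" z] smooth_at_Pair[OF that(1,3)] that(2) AQ(5)[of "v z"]
    by simp
  have dF: "((\<lambda>t. F (t *\<^sub>R v, 0) $ j) has_real_derivative d j * v $ j) (at 0)" for v j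
  proof -
    note has_derivative_on_line[OF sm, of v]
    then have "((\<lambda>t. F (t *\<^sub>R v, 0)) has_vector_derivative (\<chi> j. d j * v $ j)) (at 0)"
      unfolding has_vector_derivative_def
      by (rule has_derivative_eq_rhs) (auto simp: DF fun_eq_iff vec_eq_iff)
    from has_vector_derivative_vec_nth[OF this, of j] show ?thesis
      by (simp add: has_real_derivative_iff_has_vector_derivative)
  qed
  let ?e = "axis i (1::real)"
  \<comment> \<open>The critical point: \<open>b (D\<^sub>\<mu>F - l) = 0\<close> and \<open>b \<bullet> c = 0\<close> say that \<open>K\<close> is stationary in \<open>t\<close> and in \<open>l\<close>;
    \<open>b\<^sub>i = 1\<close> normalises \<open>b\<close>.\<close>
  let ?f1 = "\<lambda>z. (\<chi> j. if j = i then snd (snd (fst z)) \<bullet> fst (fst z)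
        else F (fst (fst z), snd z) $ j - fst (snd (fst z)) * fst (fst z) $ j,
      snd (snd (fst z)) $ i - 1,
      \<chi> k. snd (snd (fst z)) \<bullet> A (0, fst (fst z), snd z) (axis k 1) - fst (snd (fst z)) * snd (snd (fst z)) $ k)"
  obtain g1 where g1: "smooth_at g1 0" "g1 0 = (0, d i, ?e)" "\<forall>\<^sub>F u in nhds 0. ?f1 (g1 u, u) = 0"
  proof (rule smooth_implicit_function[of ?f1 "(0, d i, ?e)" 0])
    show "smooth_at ?f1 ((0, d i, ?e), 0)"
      by (intro smooth_intros sF sA) (auto simp: zero_prod_def)
    show "?f1 ((0, d i, ?e), 0) = 0"
    proof -
      have "?e \<bullet> A (0, 0, 0) (axis k 1) = d i * ?e $ k" for k
        by (simp add: A0 inner_axis') (simp add: axis_def)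
      then show ?thesis using F0 by (simp add: zero_prod_def vec_eq_iff)
    qed
  next
    fix w :: "(real^'n) \<times> real \<times> (real^'n)"
    obtain v1 v2 v3 where w: "w = (v1, v2, v3)" by (cases w) auto
    assume asm: "((\<lambda>t. ?f1 ((0, d i, ?e) + t *\<^sub>R w, 0)) has_vector_derivative 0) (at 0)"
    note 1 = bounded_linear.has_vector_derivative[OF bounded_linear_fst asm]
      and 2 = bounded_linear.has_vector_derivative[OF bounded_linear_fst bounded_linear.has_vector_derivative[OF bounded_linear_snd asm]]
      and 3 = bounded_linear.has_vector_derivative[OF bounded_linear_snd bounded_linear.has_vector_derivative[OF bounded_linear_snd asm]]
    have v1: "v1 = 0"
    proof (rule vec_eq_iff[THEN iffD2, rule_format])
      fix j
      show "v1 $ j = 0 $ j"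
      proof (cases "j = i")
        case True
        have "((\<lambda>t. (?e + t *\<^sub>R v3) \<bullet> (t *\<^sub>R v1)) has_real_derivative v1 $ i) (at 0)"
          by (auto intro!: derivative_eq_intros simp: inner_add_left inner_axis')
        then have "v1 $ i = 0"
          by (rule vector_derivative_zeroD[rotated]) (use has_vector_derivative_vec_nth[OF 1, of i] in \<open>simp add: w\<close>)
        then show ?thesis using True by simp
      next
        case False
        have "((\<lambda>t. F (t *\<^sub>R v1, 0) $ j - (d i + t * v2) * (t * v1 $ j)) has_real_derivative (d j * v1 $ j - d i * v1 $ j)) (at 0)"
          by (auto intro!: derivative_eq_intros dF)
        then have "d j * v1 $ j - d i * v1 $ j = 0"
          by (rule vector_derivative_zeroD[rotated]) (use has_vector_derivative_vec_nth[OF 1, of j] False in \<open>simp add: w\<close>)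
        then show ?thesis using dist[OF False] by (simp flip: left_diff_distrib)
      qed
    qed
    have v3i: "v3 $ i = 0"
    proof -
      have "((\<lambda>t. (?e + t *\<^sub>R v3) $ i - 1) has_real_derivative v3 $ i) (at 0)"
        by (auto intro!: derivative_eq_intros)
      then show ?thesis by (rule vector_derivative_zeroD[rotated]) (use 2 in \<open>simp add: w\<close>)
    qed
    have k: "d k * v3 $ k - d i * v3 $ k - v2 * ?e $ k = 0" for k
    proof -
      have "((\<lambda>t. (?e + t *\<^sub>R v3) $ k * d k - (d i + t * v2) * (?e $ k + t * v3 $ k)) has_real_derivative
          (d k * v3 $ k - d i * v3 $ k - v2 * ?e $ k)) (at 0)"
        by (auto intro!: derivative_eq_intros)
      moreover have "(?e + t *\<^sub>R v3) \<bullet> A (0, 0, 0) (axis k 1) = (?e + t *\<^sub>R v3) $ k * d k" for t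
        by (simp add: A0 inner_vec_def axis_def if_distrib cong: if_cong)
      ultimately show ?thesis
        by (intro vector_derivative_zeroD[rotated]) (use has_vector_derivative_vec_nth[OF 3, of k] in \<open>simp_all add: w v1\<close>)
    qed
    have "v2 = 0" using k[of i] v3i by simp
    moreover have "v3 = 0"
    proof (rule vec_eq_iff[THEN iffD2, rule_format])
      fix j show "v3 $ j = 0 $ j"
        using k[of j] dist[of j] v3i by (cases "j = i") (auto simp: axis_def simp flip: left_diff_distrib)
    qed
    ultimately show "w = 0" by (simp add: w v1 zero_prod_def)
  qed auto
  define c l b where "c = (\<lambda>u. fst (g1 u))" and "l = (\<lambda>u. fst (snd (g1 u)))" and "b = (\<lambda>u. snd (snd (g1 u)))"
  have s1: "smooth_at c 0" "smooth_at l 0" "smooth_at b 0" and z1: "c 0 = 0" "l 0 = d i" "b 0 = ?e"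
    using g1(1,2) by (auto simp: c_def l_def b_def intro!: smooth_intros)
  have e1: "\<forall>\<^sub>F u in nhds 0. b u \<bullet> c u = 0 \<and> (\<forall>j. j \<noteq> i \<longrightarrow> F (c u, u) $ j = l u * c u $ j) \<and> b u $ i = 1 \<and>
      (\<forall>v. b u \<bullet> A (0, c u, u) v = l u * (b u \<bullet> v))"
    using g1(3)
  proof eventually_elim
    case (elim u)
    have "(\<forall>j. (if j = i then b u \<bullet> c u else F (c u, u) $ j - l u * c u $ j) = 0) \<and> b u $ i = 1 \<and>
        (\<forall>k. b u \<bullet> A (0, c u, u) (axis k 1) = l u * b u $ k)"
      using elim unfolding fst_conv snd_conv c_def l_def b_def
      by (simp add: vec_eq_iff zero_prod_def split del: if_split)
    then have el: "\<And>j. (if j = i then b u \<bullet> c u else F (c u, u) $ j - l u * c u $ j) = 0" "b u $ i = 1"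
        "\<And>k. b u \<bullet> A (0, c u, u) (axis k 1) = l u * b u $ k"
      by blast+
    have "b u \<bullet> A (0, c u, u) v = l u * (b u \<bullet> v)" for v
      by (rule left_eigenvector_from_columns[OF AQ(2) el(3)])
    moreover have "b u \<bullet> c u = 0 \<and> (\<forall>j. j \<noteq> i \<longrightarrow> F (c u, u) $ j = l u * c u $ j) \<and> b u $ i = 1"
      using el(1)[of i] el(2) el(1)[of j for j] by (metis eq_iff_diff_eq_0)
    ultimately show ?case by blast
  qed
  define \<alpha> where "\<alpha> = (\<lambda>u. F (c u, u) $ i - l u * c u $ i)"
  \<comment> \<open>The blow-up.  Insert \<open>c + m \<sigma>\<close> and \<open>l + m\<close> into the equation of the curve: the components \<open>j \<noteq> i\<close> are
    divisible by \<open>m\<close>, and the combination with \<open>b\<close> is divisible by \<open>m\<^sup>2\<close>.  The quotients form \<open>?f2\<close>,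
    which is nondegenerate in \<open>\<sigma>\<close>.\<close>
  let ?f2 = "\<lambda>z. (\<chi> j. if j = i then b (snd (snd z)) \<bullet> Q (fst (snd z) *\<^sub>R fst z, c (snd (snd z)), snd (snd z)) (fst z)
          - b (snd (snd z)) \<bullet> fst z
        else A (0, c (snd (snd z)), snd (snd z)) (fst z) $ j
          + fst (snd z) * Q (fst (snd z) *\<^sub>R fst z, c (snd (snd z)), snd (snd z)) (fst z) $ j
          - (l (snd (snd z)) + fst (snd z)) * fst z $ j - c (snd (snd z)) $ j)"
  have sc: "smooth_at (\<lambda>z. c (f z)) z" "smooth_at (\<lambda>z. b (f z)) z" "smooth_at (\<lambda>z. l (f z)) z"
    if "smooth_at f z" "f z = 0" for f :: "'z::real_normed_vector \<Rightarrow> _" and z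
    using smooth_at_compose[of _ f z] that s1 by simp_all
  obtain \<sigma> where \<sigma>: "smooth_at \<sigma> (0, 0)" "\<sigma> (0, 0) = 0" "\<forall>\<^sub>F p in nhds (0, 0). ?f2 (\<sigma> p, p) = 0"
  proof (rule smooth_implicit_function[of ?f2 0 "(0, 0)"])
    show "smooth_at ?f2 (0, 0, 0)"
      by (intro smooth_intros sA sQ sc) (auto simp: z1)
    have Q0: "Q z 0 = 0" for z using AQ(6)[of z 0 0] by simp
    show "?f2 (0, 0, 0) = 0"
      by (auto simp: z1 vec_eq_iff Q0 linear_0[OF AQ(2)])
  next
    fix v :: "real^'n"
    assume asm: "((\<lambda>t. ?f2 (0 + t *\<^sub>R v, 0, 0)) has_vector_derivative 0) (at 0)"
    show "v = 0"
    proof (rule vec_eq_iff[THEN iffD2, rule_format])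
      fix j
      note j = has_vector_derivative_vec_nth[OF asm, of j]
      show "v $ j = 0 $ j"
      proof (cases "j = i")
        case True
        have "((\<lambda>t. t\<^sup>2 * Q (0, 0, 0) v $ i - t * v $ i) has_real_derivative - v $ i) (at 0)"
          by (auto intro!: derivative_eq_intros)
        then have "- v $ i = 0"
          by (rule vector_derivative_zeroD[rotated]) (use j True in \<open>simp add: z1 AQ(6) inner_axis'\<close>)
        then show ?thesis using True by simp
      next
        case False
        have "((\<lambda>t. d j * (t * v $ j) - d i * (t * v $ j)) has_real_derivative (d j * v $ j - d i * v $ j)) (at 0)"
          by (auto intro!: derivative_eq_intros)
        then have "d j * v $ j - d i * v $ j = 0"
          by (rule vector_derivative_zeroD[rotated]) (use j False in \<open>simp add: z1 A0\<close>)
        then show ?thesis using dist[OF False] by (simp flip: left_diff_distrib)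
      qed
    qed
  qed auto
  have e2: "\<forall>\<^sub>F (m, u) in nhds (0, 0). F (c u + m *\<^sub>R \<sigma> (m, u), u) - (l u + m) *\<^sub>R (c u + m *\<^sub>R \<sigma> (m, u)) = \<alpha> u *\<^sub>R ?e"
  proof -
    have ssnd: "smooth_at snd (0::real, 0::'p)" by (rule smooth_at_bounded_linear[OF bounded_linear_snd])
    let ?z = "\<lambda>p. (fst p *\<^sub>R \<sigma> p, c (snd p), snd p)"
    have s\<sigma>: "smooth_at ?z (0, 0)" by (intro smooth_intros sc \<sigma>(1)) auto
    have z0: "?z (0, 0) = (0, 0, 0)" by (simp add: z1)
    show ?thesis
      using smooth_at_eventually[OF ssnd, simplified, OF e1] \<sigma>(3)
        eventually_along_smooth[OF s\<sigma> AQ(3) z0] eventually_along_smooth[OF s\<sigma> AQ(7) z0]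
    proof eventually_elim
      case (elim p)
      obtain m u where p: "p = (m, u)" by (cases p)
      let ?s = "\<sigma> (m, u)" and ?A = "A (0, c u, u)" and ?Q = "Q (m *\<^sub>R \<sigma> (m, u), c u, u) (\<sigma> (m, u))"
      \<comment> \<open>\<open>?w\<close> is what remains of the equation of the curve after division by \<open>m\<close>.\<close>
      let ?w = "?A ?s + m *\<^sub>R ?Q - (l u + m) *\<^sub>R ?s - c u"
      have A1: "A (m *\<^sub>R ?s, c u, u) ?s = ?A ?s + m *\<^sub>R ?Q" using elim(4) by (simp add: p)
      have F1: "F (c u + m *\<^sub>R ?s, u) = F (c u, u) + m *\<^sub>R (?A ?s + m *\<^sub>R ?Q)"
        using elim(3) A1 by (simp add: p linear_cmul[OF AQ(2)])
      have wj: "?w $ j = 0" if "j \<noteq> i" for j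
        using elim(2) that by (auto simp: p vec_eq_iff split: if_splits)
      have bQ: "b u \<bullet> ?Q = b u \<bullet> ?s" using elim(2) by (auto simp: p vec_eq_iff split: if_splits)
      have "b u \<bullet> ?w = 0"
        using elim(1) by (simp add: p inner_diff_right inner_add_right bQ algebra_simps)
      moreover have "b u \<bullet> ?w = ?w $ i"
      proof -
        have "b u \<bullet> ?w = (\<Sum>j\<in>UNIV. b u $ j * ?w $ j)" by (simp add: inner_vec_def)
        also have "\<dots> = (\<Sum>j\<in>{i}. b u $ j * ?w $ j)"
          by (rule sum.mono_neutral_right) (use wj in auto)
        finally show ?thesis using elim(1) by (simp add: p)
      qed
      ultimately have w0: "?w = 0" using wj by (metis vec_eq_iff zero_index)
      have "F (c u + m *\<^sub>R ?s, u) - (l u + m) *\<^sub>R (c u + m *\<^sub>R ?s) = F (c u, u) - l u *\<^sub>R c u + m *\<^sub>R ?w"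
        unfolding F1 by (simp add: algebra_simps)
      also have "\<dots> = \<alpha> u *\<^sub>R ?e"
        unfolding w0 using elim(1) by (auto simp: p vec_eq_iff \<alpha>_def axis_def)
      finally show ?case by (simp add: p)
    qed
  qed
  define C where "C = (\<lambda>z. c (snd z) + (fst z - l (snd z)) *\<^sub>R \<sigma> (fst z - l (snd z), snd z))"
  have s\<sigma>2: "smooth_at (\<lambda>z. (fst z - l (snd z), snd z)) (d i, 0)" by (intro smooth_intros sc) auto
  show thesis
  proof (rule that[of C \<alpha>])
    have "smooth_at (\<lambda>z. \<sigma> (fst z - l (snd z), snd z)) (d i, 0)"
      by (rule smooth_at_compose[of \<sigma>, OF _ s\<sigma>2]) (simp add: z1 \<sigma>(1))
    then show "smooth_at C (d i, 0)" unfolding C_def by (intro smooth_intros sc) auto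
    show "C (d i, 0) = 0" by (simp add: C_def z1)
    show "smooth_at \<alpha> 0" unfolding \<alpha>_def by (intro smooth_intros sF sc) (auto simp: z1)
    show "\<alpha> 0 = 0" by (simp add: \<alpha>_def z1 F0)
    have "\<forall>\<^sub>F z in nhds (d i, 0). case (fst z - l (snd z), snd z) of
      (m, u) \<Rightarrow> F (c u + m *\<^sub>R \<sigma> (m, u), u) - (l u + m) *\<^sub>R (c u + m *\<^sub>R \<sigma> (m, u)) = \<alpha> u *\<^sub>R ?e"
      by (rule eventually_along_smooth[OF s\<sigma>2 e2]) (simp add: z1)
    then show "\<forall>\<^sub>F (l, u) in nhds (d i, 0). F (C (l, u), u) - l *\<^sub>R C (l, u) = \<alpha> u *\<^sub>R ?e"
      by (rule eventually_mono) (auto simp: C_def case_prod_unfold)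
    show "((\<lambda>t. C (d i + t * v, 0)) has_vector_derivative 0) (at 0)" for v
    proof -
      have "smooth_at (\<lambda>t. \<sigma> (t * v, 0)) 0"
        by (rule smooth_at_compose[of \<sigma>]) (auto intro!: smooth_intros simp: \<sigma>(1))
      then obtain D where D: "((\<lambda>t. \<sigma> (t * v, 0)) has_derivative D) (at 0)"
        using smooth_at_imp_has_derivative by blast
      have "((\<lambda>t. (t * v) *\<^sub>R \<sigma> (t * v, 0)) has_derivative (\<lambda>_. 0)) (at 0)"
        by (auto intro!: derivative_eq_intros D simp: \<sigma>(2))
      then show ?thesis by (simp add: C_def z1 has_vector_derivative_def)
    qed
  qed
qed

text \<open>Along the curve \<open>C\<close> the vector \<open>F - l C\<close> is the fixed multiple \<open>\<alpha>(u)\<close> of \<open>e\<^sub>i\<close>.  Expanding \<open>F\<close> at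
  \<open>C(l, u)\<close> gives a matrix \<open>A\<close> that depends on \<open>(\<mu>, l, u)\<close>; the equations \<open>b A = l b\<close>, \<open>b\<^sub>i = 1\<close> for a left
  eigenvector have a unique smooth solution near \<open>(e\<^sub>i, d\<^sub>i)\<close> because \<open>d\<^sub>i\<close> is a simple eigenvalue and
  \<open>C\<close> is stationary in \<open>l\<close> at the base point.\<close>

lemma row_splitting:
  fixes F :: "(real^'n) \<times> 'p::euclidean_space \<Rightarrow> real^'n" and d :: "'n \<Rightarrow> real"
  assumes sm: "smooth_at F (0, 0)" and F0: "F (0, 0) = 0"
    and DF: "\<And>v. frechet_derivative F (at (0, 0)) (v, 0) = (\<chi> j. d j * v $ j)"
    and dist: "\<And>j. j \<noteq> i \<Longrightarrow> d j \<noteq> d i"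
  obtains b l \<alpha> where
    "smooth_at b (0, 0)" "b (0, 0) = axis i (1::real)" "smooth_at l (0, 0)" "l (0, 0) = d i"
    "smooth_at \<alpha> 0" "\<alpha> 0 = 0"
    "\<forall>\<^sub>F (\<mu>, u) in nhds (0, 0). b (\<mu>, u) \<bullet> F (\<mu>, u) = \<alpha> u + l (\<mu>, u) * (b (\<mu>, u) \<bullet> \<mu>)"
proof (rule singular_direction_curve[OF assms])
  fix C \<alpha>
  assume C: "smooth_at C (d i, 0)" "C (d i, 0) = 0" "smooth_at \<alpha> 0" "\<alpha> 0 = 0"
    "\<forall>\<^sub>F (l, u) in nhds (d i, 0). F (C (l, u), u) - l *\<^sub>R C (l, u) = \<alpha> u *\<^sub>R axis i (1::real)"
    "\<And>v. ((\<lambda>t. C (d i + t * v, 0)) has_vector_derivative 0) (at 0)"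
  show thesis
  proof (rule smooth_second_order_hadamard[OF sm])
    fix A Q
    assume A: "\<And>v. smooth_at (\<lambda>z. A z v) (0, 0, 0)" "\<And>z. linear (A z)"
      "\<forall>\<^sub>F (x, c, u) in nhds (0, 0, 0). F (c + x, u) = F (c, u) + A (x, c, u) x"
      "\<And>v. A (0, 0, 0) v = frechet_derivative F (at (0, 0)) (v, 0)"
    have A0: "A (0, 0, 0) v = (\<chi> j. d j * v $ j)" for v using A(4) DF by simp
    let ?e = "axis i (1::real)"
    let ?z = "\<lambda>z. (fst (snd z) - C (snd (fst z), snd (snd z)), C (snd (fst z), snd (snd z)), snd (snd z))"
    let ?f = "\<lambda>z. (\<chi> k. fst (fst z) \<bullet> A (?z z) (axis k 1) - snd (fst z) * fst (fst z) $ k, fst (fst z) $ i - 1)"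
    have sz: "smooth_at ?z ((?e, d i), 0, 0)"
    proof -
      have "smooth_at (\<lambda>z. C (snd (fst z), snd (snd z))) ((?e, d i), 0, 0)"
        by (rule smooth_at_compose[of C]) (auto intro!: smooth_intros C(1))
      then show ?thesis by (intro smooth_intros)
    qed
    obtain g where g: "smooth_at g (0, 0)" "g (0, 0) = (?e, d i)" "\<forall>\<^sub>F p in nhds (0, 0). ?f (g p, p) = 0"
    proof (rule smooth_implicit_function[of ?f "(?e, d i)" "(0, 0)"])
      have "smooth_at (\<lambda>z. A (?z z) v) ((?e, d i), 0, 0)" for v
        by (rule smooth_at_compose[of "\<lambda>z. A z v", OF _ sz]) (simp add: C(2) A(1))
      then show "smooth_at ?f ((?e, d i), 0, 0)" by (intro smooth_intros)
      have "?e \<bullet> A (0, 0, 0) (axis k 1) = d i * ?e $ k" for k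
        by (simp add: A0 inner_axis') (simp add: axis_def)
      then show "?f ((?e, d i), 0, 0) = 0" by (simp add: C(2) zero_prod_def vec_eq_iff)
    next
      fix w :: "(real^'n) \<times> real"
      obtain \<beta> m where w: "w = (\<beta>, m)" by (cases w)
      assume asm: "((\<lambda>t. ?f ((?e, d i) + t *\<^sub>R w, 0, 0)) has_vector_derivative 0) (at 0)"
      note 1 = bounded_linear.has_vector_derivative[OF bounded_linear_fst asm]
        and 2 = bounded_linear.has_vector_derivative[OF bounded_linear_snd asm]
      have \<beta>i: "\<beta> $ i = 0"
      proof -
        have "((\<lambda>t. (?e + t *\<^sub>R \<beta>) $ i - 1) has_real_derivative \<beta> $ i) (at 0)"
          by (auto intro!: derivative_eq_intros)
        then show ?thesis by (rule vector_derivative_zeroD[rotated]) (use 2 in \<open>simp add: w\<close>)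
      qed
      have k: "d k * \<beta> $ k - d i * \<beta> $ k - m * ?e $ k = 0" for k
      proof -
        let ?a = "\<lambda>t. A (- C (d i + t * m, 0), C (d i + t * m, 0), 0) (axis k 1)"
        let ?D = "frechet_derivative (\<lambda>z. A z (axis k 1)) (at (0, 0, 0))"
        have DA: "((\<lambda>z. A z (axis k 1)) has_derivative ?D) (at (0, 0, 0))"
          by (rule smooth_at_imp_has_derivative[OF A(1)])
        have dC: "((\<lambda>t. C (d i + t * m, 0)) has_derivative (\<lambda>_. 0)) (at 0)"
          using C(6)[of m] by (simp add: has_vector_derivative_def)
        have "(?a has_derivative (\<lambda>s. ?D (0, 0, 0))) (at 0)"
          by (rule has_derivative_compose[where g = "\<lambda>z. A z (axis k 1)"
              and f = "\<lambda>t. (- C (d i + t * m, 0), C (d i + t * m, 0), 0)"])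
            (auto intro!: derivative_eq_intros dC simp: C(2) DA)
        moreover have "?D (0, 0, 0) = 0"
          using linear_0[OF has_derivative_linear[OF DA]] by (simp add: zero_prod_def)
        ultimately have da: "(?a has_derivative (\<lambda>s. 0)) (at 0)" by simp
        have a0: "A (0, 0, 0) (axis k 1) = d k *\<^sub>R axis k 1"
          by (auto simp: A0 vec_eq_iff axis_def)
        have de: "((\<lambda>t. ?e + t *\<^sub>R \<beta>) has_derivative (\<lambda>s. s *\<^sub>R \<beta>)) (at 0)"
          by (auto intro!: derivative_eq_intros)
        have "((\<lambda>t. (?e + t *\<^sub>R \<beta>) \<bullet> ?a t) has_derivative (\<lambda>s. s * (d k * \<beta> $ k))) (at 0)"
          using has_derivative_inner[OF de da]
          by (rule has_derivative_eq_rhs) (simp add: C(2) a0 inner_axis fun_eq_iff mult.commute)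
        then have "((\<lambda>t. (?e + t *\<^sub>R \<beta>) \<bullet> ?a t) has_real_derivative d k * \<beta> $ k) (at 0)"
          unfolding has_field_derivative_def
          by (rule has_derivative_eq_rhs) (simp add: fun_eq_iff)
        then have "((\<lambda>t. (?e + t *\<^sub>R \<beta>) \<bullet> ?a t - (d i + t * m) * (?e $ k + t * \<beta> $ k)) has_real_derivative
            (d k * \<beta> $ k - d i * \<beta> $ k - m * ?e $ k)) (at 0)"
          by (auto intro!: derivative_eq_intros)
        then show ?thesis
          by (rule vector_derivative_zeroD[rotated]) (use has_vector_derivative_vec_nth[OF 1, of k] in \<open>simp add: w\<close>)
      qed
      have "m = 0" using k[of i] \<beta>i by simp
      moreover have "\<beta> = 0"
      proof (rule vec_eq_iff[THEN iffD2, rule_format])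
        fix j show "\<beta> $ j = 0 $ j"
          using k[of j] dist[of j] \<beta>i by (cases "j = i") (auto simp: axis_def simp flip: left_diff_distrib)
      qed
      ultimately show "w = 0" by (simp add: w zero_prod_def)
    qed auto
    define b l where "b = (\<lambda>p. fst (g p))" and "l = (\<lambda>p. snd (g p))"
    have s1: "smooth_at b (0, 0)" "smooth_at l (0, 0)" and z1: "b (0, 0) = ?e" "l (0, 0) = d i"
      using g(1,2) by (auto simp: b_def l_def intro!: smooth_intros)
    have sl: "smooth_at (\<lambda>p. (l p, snd p)) (0, 0)" by (intro smooth_intros s1)
    have sx: "smooth_at (\<lambda>p. (fst p - C (l p, snd p), C (l p, snd p), snd p)) (0, 0)"
    proof -
      have "smooth_at (\<lambda>p. C (l p, snd p)) (0, 0)"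
        by (rule smooth_at_compose[of C, OF _ sl]) (simp add: z1 C(1))
      then show ?thesis by (intro smooth_intros)
    qed
    have zl: "(l (0, 0), snd (0, 0)) = (d i, 0 :: 'p)" by (simp add: z1)
    have zx: "(fst (0, 0) - C (l (0, 0), snd (0, 0)), C (l (0, 0), snd (0, 0)), snd (0, 0)) = (0, 0, 0 :: 'p)"
      by (simp add: z1 C(2))
    show thesis
    proof (rule that[OF s1(1) z1(1) s1(2) z1(2) C(3,4)])
      show "\<forall>\<^sub>F (\<mu>, u) in nhds (0, 0). b (\<mu>, u) \<bullet> F (\<mu>, u) = \<alpha> u + l (\<mu>, u) * (b (\<mu>, u) \<bullet> \<mu>)"
        using g(3) eventually_along_smooth[OF sl C(5) zl] eventually_along_smooth[OF sx A(3) zx]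
      proof eventually_elim
        case (elim p)
        obtain \<mu> u where p: "p = (\<mu>, u)" by (cases p)
        let ?l = "l (\<mu>, u)" and ?b = "b (\<mu>, u)"
        let ?c = "C (?l, u)"
        let ?A = "A (\<mu> - ?c, ?c, u)"
        have el: "?b $ i = 1" "\<And>k. ?b \<bullet> ?A (axis k 1) = ?l * ?b $ k"
          using elim(1) by (simp_all add: p b_def l_def vec_eq_iff zero_prod_def)
        have lin: "?b \<bullet> ?A v = ?l * (?b \<bullet> v)" for v
          by (rule left_eigenvector_from_columns[OF A(2) el(2)])
        have "F (\<mu>, u) = F (?c, u) + ?A (\<mu> - ?c)" using elim(3) by (simp add: p)
        also have "F (?c, u) = ?l *\<^sub>R ?c + \<alpha> u *\<^sub>R ?e" using elim(2) by (simp add: p algebra_simps)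
        finally have "?b \<bullet> F (\<mu>, u) = \<alpha> u + ?l * (?b \<bullet> \<mu>)"
          by (simp add: inner_add_right inner_axis lin el(1) inner_diff_right algebra_simps)
        then show ?case by (simp add: p)
      qed
    qed
  qed
qed

section \<open>The normal form of the pair of vectors\<close>

text \<open>Linear dependence of two vectors, in the form of a nontrivial relation: the invariances below
  are then statements about the pair of coefficients.\<close>

definition parallel :: "'a::real_vector \<Rightarrow> 'a \<Rightarrow> bool" where
  "parallel a b \<longleftrightarrow> (\<exists>s t. (s \<noteq> 0 \<or> t \<noteq> 0) \<and> s *\<^sub>R a + t *\<^sub>R b = 0)"

lemma parallel_linear_image:
  assumes "linear L" "inj L"
  shows "parallel (L a) (L b) \<longleftrightarrow> parallel a b"
proof -
  have "s *\<^sub>R L a + t *\<^sub>R L b = 0 \<longleftrightarrow> s *\<^sub>R a + t *\<^sub>R b = 0" for s t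
  proof -
    have "s *\<^sub>R L a + t *\<^sub>R L b = L (s *\<^sub>R a + t *\<^sub>R b)"
      by (simp add: linear_add[OF assms(1)] linear_cmul[OF assms(1)])
    then show ?thesis using inj_eq[OF assms(2), of _ 0] by (simp add: linear_0[OF assms(1)])
  qed
  then show ?thesis by (simp add: parallel_def)
qed

lemma parallel_combination_imp:
  assumes "parallel a b" "q - r * p \<noteq> 0"
  shows "parallel (q *\<^sub>R a + p *\<^sub>R b) (r *\<^sub>R a + b)"
proof -
  obtain s t where st: "s \<noteq> 0 \<or> t \<noteq> 0" "s *\<^sub>R a + t *\<^sub>R b = 0"
    using assms(1) unfolding parallel_def by blast
  let ?s = "s - r * t" and ?t = "q * t - p * s"
  have "?s *\<^sub>R (q *\<^sub>R a + p *\<^sub>R b) + ?t *\<^sub>R (r *\<^sub>R a + b) = (q - r * p) *\<^sub>R (s *\<^sub>R a + t *\<^sub>R b)"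
    by (simp add: algebra_simps)
  then have "?s *\<^sub>R (q *\<^sub>R a + p *\<^sub>R b) + ?t *\<^sub>R (r *\<^sub>R a + b) = 0" using st(2) by simp
  moreover have "?s \<noteq> 0 \<or> ?t \<noteq> 0"
  proof (rule ccontr)
    assume "\<not> (?s \<noteq> 0 \<or> ?t \<noteq> 0)"
    then have "s = r * t" "(q - r * p) * t = 0" by (auto simp: algebra_simps)
    then show False using st(1) assms(2) by simp
  qed
  ultimately show ?thesis unfolding parallel_def by blast
qed

lemma parallel_combination:
  assumes "q - r * p \<noteq> 0"
  shows "parallel (q *\<^sub>R a + p *\<^sub>R b) (r *\<^sub>R a + b) \<longleftrightarrow> parallel a b"
proof
  assume "parallel (q *\<^sub>R a + p *\<^sub>R b) (r *\<^sub>R a + b)"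
  then obtain s t where st: "s \<noteq> 0 \<or> t \<noteq> 0" "s *\<^sub>R (q *\<^sub>R a + p *\<^sub>R b) + t *\<^sub>R (r *\<^sub>R a + b) = 0"
    unfolding parallel_def by blast
  have "(s * q + t * r) *\<^sub>R a + (s * p + t) *\<^sub>R b = 0"
    using st(2) by (simp add: algebra_simps)
  moreover have "s * q + t * r \<noteq> 0 \<or> s * p + t \<noteq> 0"
  proof (rule ccontr)
    assume "\<not> (s * q + t * r \<noteq> 0 \<or> s * p + t \<noteq> 0)"
    then have "t = - (s * p)" "s * q + t * r = 0" by auto
    then have "t = - (s * p)" "s * (q - r * p) = 0" by (auto simp: algebra_simps)
    then show False using st(1) assms by simp
  qed
  ultimately show "parallel a b" unfolding parallel_def by blast
qed (rule parallel_combination_imp[OF _ assms])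

text \<open>The Moebius transformation \<open>x \<mapsto> (q x + p) / (1 + r x)\<close>, with \<open>(q, p, r) = m l\<close>, that sends \<open>l\<^sub>i\<close> to
  \<open>d\<^sub>i\<close>; it is the identity for \<open>l = d\<close>.  The linear system for \<open>(q, p, r)\<close> is of Vandermonde type.\<close>

lemma moebius_parameters:
  fixes d :: "3 \<Rightarrow> real"
  assumes "inj d"
  obtains m :: "real^3 \<Rightarrow> real^3" where
    "smooth_at m (\<chi> i. d i)" "m (\<chi> i. d i) = axis 1 1"
    "\<forall>\<^sub>F l in nhds (\<chi> i. d i). \<forall>i. m l $ 1 * l $ i + m l $ 2 = d i * (1 + m l $ 3 * l $ i)"
proof -
  let ?f = "\<lambda>z :: (real^3) \<times> (real^3). (\<chi> i. snd z $ i * fst z $ 1 + fst z $ 2 - d i * (1 + fst z $ 3 * snd z $ i)) :: real^3"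
  have ax: "axis (1::3) (1::real) $ 1 = 1" "axis (1::3) (1::real) $ 2 = 0" "axis (1::3) (1::real) $ 3 = 0"
    by (simp_all add: axis_def)
  show thesis
  proof (rule smooth_implicit_function[of ?f "axis 1 1" "\<chi> i. d i"])
    show "smooth_at ?f (axis 1 1, \<chi> i. d i)" by (intro smooth_intros)
    show "?f (axis 1 1, \<chi> i. d i) = 0" by (simp add: vec_eq_iff ax)
  next
    fix v :: "real^3"
    assume asm: "((\<lambda>t. ?f (axis 1 1 + t *\<^sub>R v, \<chi> i. d i)) has_vector_derivative 0) (at 0)"
    have eq: "d i * v $ 1 + v $ 2 - d i * (v $ 3 * d i) = 0" for i
    proof -
      have "((\<lambda>t. d i * (1 + t * v $ 1) + t * v $ 2 - d i * (1 + t * v $ 3 * d i)) has_real_derivative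
          d i * v $ 1 + v $ 2 - d i * (v $ 3 * d i)) (at 0)"
        by (auto intro!: derivative_eq_intros)
      then show ?thesis
        by (rule vector_derivative_zeroD[rotated]) (use has_vector_derivative_vec_nth[OF asm, of i] in \<open>simp add: ax\<close>)
    qed
    have d: "d 1 \<noteq> d 2" "d 2 \<noteq> d 3" "d 1 \<noteq> d 3"
      using injD[OF assms, of 1 2] injD[OF assms, of 2 3] injD[OF assms, of 1 3] by auto
    have "(d 1 - d 2) * (v $ 1 - (d 1 + d 2) * v $ 3) = 0" "(d 2 - d 3) * (v $ 1 - (d 2 + d 3) * v $ 3) = 0"
      using eq[of 1] eq[of 2] eq[of 3] by (simp_all add: algebra_simps)
    then have *: "v $ 1 - (d 1 + d 2) * v $ 3 = 0" "v $ 1 - (d 2 + d 3) * v $ 3 = 0" using d by auto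
    then have "(d 1 - d 3) * v $ 3 = 0" by (simp add: algebra_simps)
    then have "v $ 3 = 0" using d by simp
    then have "v $ 1 = 0" "v $ 2 = 0" "v $ 3 = 0" using * eq[of 1] by auto
    then show "v = 0" by (simp add: vec_eq_iff forall_3)
  next
    fix m assume m: "smooth_at m (\<chi> i. d i)" "m (\<chi> i. d i) = axis 1 1"
      "\<forall>\<^sub>F l in nhds (\<chi> i. d i). ?f (m l, l) = 0"
    show thesis
      using m(3) by (intro that[OF m(1,2)]) (auto elim!: eventually_mono simp: vec_eq_iff mult.commute)
  qed
qed

text \<open>Write \<open>n = B \<mu>\<close> and \<open>w = B F\<close>, so that \<open>w\<^sub>i = \<alpha>\<^sub>i + l\<^sub>i n\<^sub>i\<close>.  With the Moebius parameters of \<open>(l\<^sub>i)\<close>, the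
  combinations \<open>q w + p n\<close> and \<open>r w + n\<close> satisfy
  \<open>(q w + p n)\<^sub>i = d\<^sub>i (r w + n)\<^sub>i + (q - r d\<^sub>i) \<alpha>\<^sub>i\<close> and \<open>q - r d\<^sub>i = (q - r p) / (1 + r l\<^sub>i)\<close>.  Multiplying the \<open>i\<close>-th
  coordinates by \<open>K\<^sub>i = (1 + r l\<^sub>i) / (q - r p)\<close> removes the last factor, and \<open>\<Psi> = K (r w + n)\<close> is the new
  coordinate.\<close>

lemma normal_form:
  fixes F :: "(real^3) \<times> 'p::euclidean_space \<Rightarrow> real^3" and d :: "3 \<Rightarrow> real"
  assumes sm: "smooth_at F (0, 0)" and F0: "F (0, 0) = 0"
    and DF: "\<And>v. frechet_derivative F (at (0, 0)) (v, 0) = (\<chi> j. d j * v $ j)"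
    and "inj d"
  obtains \<Psi> \<phi> where
    "smooth_at \<Psi> (0, 0)" "\<And>v. frechet_derivative \<Psi> (at (0, 0)) (v, 0) = v"
    "smooth_at \<phi> 0" "\<phi> 0 = 0"
    "\<forall>\<^sub>F (\<mu>, u) in nhds (0, 0). parallel (F (\<mu>, u)) \<mu> \<longleftrightarrow>
        parallel (\<chi> i. d i * \<Psi> (\<mu>, u) $ i + \<phi> u $ i) (\<Psi> (\<mu>, u))"
proof (rule moebius_parameters[OF \<open>inj d\<close>])
  fix m :: "real^3 \<Rightarrow> real^3"
  assume m: "smooth_at m (\<chi> i. d i)" "m (\<chi> i. d i) = axis 1 1"
    "\<forall>\<^sub>F l in nhds (\<chi> i. d i). \<forall>i. m l $ 1 * l $ i + m l $ 2 = d i * (1 + m l $ 3 * l $ i)"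
  have ex: "\<exists>b l \<alpha>. smooth_at b (0, 0) \<and> b (0, 0) = axis i (1::real) \<and> smooth_at l (0, 0) \<and> l (0, 0) = d i \<and>
    smooth_at \<alpha> 0 \<and> \<alpha> 0 = 0 \<and>
    (\<forall>\<^sub>F (\<mu>, u) in nhds (0, 0). b (\<mu>, u) \<bullet> F (\<mu>, u) = \<alpha> u + l (\<mu>, u) * (b (\<mu>, u) \<bullet> \<mu>))"
    (is "\<exists>b l \<alpha>. ?R i b l \<alpha>") for i
  proof (rule row_splitting[OF sm F0 DF])
    show "d j \<noteq> d i" if "j \<noteq> i" for j using \<open>inj d\<close> that by (simp add: inj_eq)
  qed (intro exI conjI)
  have "\<forall>i. \<exists>b l \<alpha>. ?R i b l \<alpha>" using ex by blast
  then obtain b l \<alpha> where R: "\<And>i. ?R i (b i) (l i) (\<alpha> i)"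
    unfolding choice_iff by blast
  note b = R[THEN conjunct1] R[THEN conjunct2, THEN conjunct1]
    and l = R[THEN conjunct2, THEN conjunct2, THEN conjunct1]
      R[THEN conjunct2, THEN conjunct2, THEN conjunct2, THEN conjunct1]
    and \<alpha> = R[THEN conjunct2, THEN conjunct2, THEN conjunct2, THEN conjunct2, THEN conjunct1]
      R[THEN conjunct2, THEN conjunct2, THEN conjunct2, THEN conjunct2, THEN conjunct2, THEN conjunct1]
    and eq = R[THEN conjunct2, THEN conjunct2, THEN conjunct2, THEN conjunct2, THEN conjunct2, THEN conjunct2]
  define q p r where "q = (\<lambda>z. m (\<chi> i. l i z) $ 1)" and "p = (\<lambda>z. m (\<chi> i. l i z) $ 2)" and "r = (\<lambda>z. m (\<chi> i. l i z) $ 3)"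
  have sl: "smooth_at (\<lambda>z. \<chi> i. l i z) (0, 0)" by (intro smooth_intros l)
  have l0: "(\<chi> i. l i (0, 0)) = (\<chi> i. d i)" by (simp add: l)
  have "smooth_at (\<lambda>z. m (\<chi> i. l i z)) (0, 0)"
    by (rule smooth_at_compose[of m, OF _ sl]) (simp only: l0 m(1))
  then have sq: "smooth_at q (0, 0)" "smooth_at p (0, 0)" "smooth_at r (0, 0)"
    unfolding q_def p_def r_def by (rule smooth_at_linear_image[OF bounded_linear_vec_nth])+
  have zq: "q (0, 0) = 1" "p (0, 0) = 0" "r (0, 0) = 0"
    unfolding q_def p_def r_def l0 m(2) by (simp_all add: axis_def)
  have em: "\<forall>\<^sub>F z in nhds (0, 0). \<forall>i. q z * l i z + p z = d i * (1 + r z * l i z)"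
    using eventually_along_smooth[OF sl m(3) l0] by (simp add: q_def p_def r_def)
  define K where "K = (\<lambda>i z. (1 + r z * l i z) / (q z - r z * p z))"
  define \<Psi> where "\<Psi> = (\<lambda>z. \<chi> i. K i z * ((1 + r z * l i z) * (b i z \<bullet> fst z) + r z * \<alpha> i (snd z)))"
  define \<phi> where "\<phi> = (\<lambda>u. \<chi> i. \<alpha> i u)"
  have sK: "smooth_at (K i) (0, 0)" for i
    unfolding K_def by (intro smooth_intros l sq) (simp add: zq)
  have K0: "K i (0, 0) = 1" for i by (simp add: K_def zq)
  have s\<alpha>: "smooth_at (\<lambda>z. \<alpha> i (snd z)) (0, 0)" for i
    by (rule smooth_at_compose[of "\<alpha> i"]) (auto intro!: smooth_intros \<alpha>)
  have s\<Psi>: "smooth_at \<Psi> (0, 0)" unfolding \<Psi>_def by (intro smooth_intros sK l sq b s\<alpha>)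
  show thesis
  proof (rule that[of \<Psi> \<phi>, OF s\<Psi>])
    show "smooth_at \<phi> 0" unfolding \<phi>_def by (intro smooth_intros \<alpha>)
    show "\<phi> 0 = 0" by (simp add: \<phi>_def \<alpha> vec_eq_iff)
    show "frechet_derivative \<Psi> (at (0, 0)) (v, 0) = v" for v
    proof -
      \<comment> \<open>Since \<open>\<alpha> 0 = 0\<close>, on the line \<open>t *\<^sub>R v\<close> the \<open>i\<close>-th component of \<open>\<Psi>\<close> is \<open>t\<close> times \<open>?E i\<close>, and
        \<open>?E i\<close> tends to \<open>v $ i\<close>.\<close>
      let ?E = "\<lambda>i z. K i z * (1 + r z * l i z) * (b i z \<bullet> v)"
      have c: "smooth_at (\<lambda>t. (t *\<^sub>R v, 0::'p)) 0" by (intro smooth_intros)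
      have sE: "smooth_at (\<lambda>t. ?E i (t *\<^sub>R v, 0)) 0" for i
        by (rule smooth_at_compose[of "?E i", OF _ c]) (auto intro!: smooth_intros sK sq l b)
      note has_derivative_on_line[OF s\<Psi>, of v]
      moreover have "((\<lambda>t. \<Psi> (t *\<^sub>R v, 0)) has_derivative (\<lambda>s. s *\<^sub>R v)) (at 0)"
      proof -
        have "((\<lambda>t. \<Psi> (t *\<^sub>R v, 0) \<bullet> axis i 1) has_derivative (\<lambda>s. (s *\<^sub>R v) \<bullet> axis i 1)) (at 0)" for i
        proof -
          have "((\<lambda>t. t * ?E i (t *\<^sub>R v, 0)) has_derivative (\<lambda>s. s * v $ i)) (at 0)"
            using has_derivative_mult[OF has_derivative_ident smooth_at_imp_has_derivative[OF sE[of i]]]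
            by (rule has_derivative_eq_rhs) (simp add: fun_eq_iff K0 zq b inner_axis')
          then show ?thesis by (simp add: \<Psi>_def inner_axis \<alpha> mult_ac)
        qed
        then show ?thesis
          by (subst has_derivative_componentwise_within) (auto simp: Basis_vec_def)
      qed
      ultimately have "(\<lambda>s. frechet_derivative \<Psi> (at (0, 0)) (s *\<^sub>R v, 0)) = (\<lambda>s. s *\<^sub>R v)"
        by (rule has_derivative_unique)
      from fun_cong[OF this, of 1] show ?thesis by simp
    qed
    define B where "B = (\<lambda>z v. \<chi> i. b i z \<bullet> v)"
    have linB: "linear (B z)" for z
      unfolding B_def by (auto simp: linear_iff vec_eq_iff inner_add_right)
    have "\<forall>\<^sub>F z in nhds (0, 0). inj (B z)"
    proof (rule continuous_linear_family_bounded_below[of B "(0, 0)"])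
      show "inj (B (0, 0))" by (auto simp: inj_def B_def b inner_axis' vec_eq_iff)
      show "isCont (\<lambda>z. B z v) (0, 0)" for v
        unfolding B_def by (intro smooth_at_imp_isCont smooth_intros b)
    next
      fix C assume "\<forall>\<^sub>F z in nhds (0, 0). \<forall>w. norm w \<le> C * norm (B z w)"
      then show ?thesis
      proof eventually_elim
        case (elim z)
        have "w = 0" if "B z w = 0" for w using elim[rule_format, of w] that by simp
        then show ?case by (simp add: linear_injective_0[OF linB])
      qed
    qed (simp add: linB)
    moreover have "\<forall>\<^sub>F z in nhds (0, 0). q z - r z * p z \<noteq> 0"
    proof -
      have "smooth_at (\<lambda>z. q z - r z * p z) (0, 0)" by (intro smooth_intros sq)
      from tendsto_imp_eventually_ne[OF smooth_at_imp_tendsto[OF this], of 0] show ?thesis by (simp add: zq)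
    qed
    moreover have "\<forall>\<^sub>F z in nhds (0, 0). \<forall>i. 1 + r z * l i z \<noteq> 0"
    proof (rule eventually_all_finite)
      fix i
      have "smooth_at (\<lambda>z. 1 + r z * l i z) (0, 0)" by (intro smooth_intros sq l)
      from tendsto_imp_eventually_ne[OF smooth_at_imp_tendsto[OF this], of 0]
      show "\<forall>\<^sub>F z in nhds (0, 0). 1 + r z * l i z \<noteq> 0" by (simp add: zq)
    qed
    moreover have "\<forall>\<^sub>F z in nhds (0, 0). \<forall>i. b i z \<bullet> F z = \<alpha> i (snd z) + l i z * (b i z \<bullet> fst z)"
      by (rule eventually_all_finite) (use eq in \<open>simp add: case_prod_unfold\<close>)
    ultimately have "\<forall>\<^sub>F z in nhds (0, 0). parallel (F z) (fst z) \<longleftrightarrow>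
        parallel (\<chi> i. d i * \<Psi> z $ i + \<phi> (snd z) $ i) (\<Psi> z)"
      using em
    proof eventually_elim
      case (elim z)
      define k where "k = (\<lambda>v :: real^3. \<chi> i. K i z * v $ i)"
      have K: "K i z \<noteq> 0" for i using elim(2,3) by (simp add: K_def)
      have link: "linear k" unfolding k_def by (auto simp: linear_iff vec_eq_iff algebra_simps)
      have injk: "inj k" unfolding k_def using K by (auto simp: inj_def vec_eq_iff)
      let ?w = "B z (F z)" and ?n = "B z (fst z)"
      have \<Psi>: "\<Psi> z = k (r z *\<^sub>R ?w + ?n)"
        using elim(4) by (simp add: \<Psi>_def k_def B_def vec_eq_iff algebra_simps)
      have "d i * \<Psi> z $ i + \<phi> (snd z) $ i = k (q z *\<^sub>R ?w + p z *\<^sub>R ?n) $ i" for i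
      proof -
        let ?L = "l i z" and ?a = "\<alpha> i (snd z)" and ?v = "b i z \<bullet> fst z" and ?D = "q z - r z * p z"
        let ?c = "1 + r z * ?L"
        have e: "q z * ?L + p z = d i * ?c" using elim(5) by simp
        have "?D = q z * ?c - r z * (q z * ?L + p z)" by (simp add: algebra_simps)
        then have e2: "?c * (q z - r z * d i) = ?D" unfolding e by (simp add: algebra_simps)
        have "k (q z *\<^sub>R ?w + p z *\<^sub>R ?n) $ i = K i z * (q z * (?a + ?L * ?v) + p z * ?v)"
          using elim(4) by (simp add: k_def B_def)
        also have "q z * (?a + ?L * ?v) + p z * ?v = q z * ?a + (q z * ?L + p z) * ?v" by (simp add: algebra_simps)
        also have "\<dots> = d i * (?c * ?v + r z * ?a) + (q z - r z * d i) * ?a"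
          unfolding e by (simp add: algebra_simps)
        also have "K i z * \<dots> = d i * (K i z * (?c * ?v + r z * ?a)) + (?c * (q z - r z * d i)) / ?D * ?a"
          by (simp add: K_def algebra_simps add_divide_distrib diff_divide_distrib)
        also have "\<dots> = d i * \<Psi> z $ i + \<phi> (snd z) $ i"
          unfolding e2 using elim(2) by (simp add: \<Psi>_def \<phi>_def)
        finally show ?thesis by simp
      qed
      then have w: "(\<chi> i. d i * \<Psi> z $ i + \<phi> (snd z) $ i) = k (q z *\<^sub>R ?w + p z *\<^sub>R ?n)"
        by (simp add: vec_eq_iff)
      show ?case
        unfolding w unfolding \<Psi> parallel_linear_image[OF link injk] parallel_combination[OF elim(2)]
          parallel_linear_image[OF linB elim(1)] ..
    qed
    then show "\<forall>\<^sub>F (\<mu>, u) in nhds (0, 0). parallel (F (\<mu>, u)) \<mu> \<longleftrightarrow>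
        parallel (\<chi> i. d i * \<Psi> (\<mu>, u) $ i + \<phi> u $ i) (\<Psi> (\<mu>, u))"
      by (simp add: case_prod_unfold)
  qed
qed

section \<open>Families of maps close to the identity\<close>

lemma diffeo_onto_imageI:
  fixes f :: "'a::euclidean_space \<Rightarrow> 'a"
  assumes M: "open M" and sm: "\<And>x. x \<in> M \<Longrightarrow> smooth_at f x" and inj: "inj_on f M"
    and D: "\<And>x. x \<in> M \<Longrightarrow> inj (frechet_derivative f (at x))"
  shows "diffeo_onto_image M f"
proof -
  have loc: "(\<forall>\<^sub>F y in nhds (f x). y \<in> f ` M) \<and> smooth_at (inv_into M f) (f x)" if x: "x \<in> M" for x
  proof (rule smooth_local_inverse[OF sm[OF x] D[OF x]])
    fix g assume g: "smooth_at g (f x)" "g (f x) = x" "\<forall>\<^sub>F y in nhds (f x). f (g y) = y"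
    have gM: "\<forall>\<^sub>F y in nhds (f x). g y \<in> M"
      using smooth_at_eventually[OF g(1), of "\<lambda>x. x \<in> M"] eventually_nhds_in_open[OF M x] g(2) by simp
    have "\<forall>\<^sub>F y in nhds (f x). y \<in> f ` M"
      using g(3) gM by eventually_elim (metis imageI)
    moreover have "\<forall>\<^sub>F y in nhds (f x). g y = inv_into M f y"
      using g(3) gM by eventually_elim (metis inj inv_into_f_f)
    ultimately show ?thesis using smooth_at_cong[OF g(1)] by blast
  qed
  have "open (f ` M)"
  proof (subst open_subopen, clarify)
    fix x assume "x \<in> M"
    then have "\<forall>\<^sub>F y in nhds (f x). y \<in> f ` M" using loc by blast
    then show "\<exists>T. open T \<and> f x \<in> T \<and> T \<subseteq> f ` M"
      unfolding eventually_nhds by (simp add: subset_eq)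
  qed
  then show ?thesis
    unfolding diffeo_onto_image_def using inj sm loc by (auto intro!: smooth_on_if_smooth_at)
qed

text \<open>Where the partial derivative of \<open>\<Psi>\<close> differs from the identity by at most \<open>1/2\<close>, the map
  \<open>x \<mapsto> \<Psi> (x, u) - x\<close> is a contraction on a ball, and one ball serves for all small \<open>u\<close>.\<close>

lemma near_identity_family_diffeo:
  fixes \<Psi> :: "'x::euclidean_space \<times> 'p::euclidean_space \<Rightarrow> 'x"
  assumes sm: "smooth_at \<Psi> (0, 0)" and D: "\<And>v. frechet_derivative \<Psi> (at (0, 0)) (v, 0) = v"
    and P: "\<forall>\<^sub>F z in nhds (0, 0). P z"
  obtains e where "e > 0"
    "\<And>x u. x \<in> ball 0 e \<Longrightarrow> u \<in> ball 0 e \<Longrightarrow> P (x, u) \<and> smooth_at \<Psi> (x, u)"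
    "\<And>u. u \<in> ball 0 e \<Longrightarrow> diffeo_onto_image (ball 0 e) (\<lambda>x. \<Psi> (x, u))"
proof -
  let ?D = "\<lambda>z v. frechet_derivative \<Psi> (at z) (v, 0)"
  have sD: "smooth_at (\<lambda>z. ?D z v) (0, 0)" for v
    by (intro smooth_at_frechet_derivative sm smooth_intros)
  have "((\<lambda>z. \<Sum>b\<in>Basis. norm (?D z b - b)) \<longlongrightarrow> (\<Sum>b\<in>Basis. norm (?D (0, 0) b - b))) (nhds (0, 0))"
    by (intro tendsto_intros smooth_at_imp_tendsto sD)
  then have "\<forall>\<^sub>F z in nhds (0, 0). (\<Sum>b\<in>Basis. norm (?D z b - b)) < 1 / 2"
    by (rule order_tendstoD) (simp add: D)
  with P eventually_smooth_at[OF sm]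
  have "\<forall>\<^sub>F z in nhds (0, 0). P z \<and> smooth_at \<Psi> z \<and> (\<Sum>b\<in>Basis. norm (?D z b - b)) < 1 / 2"
    by eventually_elim simp
  then show thesis
  proof (rule eventually_nhds_product_ball)
    fix e :: real
    assume e: "e > 0" "\<And>x u. x \<in> ball 0 e \<Longrightarrow> u \<in> ball 0 e \<Longrightarrow>
        P (x, u) \<and> smooth_at \<Psi> (x, u) \<and> (\<Sum>b\<in>Basis. norm (?D (x, u) b - b)) < 1 / 2"
    have diffeo: "diffeo_onto_image (ball 0 e) (\<lambda>x. \<Psi> (x, u))" if u: "u \<in> ball 0 e" for u
    proof -
      let ?f = "\<lambda>x. \<Psi> (x, u)"
      have sf: "smooth_at ?f x" if x: "x \<in> ball 0 e" for x
        by (rule smooth_at_compose[of \<Psi>]) (use e(2)[OF x u] in \<open>auto intro!: smooth_intros\<close>)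
      have df: "(?f has_derivative ?D (x, u)) (at x)" if x: "x \<in> ball 0 e" for x
      proof -
        have "(\<Psi> has_derivative frechet_derivative \<Psi> (at (x, u))) (at (x, u))"
          using e(2)[OF x u] smooth_at_imp_has_derivative by blast
        then show ?thesis
          by (intro has_derivative_compose[where g = \<Psi> and f = "\<lambda>x. (x, u)" and f' = "\<lambda>v. (v, 0)"])
            (auto intro!: derivative_intros)
      qed
      have est: "norm (?D (x, u) v - v) \<le> 1 / 2 * norm v" if x: "x \<in> ball 0 e" for x v
      proof -
        have lin: "linear (\<lambda>v. ?D (x, u) v - v)"
          using linear_compose_sub[OF has_derivative_linear[OF df[OF x]] linear_id] by (simp add: id_def)
        have "norm (?D (x, u) v - v) \<le> norm v * (\<Sum>b\<in>Basis. norm (?D (x, u) b - b))"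
          by (rule norm_linear_le_basis_sum[OF lin])
        also have "\<dots> \<le> norm v * (1 / 2)"
          using e(2)[OF x u] by (intro mult_left_mono) auto
        finally show ?thesis by simp
      qed
      show ?thesis
      proof (rule diffeo_onto_imageI[OF open_ball sf])
        show "inj_on ?f (ball 0 e)"
        proof (rule inj_onI)
          fix x y assume xy: "x \<in> ball 0 e" "y \<in> ball 0 e" "\<Psi> (x, u) = \<Psi> (y, u)"
          have "norm ((?f x - x) - (?f y - y)) \<le> 1 / 2 * norm (x - y)"
          proof (rule differentiable_bound[OF convex_ball])
            show "((\<lambda>x. ?f x - x) has_derivative (\<lambda>v. ?D (x, u) v - v)) (at x within ball 0 e)"
              if "x \<in> ball 0 e" for x
              by (rule has_derivative_at_withinI[OF has_derivative_diff[OF df[OF that] has_derivative_ident]])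
            show "onorm (\<lambda>v. ?D (x, u) v - v) \<le> 1 / 2" if "x \<in> ball 0 e" for x
              using est[OF that] by (intro onorm_bound) auto
          qed (use xy in auto)
          then show "x = y" using xy(3) by (simp add: norm_minus_commute)
        qed
        show "inj (frechet_derivative ?f (at x))" if x: "x \<in> ball 0 e" for x
        proof -
          have eq: "frechet_derivative ?f (at x) = ?D (x, u)" by (rule frechet_derivative_at[OF df[OF x], symmetric])
          have "v = 0" if "?D (x, u) v = 0" for v using est[OF x, of v] that by simp
          then show ?thesis
            unfolding eq linear_injective_0[OF has_derivative_linear[OF df[OF x]]] by blast
        qed
      qed
    qed
    have "P (x, u) \<and> smooth_at \<Psi> (x, u)" if "x \<in> ball 0 e" "u \<in> ball 0 e" for x u
      using e(2)[OF that] by (elim conjE) (rule conjI)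
    then show thesis by (rule that[OF e(1) _ diffeo])
  qed
qed

section \<open>Singular sets in an orthonormal frame\<close>

definition frame_coords :: "(3 \<Rightarrow> real^3) \<Rightarrow> real^3 \<Rightarrow> real^3" where
  "frame_coords e v = (\<chi> i. v \<bullet> e i)"

definition frame_point :: "(3 \<Rightarrow> real^3) \<Rightarrow> real^3 \<Rightarrow> real^3" where
  "frame_point e x = (\<Sum>i\<in>UNIV. x $ i *\<^sub>R e i)"

lemma linear_frame_coords: "linear (frame_coords e)"
  by (auto simp: frame_coords_def linear_iff vec_eq_iff inner_add_left)

lemma linear_frame_point: "linear (frame_point e)"
  by (auto simp: frame_point_def linear_iff scaleR_add_left sum.distrib scaleR_sum_right)

lemma frame_coords_point:
  assumes "orthonormal_frame e" shows "frame_coords e (frame_point e x) = x"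
proof -
  have o: "e i \<bullet> e j = (if i = j then 1 else 0)" for i j
    using assms unfolding orthonormal_frame_def by blast
  show ?thesis
    by (simp add: frame_coords_def frame_point_def vec_eq_iff inner_sum_left o if_distrib cong: if_cong)
qed

lemma inj_frame_coords:
  assumes "orthonormal_frame e" shows "inj (frame_coords e)"
proof -
  have "surj (frame_coords e)" using frame_coords_point[OF assms] by (metis surjI)
  then show ?thesis using linear_surjective_imp_injective[OF linear_frame_coords] by auto
qed

lemma frame_point_coords:
  assumes "orthonormal_frame e" shows "frame_point e (frame_coords e v) = v"
  using inj_frame_coords[OF assms] frame_coords_point[OF assms] by (rule injD)

text \<open>Rank at most 1 means that the transposed Jacobian, a map from the plane, has a kernel; a kernel
  vector is a linear relation between the gradient of \<open>f\<close> and \<open>\<mu>\<close>.\<close>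

lemma singular_set_iff_parallel:
  assumes e: "orthonormal_frame e" and f: "(f has_derivative f') (at \<mu>)"
  shows "\<mu> \<in> singular_set f \<longleftrightarrow> parallel (\<chi> i. f' (e i)) (frame_coords e \<mu>)"
proof -
  let ?g = "\<lambda>\<nu>. vector [f \<nu>, orbit_momentum \<nu>] :: real^2"
  let ?G = "\<chi> k. f' (axis k 1)"
  have lin: "linear f'" using f by (rule has_derivative_linear)
  have om: "orbit_momentum = (\<lambda>\<nu>. \<nu> \<bullet> \<nu> / 2)"
    by (auto simp: orbit_momentum_def fun_eq_iff inner_vec_def sum_3 power2_eq_square)
  have dom: "(orbit_momentum has_derivative (\<lambda>h. \<mu> \<bullet> h)) (at \<mu>)"
    unfolding om by (auto intro!: derivative_eq_intros simp: inner_commute)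
  have "(?g has_derivative (\<lambda>h. vector [f' h, \<mu> \<bullet> h])) (at \<mu>)"
  proof -
    have v: "(vector [x, y] :: real^2) = x *\<^sub>R axis 1 1 + y *\<^sub>R axis 2 1" for x y
      by (simp add: vec_eq_iff forall_2 axis_def)
    show ?thesis unfolding v by (auto intro!: derivative_eq_intros f dom)
  qed
  then have J: "jacobian ?g (at \<mu>) = matrix (\<lambda>h. vector [f' h, \<mu> \<bullet> h] :: real^2)" (is "?J = _")
    unfolding jacobian_def by (simp add: frechet_derivative_at[symmetric])
  have Jx: "transpose ?J *v x = x $ 1 *\<^sub>R ?G + x $ 2 *\<^sub>R \<mu>" for x
    by (simp add: J vec_eq_iff matrix_vector_mult_def transpose_def matrix_def sum_2 inner_axis mult.commute)
  have "rank ?J \<le> 1 \<longleftrightarrow> rank (transpose ?J) \<noteq> CARD(2)"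
    using rank_bound[of ?J] by (auto simp: rank_transpose)
  also have "\<dots> \<longleftrightarrow> \<not> inj ((*v) (transpose ?J))"
    by (simp only: full_rank_injective)
  also have "\<dots> \<longleftrightarrow> (\<exists>x. x \<noteq> 0 \<and> transpose ?J *v x = 0)"
    by (auto simp: linear_injective_0[OF matrix_vector_mul_linear])
  also have "\<dots> \<longleftrightarrow> parallel ?G \<mu>"
  proof
    assume "\<exists>x. x \<noteq> 0 \<and> transpose ?J *v x = 0"
    then show "parallel ?G \<mu>" unfolding parallel_def Jx by (auto simp: vec_eq_iff forall_2)
  next
    assume "parallel ?G \<mu>"
    then obtain s t where "s \<noteq> 0 \<or> t \<noteq> 0" "s *\<^sub>R ?G + t *\<^sub>R \<mu> = 0" unfolding parallel_def by blast
    then show "\<exists>x. x \<noteq> 0 \<and> transpose ?J *v x = 0"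
      unfolding Jx by (intro exI[of _ "vector [s, t]"]) (auto simp: vec_eq_iff forall_2)
  qed
  also have "\<dots> \<longleftrightarrow> parallel (frame_coords e ?G) (frame_coords e \<mu>)"
    by (simp add: parallel_linear_image[OF linear_frame_coords inj_frame_coords[OF e]])
  also have "frame_coords e ?G = (\<chi> i. f' (e i))"
  proof -
    have "?G \<bullet> v = f' v" for v
    proof -
      have "f' v = f' (\<Sum>k\<in>UNIV. v $ k *\<^sub>R axis k 1)" 
        using basis_expansion[of v] by (simp add: scalar_mult_eq_scaleR)
      then show ?thesis
        by (simp add: linear_sum[OF lin] linear_cmul[OF lin] inner_vec_def mult.commute)
    qed
    then show ?thesis by (simp add: frame_coords_def)
  qed
  finally show ?thesis by (simp add: singular_set_def)
qed

text \<open>For the second derivatives, the mean value theorem on the segment from \<open>t v\<close> to \<open>t v + t w\<close> gives a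
  \<open>\<theta>\<close> in \<open>(0, 1)\<close> at which the derivative of \<open>r\<close> in direction \<open>w\<close> is of order \<open>t\<^sup>2\<close>.  With \<open>L w\<close> the
  derivative at \<open>0\<close> of that directional derivative, \<open>L w v + \<theta> L w w\<close> is arbitrarily small.  The case
  \<open>v = w\<close> yields \<open>L w w = 0\<close>, and then \<open>L w v = 0\<close> follows.\<close>

lemma third_order_vanishing:
  fixes r :: "'a::euclidean_space \<Rightarrow> real"
  assumes sm: "smooth_at r 0" and O: "r \<in> O[at 0](\<lambda>x. norm x ^ 3)"
  shows "frechet_derivative r (at 0) w = 0"
    and "frechet_derivative (\<lambda>x. frechet_derivative r (at x) w) (at 0) v = 0"
proof -
  obtain C where C: "C > 0" "\<forall>\<^sub>F x in at 0. norm (r x) \<le> C * norm (norm x ^ 3)"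
    using O by (rule landau_o.bigE)
  have "(r \<longlongrightarrow> 0) (at 0)"
  proof (rule Lim_null_comparison[OF C(2)])
    have "((\<lambda>x::'a. C * norm (norm x ^ 3)) \<longlongrightarrow> C * norm (norm (0::'a) ^ 3)) (at 0)"
      by (intro tendsto_intros)
    then show "((\<lambda>x::'a. C * norm (norm x ^ 3)) \<longlongrightarrow> 0) (at 0)" by simp
  qed
  then have r0: "r 0 = 0"
    using smooth_at_imp_isCont[OF sm] by (auto simp: isCont_def intro: tendsto_unique[OF at_neq_bot])
  have Cn: "\<forall>\<^sub>F x in nhds 0. \<bar>r x\<bar> \<le> C * norm x ^ 3"
    using C(2) unfolding eventually_at_filter by eventually_elim (use r0 in auto)
  have dr: "(r has_derivative frechet_derivative r (at 0)) (at 0)"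
    by (rule smooth_at_imp_has_derivative[OF sm])
  have "(r has_derivative (\<lambda>_. 0)) (at 0)"
  proof -
    have "((\<lambda>x::'a. C * norm x ^ 2) \<longlongrightarrow> C * norm (0::'a) ^ 2) (at 0)" by (intro tendsto_intros)
    then have l: "((\<lambda>x::'a. C * norm x ^ 2) \<longlongrightarrow> 0) (at 0)" by simp
    have "\<forall>\<^sub>F x in at 0. norm (norm (r x) / norm x) \<le> C * norm x ^ 2"
      using C(2) unfolding eventually_at_filter
      by eventually_elim (auto simp: field_simps power2_eq_square power3_eq_cube)
    then have "((\<lambda>x. norm (r x) / norm x) \<longlongrightarrow> 0) (at 0)" by (rule Lim_null_comparison[OF _ l])
    then show ?thesis using r0 by (simp add: has_derivative_iff_norm)
  qed
  from has_derivative_unique[OF dr this]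
  have D0: "frechet_derivative r (at 0) v = 0" for v by simp
  then show "frechet_derivative r (at 0) w = 0" .
  define \<rho> where "\<rho> = (\<lambda>w x. frechet_derivative r (at x) w)"
  define L where "L = (\<lambda>w. frechet_derivative (\<rho> w) (at 0))"
  have s\<rho>: "smooth_at (\<rho> w) 0" for w
    unfolding \<rho>_def by (intro smooth_at_frechet_derivative sm smooth_intros)
  have d\<rho>: "(\<rho> w has_derivative L w) (at 0)" for w
    unfolding L_def by (rule smooth_at_imp_has_derivative[OF s\<rho>])
  have linL: "linear (L w)" for w using d\<rho> by (rule has_derivative_linear)
  have lin\<rho>: "\<forall>\<^sub>F x in nhds 0. linear (\<lambda>w. \<rho> w x)"
    using eventually_smooth_at[OF sm]
    by eventually_elim (auto simp: \<rho>_def intro: has_derivative_linear smooth_at_imp_has_derivative)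
  have key: "\<exists>\<theta>. 0 < \<theta> \<and> \<theta> < 1 \<and> \<bar>L w v + \<theta> * L w w\<bar> \<le> \<eta>" if "\<eta> > 0" for v w \<eta>
  proof -
    define K where "K = norm v + norm w + 1"
    have K: "K > 0" "norm v \<le> K" "norm w \<le> K" "norm v + norm w \<le> K" using norm_ge_zero[of v] norm_ge_zero[of w] unfolding K_def by linarith+
    let ?\<epsilon> = "\<eta> / (2 * K)"
    have "?\<epsilon> > 0" using that K by simp
    then have "\<exists>d>0. \<forall>y. norm (y - 0) < d \<longrightarrow>
        norm (\<rho> w y - \<rho> w 0 - L w (y - 0)) \<le> ?\<epsilon> * norm (y - 0)"
      using d\<rho>[of w] unfolding has_derivative_at_alt by blast
    then have "\<forall>\<^sub>F x in nhds 0. norm (\<rho> w x - L w x) \<le> ?\<epsilon> * norm x"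
      unfolding eventually_nhds_metric by (simp add: \<rho>_def D0 dist_norm)
    then have "\<forall>\<^sub>F x in nhds 0. norm (\<rho> w x - L w x) \<le> ?\<epsilon> * norm x \<and> \<bar>r x\<bar> \<le> C * norm x ^ 3 \<and> smooth_at r x"
      using Cn eventually_smooth_at[OF sm] by eventually_elim simp
    then obtain \<delta> where \<delta>: "\<delta> > 0" "\<And>x. norm x < \<delta> \<Longrightarrow>
        norm (\<rho> w x - L w x) \<le> ?\<epsilon> * norm x \<and> \<bar>r x\<bar> \<le> C * norm x ^ 3 \<and> smooth_at r x"
      unfolding eventually_nhds_metric by (auto simp: dist_norm)
    \<comment> \<open>The first bound keeps the segment in the ball of radius \<open>\<delta>\<close>, the second makes the
      cubic estimate of \<open>r\<close> smaller than \<open>\<eta> / 2\<close> after division by \<open>t\<^sup>2\<close>.\<close>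
    define t where "t = min (\<delta> / (2 * K)) (\<eta> / (4 * C * K ^ 3))"
    have t: "t > 0" "t * K < \<delta>" "2 * C * K ^ 3 * t \<le> \<eta> / 2"
    proof -
      show "t > 0" using \<delta>(1) that K C by (simp add: t_def)
      have "t * K \<le> \<delta> / (2 * K) * K" using K by (intro mult_right_mono) (auto simp: t_def)
      also have "\<dots> < \<delta>" using K \<delta>(1) by simp
      finally show "t * K < \<delta>" .
      have "2 * C * K ^ 3 * t \<le> 2 * C * K ^ 3 * (\<eta> / (4 * C * K ^ 3))"
        using K C by (intro mult_left_mono) (auto simp: t_def)
      also have "\<dots> = \<eta> / 2" using K C by (simp add: field_simps)
      finally show "2 * C * K ^ 3 * t \<le> \<eta> / 2" .
    qed
    let ?x = "\<lambda>\<theta>. t *\<^sub>R v + (\<theta> * t) *\<^sub>R w"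
    have nx: "norm (?x \<theta>) \<le> t * K" if "0 \<le> \<theta>" "\<theta> \<le> 1" for \<theta>
    proof -
      have "norm (?x \<theta>) \<le> norm (t *\<^sub>R v) + norm ((\<theta> * t) *\<^sub>R w)" by (rule norm_triangle_ineq)
      also have "\<dots> \<le> t * norm v + t * norm w"
        using that t(1) by (simp add: abs_mult mult_right_mono)
      also have "\<dots> \<le> t * K" using K(4) t(1) by (simp flip: distrib_left)
      finally show ?thesis .
    qed
    have "\<exists>\<theta>>0. \<theta> < 1 \<and> r (?x 1) - r (?x 0) = (1 - 0) * (t * \<rho> w (?x \<theta>))"
    proof (rule MVT2)
      fix \<theta> :: real assume \<theta>: "0 \<le> \<theta>" "\<theta> \<le> 1"
      have sr: "smooth_at r (?x \<theta>)" using \<delta>(2) nx[OF \<theta>] t(2) by simp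
      note d = smooth_at_imp_has_derivative[OF sr]
      have "((\<lambda>\<theta>. r (?x \<theta>)) has_derivative (\<lambda>s. frechet_derivative r (at (?x \<theta>)) ((s * t) *\<^sub>R w))) (at \<theta>)"
        by (rule has_derivative_compose[where f = ?x, OF _ d]) (auto intro!: derivative_eq_intros)
      then show "((\<lambda>\<theta>. r (?x \<theta>)) has_real_derivative t * \<rho> w (?x \<theta>)) (at \<theta>)"
        unfolding has_field_derivative_def
        by (rule has_derivative_eq_rhs)
          (simp add: \<rho>_def fun_eq_iff linear_cmul[OF has_derivative_linear[OF d]] mult_ac)
    qed simp
    then obtain \<theta> where \<theta>: "0 < \<theta>" "\<theta> < 1" "r (?x 1) - r (?x 0) = t * \<rho> w (?x \<theta>)" by auto
    have bound: "\<bar>r (?x \<theta>)\<bar> \<le> C * (t * K) ^ 3" if "0 \<le> \<theta>" "\<theta> \<le> 1" for \<theta>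
    proof -
      have "\<bar>r (?x \<theta>)\<bar> \<le> C * norm (?x \<theta>) ^ 3" using \<delta>(2) nx[OF that] t(2) by simp
      also have "\<dots> \<le> C * (t * K) ^ 3" using nx[OF that] C by (intro mult_left_mono power_mono) auto
      finally show ?thesis .
    qed
    have "t * \<bar>\<rho> w (?x \<theta>)\<bar> \<le> t * (2 * C * K ^ 3 * t * t)"
    proof -
      have "t * \<bar>\<rho> w (?x \<theta>)\<bar> = \<bar>r (?x 1) - r (?x 0)\<bar>" using \<theta>(3) t(1) by (simp add: abs_mult)
      also have "\<dots> \<le> 2 * (C * (t * K) ^ 3)" using bound[of 1] bound[of 0] by simp
      also have "\<dots> = t * (2 * C * K ^ 3 * t * t)" by (simp add: power3_eq_cube)
      finally show ?thesis .
    qed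
    then have "\<bar>\<rho> w (?x \<theta>)\<bar> \<le> 2 * C * K ^ 3 * t * t" using t(1) by simp
    also have "\<dots> \<le> \<eta> / 2 * t" using t(1,3) by (intro mult_right_mono) auto
    finally have 1: "\<bar>\<rho> w (?x \<theta>)\<bar> \<le> \<eta> / 2 * t" .
    have "\<bar>\<rho> w (?x \<theta>) - L w (?x \<theta>)\<bar> \<le> ?\<epsilon> * norm (?x \<theta>)"
      using \<delta>(2) nx[of \<theta>] \<theta> t(2) by simp
    also have "\<dots> \<le> ?\<epsilon> * (t * K)"
      using nx[of \<theta>] \<theta> \<open>?\<epsilon> > 0\<close> by (intro mult_left_mono) auto
    also have "\<dots> = \<eta> / 2 * t" using K by (simp add: field_simps)
    finally have "\<bar>L w (?x \<theta>)\<bar> \<le> \<eta> * t" using 1 by (simp add: abs_if split: if_splits)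
    moreover have "L w (?x \<theta>) = t * (L w v + \<theta> * L w w)"
      by (simp add: linear_add[OF linL] linear_cmul[OF linL] algebra_simps)
    ultimately have "t * \<bar>L w v + \<theta> * L w w\<bar> \<le> t * \<eta>" using t(1) by (simp add: abs_mult mult.commute)
    then have "\<bar>L w v + \<theta> * L w w\<bar> \<le> \<eta>" using t(1) by simp
    then show ?thesis using \<theta> by blast
  qed
  have Lww: "L w w = 0" for w
  proof (rule ccontr)
    assume nz: "L w w \<noteq> 0"
    then obtain \<theta> where "0 < \<theta>" "\<bar>L w w + \<theta> * L w w\<bar> \<le> \<bar>L w w\<bar> / 2"
      using key[of "\<bar>L w w\<bar> / 2" w w] by auto
    moreover have "\<bar>L w w + \<theta> * L w w\<bar> = (1 + \<theta>) * \<bar>L w w\<bar>"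
      using \<open>0 < \<theta>\<close> abs_mult[of "1 + \<theta>" "L w w"] by (simp add: distrib_right)
    ultimately have "(1 + \<theta>) * \<bar>L w w\<bar> \<le> (1 / 2) * \<bar>L w w\<bar>" by simp
    then have "1 + \<theta> \<le> 1 / 2" using nz by simp
    then show False using \<open>0 < \<theta>\<close> by simp
  qed
  have "L w v = 0"
  proof (rule ccontr)
    assume nz: "L w v \<noteq> 0"
    then show False using key[of "\<bar>L w v\<bar> / 2" w v] by (auto simp: Lww)
  qed
  then show "frechet_derivative (\<lambda>x. frechet_derivative r (at x) w) (at 0) v = 0"
    by (simp add: L_def \<rho>_def)
qed

definition frame_gradient ::
    "(3 \<Rightarrow> real^3) \<Rightarrow> ((real^3) \<times> 'p::euclidean_space \<Rightarrow> real) \<Rightarrow> (real^3) \<times> 'p \<Rightarrow> real^3" where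
  "frame_gradient e h z = (\<chi> i. frechet_derivative h (at (frame_point e (fst z), snd z)) (e i, 0))"

lemma bounded_linear_frame_maps:
  "bounded_linear (frame_coords e)" "bounded_linear (frame_point e)"
  using linear_frame_coords linear_frame_point by (simp_all add: linear_conv_bounded_linear)

lemma has_derivative_fixed_parameter:
  assumes "smooth_at h (\<mu>, u)"
  shows "((\<lambda>\<mu>. h (\<mu>, u)) has_derivative (\<lambda>v. frechet_derivative h (at (\<mu>, u)) (v, 0))) (at \<mu>)"
  by (rule has_derivative_compose[where f = "\<lambda>\<mu>. (\<mu>, u)" and f' = "\<lambda>v. (v, 0)",
        OF _ smooth_at_imp_has_derivative[OF assms]])
    (auto intro!: derivative_intros)

lemma G_fun_has_derivative:
  fixes a b c :: real
  assumes "orthonormal_frame e"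
  defines "d \<equiv> vector [2 * a, 2 * b, 2 * c] :: real^3"
  shows "\<exists>D. (G_fun a b c e \<alpha> has_derivative D) (at \<mu>) \<and> (\<forall>i. D (e i) = d $ i * (\<mu> \<bullet> e i) + \<alpha> $ i)"
proof -
  have o: "e i \<bullet> e j = (if i = j then 1 else 0)" for i j
    using assms unfolding orthonormal_frame_def by blast
  let ?D = "\<lambda>v. \<Sum>i\<in>UNIV. (d $ i * (\<mu> \<bullet> e i) + \<alpha> $ i) * (v \<bullet> e i)"
  have "(G_fun a b c e \<alpha> has_derivative ?D) (at \<mu>)"
    unfolding G_fun_def[abs_def] quadratic_part_def
    by (auto intro!: derivative_eq_intros simp: fun_eq_iff sum_3 d_def algebra_simps)
  moreover have "?D (e i) = d $ i * (\<mu> \<bullet> e i) + \<alpha> $ i" for i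
    by (simp add: o if_distrib cong: if_cong)
  ultimately show ?thesis by blast
qed

lemma frame_gradient_of_third_order_perturbation:
  fixes h :: "(real^3) \<times> 'p::euclidean_space \<Rightarrow> real"
  assumes sm: "smooth_at h (0, 0)" and e: "orthonormal_frame e"
    and O: "(\<lambda>\<mu>. h (\<mu>, 0) - k - quadratic_part a b c e \<mu>) \<in> O[at 0](\<lambda>\<mu>. norm \<mu> ^ 3)"
  shows "smooth_at (frame_gradient e h) (0, 0)" "frame_gradient e h (0, 0) = 0"
    and "frechet_derivative (frame_gradient e h) (at (0, 0)) (v, 0) =
      (\<chi> i. (vector [2 * a, 2 * b, 2 * c] :: real^3) $ i * v $ i)"
proof -
  let ?d = "vector [2 * a, 2 * b, 2 * c] :: real^3"
  have fp0: "frame_point e 0 = 0" by (rule linear_0[OF linear_frame_point])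
  let ?z = "\<lambda>z :: (real^3) \<times> 'p. (frame_point e (fst z), snd z)"
  have sz: "smooth_at ?z (0, 0)"
    by (intro smooth_intros smooth_at_linear_image[OF bounded_linear_frame_maps(2)])
  have sD: "smooth_at (\<lambda>z. frechet_derivative h (at z) (w, 0)) (0, 0)" for w
    by (intro smooth_at_frechet_derivative sm smooth_intros)
  have "smooth_at (\<lambda>z. frechet_derivative h (at (?z z)) (w, 0)) (0, 0)" for w
    by (rule smooth_at_compose[of "\<lambda>z. frechet_derivative h (at z) (w, 0)" ?z, OF _ sz]) (simp add: fp0 sD)
  then show smF: "smooth_at (frame_gradient e h) (0, 0)"
    unfolding frame_gradient_def[abs_def] by (intro smooth_intros)
  define r where "r = (\<lambda>\<mu>. h (\<mu>, 0) - k - quadratic_part a b c e \<mu>)"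
  have sh0: "smooth_at (\<lambda>\<mu>. h (\<mu>, 0)) 0"
    by (rule smooth_at_compose[of h]) (auto intro!: smooth_intros sm)
  have sr: "smooth_at r 0"
    unfolding r_def quadratic_part_def power2_eq_square by (intro smooth_intros sh0)
  have r: "frechet_derivative r (at 0) w = 0"
    "frechet_derivative (\<lambda>x. frechet_derivative r (at x) w) (at 0) w' = 0" for w w'
    using third_order_vanishing[OF sr] O by (auto simp: r_def)
  define \<rho> where "\<rho> = (\<lambda>i x. frechet_derivative r (at x) (e i))"
  have "\<forall>\<^sub>F \<mu> in nhds 0. smooth_at h (\<mu>, 0)"
    using smooth_at_eventually[of "\<lambda>\<mu>. (\<mu>, 0)" 0 "smooth_at h"] eventually_smooth_at[OF sm]
    by (simp add: smooth_intros)
  then have grad: "\<forall>\<^sub>F \<mu> in nhds 0. \<forall>i. frechet_derivative h (at (\<mu>, 0)) (e i, 0) = ?d $ i * (\<mu> \<bullet> e i) + \<rho> i \<mu>"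
  proof eventually_elim
    case (elim \<mu>)
    obtain D where D: "(G_fun a b c e 0 has_derivative D) (at \<mu>)" "\<And>i. D (e i) = ?d $ i * (\<mu> \<bullet> e i) + 0 $ i"
      using G_fun_has_derivative[OF e] by blast
    have "G_fun a b c e 0 = quadratic_part a b c e" by (simp add: G_fun_def fun_eq_iff)
    then have "(r has_derivative (\<lambda>v. frechet_derivative h (at (\<mu>, 0)) (v, 0) - 0 - D v)) (at \<mu>)"
      unfolding r_def using D(1)
      by (intro has_derivative_diff has_derivative_fixed_parameter elim has_derivative_const) simp
    from frechet_derivative_at[OF this] show ?case
      unfolding \<rho>_def by (metis (no_types, lifting) D(2) add.commute add_0_right diff_add_cancel diff_zero zero_index)
  qed
  have \<rho>0: "\<rho> i 0 = 0" for i by (simp add: \<rho>_def r)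
  show "frame_gradient e h (0, 0) = 0"
    using eventually_nhds_x_imp_x[OF grad] by (simp add: frame_gradient_def fp0 vec_eq_iff \<rho>0)
  note has_derivative_on_line[OF smF, of v]
  moreover have "((\<lambda>t. frame_gradient e h (t *\<^sub>R v, 0)) has_derivative (\<lambda>s. s *\<^sub>R (\<chi> i. ?d $ i * v $ i))) (at 0)"
  proof -
    have c: "smooth_at (\<lambda>t. frame_point e (t *\<^sub>R v)) 0"
      by (intro smooth_intros smooth_at_linear_image[OF bounded_linear_frame_maps(2)])
    have ev: "\<forall>\<^sub>F t in nhds 0. \<forall>i. frechet_derivative h (at (frame_point e (t *\<^sub>R v), 0)) (e i, 0) =
        ?d $ i * (t * v $ i) + \<rho> i (frame_point e (t *\<^sub>R v))"
    proof -
      have "frame_point e (t *\<^sub>R v) \<bullet> e i = t * v $ i" for t i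
        using arg_cong[OF frame_coords_point[OF e, of "t *\<^sub>R v"], of "\<lambda>x. x $ i"] by (simp add: frame_coords_def)
      then show ?thesis
        using eventually_along_smooth[OF c grad] by (simp add: fp0)
    qed
    have "((\<lambda>t. frame_gradient e h (t *\<^sub>R v, 0) \<bullet> axis i 1) has_derivative (\<lambda>s. (s *\<^sub>R (\<chi> i. ?d $ i * v $ i)) \<bullet> axis i 1)) (at 0)" for i
    proof -
      have "smooth_at (\<rho> i) 0"
        unfolding \<rho>_def by (intro smooth_at_frechet_derivative sr smooth_intros)
      moreover have "frechet_derivative (\<rho> i) (at 0) = (\<lambda>_. 0)" by (rule ext) (simp add: \<rho>_def r(2))
      ultimately have d\<rho>: "(\<rho> i has_derivative (\<lambda>_. 0)) (at (frame_point e (0 *\<^sub>R v)))"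
        using smooth_at_imp_has_derivative[of "\<rho> i" 0] by (simp add: fp0)
      have "((\<lambda>t. \<rho> i (frame_point e (t *\<^sub>R v))) has_derivative (\<lambda>_. 0)) (at 0)"
        by (rule has_derivative_compose[OF smooth_at_imp_has_derivative[OF c] d\<rho>])
      then have "((\<lambda>t. ?d $ i * (t * v $ i) + \<rho> i (frame_point e (t *\<^sub>R v))) has_derivative (\<lambda>s. ?d $ i * (s * v $ i))) (at 0)"
        by (auto intro!: derivative_eq_intros)
      then have "((\<lambda>t. frame_gradient e h (t *\<^sub>R v, 0) \<bullet> axis i 1) has_derivative (\<lambda>s. ?d $ i * (s * v $ i))) (at 0)"
      proof (rule has_derivative_transform_eventually)
        show "\<forall>\<^sub>F t in at 0. ?d $ i * (t * v $ i) + \<rho> i (frame_point e (t *\<^sub>R v)) = frame_gradient e h (t *\<^sub>R v, 0) \<bullet> axis i 1"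
          using ev unfolding eventually_at_filter
          by eventually_elim (simp add: frame_gradient_def inner_axis)
        show "?d $ i * (0 * v $ i) + \<rho> i (frame_point e (0 *\<^sub>R v)) = frame_gradient e h (0 *\<^sub>R v, 0) \<bullet> axis i 1"
          using eventually_nhds_x_imp_x[OF ev] by (simp add: frame_gradient_def inner_axis)
      qed simp
      then show ?thesis by (rule has_derivative_eq_rhs) (simp add: fun_eq_iff inner_axis)
    qed
    then show ?thesis
      by (subst has_derivative_componentwise_within) (auto simp: Basis_vec_def)
  qed
  ultimately have "(\<lambda>s. frechet_derivative (frame_gradient e h) (at (0, 0)) (s *\<^sub>R v, 0)) = (\<lambda>s. s *\<^sub>R (\<chi> i. ?d $ i * v $ i))"
    by (rule has_derivative_unique)
  from fun_cong[OF this, of 1]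
  show "frechet_derivative (frame_gradient e h) (at (0, 0)) (v, 0) = (\<chi> i. ?d $ i * v $ i)" by simp
qed

text \<open>The statement for a family \<open>h\<close> of functions on \<open>so(3)\<^sup>*\<close>.  The predicate \<open>P\<close> carries further
  conditions that the chosen neighbourhoods have to meet.\<close>

lemma singular_set_unfolding:
  fixes h :: "(real^3) \<times> 'p::euclidean_space \<Rightarrow> real"
  assumes sm: "smooth_at h (0, 0)" and e: "orthonormal_frame e" and "a > b" "b > c"
    and O: "(\<lambda>\<mu>. h (\<mu>, 0) - k - quadratic_part a b c e \<mu>) \<in> O[at 0](\<lambda>\<mu>. norm \<mu> ^ 3)"
    and P: "\<forall>\<^sub>F z in nhds (0, 0). P z"
  obtains r \<Phi> \<phi> where "r > 0" "\<phi> 0 = 0"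
    "\<And>\<mu> u. \<mu> \<in> ball 0 r \<Longrightarrow> u \<in> ball 0 r \<Longrightarrow> P (\<mu>, u) \<and> smooth_at \<Phi> (\<mu>, u) \<and> smooth_at \<phi> u \<and>
      (\<mu> \<in> singular_set (\<lambda>\<mu>. h (\<mu>, u)) \<longleftrightarrow> \<Phi> (\<mu>, u) \<in> R_G a b c e (\<phi> u))"
    "\<And>u. u \<in> ball 0 r \<Longrightarrow> diffeo_onto_image (ball 0 r) (\<lambda>\<mu>. \<Phi> (\<mu>, u))"
proof -
  let ?d = "vector [2 * a, 2 * b, 2 * c] :: real^3"
  have inj: "inj (\<lambda>i. ?d $ i)"
    using \<open>a > b\<close> \<open>b > c\<close> by (auto simp: inj_def forall_3)
  note F = frame_gradient_of_third_order_perturbation[OF sm e O]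
  show thesis
  proof (rule normal_form[OF F inj])
    fix \<Psi> \<phi>
    assume \<Psi>: "smooth_at \<Psi> (0, 0)" "\<And>v. frechet_derivative \<Psi> (at (0, 0)) (v, 0) = v"
      "smooth_at \<phi> (0::'p)" "\<phi> 0 = 0"
      "\<forall>\<^sub>F (\<mu>, u) in nhds (0, 0). parallel (frame_gradient e h (\<mu>, u)) \<mu> \<longleftrightarrow>
        parallel (\<chi> i. ?d $ i * \<Psi> (\<mu>, u) $ i + \<phi> u $ i) (\<Psi> (\<mu>, u))"
    let ?z = "\<lambda>z :: (real^3) \<times> 'p. (frame_coords e (fst z), snd z)"
    have fc0: "frame_coords e 0 = 0" by (rule linear_0[OF linear_frame_coords])
    have fp0: "frame_point e 0 = 0" by (rule linear_0[OF linear_frame_point])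
    have sz: "smooth_at ?z (0, 0)"
      by (intro smooth_intros smooth_at_linear_image[OF bounded_linear_frame_maps(1)])
    have z0: "?z (0, 0) = (0, 0)" by (simp add: fc0)
    define \<Phi> where "\<Phi> = (\<lambda>z. frame_point e (\<Psi> (?z z)))"
    have s\<Phi>: "smooth_at \<Phi> (0, 0)"
      unfolding \<Phi>_def
      by (intro smooth_at_linear_image[OF bounded_linear_frame_maps(2)] smooth_at_compose[of \<Psi> ?z, OF _ sz])
        (simp only: z0 \<Psi>(1))
    have D\<Phi>: "frechet_derivative \<Phi> (at (0, 0)) (v, 0) = v" for v
    proof -
      have "(\<Phi> has_derivative (\<lambda>w. frame_point e (frechet_derivative \<Psi> (at (0, 0)) (?z w)))) (at (0, 0))"
        unfolding \<Phi>_def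
      proof (intro bounded_linear.has_derivative[OF bounded_linear_frame_maps(2)] has_derivative_compose[where g = \<Psi> and f = ?z and f' = ?z])
        show "(?z has_derivative ?z) (at (0, 0))"
          by (intro derivative_intros bounded_linear.has_derivative[OF bounded_linear_frame_maps(1)])
        show "(\<Psi> has_derivative frechet_derivative \<Psi> (at (0, 0))) (at (?z (0, 0)))"
          unfolding z0 by (rule smooth_at_imp_has_derivative[OF \<Psi>(1)])
      qed
      from fun_cong[OF frechet_derivative_at[OF this], of "(v, 0)"] show ?thesis
        by (simp add: \<Psi>(2) frame_point_coords[OF e])
    qed
    have "smooth_at snd (0 :: real^3, 0 :: 'p)" by (rule smooth_at_bounded_linear[OF bounded_linear_snd])
    from smooth_at_eventually[OF this, of "smooth_at \<phi>"]
    have e\<phi>: "\<forall>\<^sub>F z in nhds (0 :: real^3, 0). smooth_at \<phi> (snd z)"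
      using eventually_smooth_at[OF \<Psi>(3)] by simp
    have "\<forall>\<^sub>F z in nhds (0, 0). P z \<and> smooth_at \<phi> (snd z) \<and>
      (fst z \<in> singular_set (\<lambda>\<mu>. h (\<mu>, snd z)) \<longleftrightarrow> \<Phi> z \<in> R_G a b c e (\<phi> (snd z)))"
      using P e\<phi> eventually_along_smooth[OF sz \<Psi>(5) z0] eventually_smooth_at[OF sm]
    proof eventually_elim
      case (elim z)
      obtain \<mu> u where z: "z = (\<mu>, u)" by (cases z)
      have "(\<chi> i. frechet_derivative h (at (\<mu>, u)) (e i, 0)) = frame_gradient e h (frame_coords e \<mu>, u)"
        by (simp add: frame_gradient_def frame_point_coords[OF e])
      moreover have "smooth_at h (\<mu>, u)" using elim(4) z by simp
      ultimately have "\<mu> \<in> singular_set (\<lambda>\<mu>. h (\<mu>, u)) \<longleftrightarrow>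
          parallel (frame_gradient e h (frame_coords e \<mu>, u)) (frame_coords e \<mu>)"
        using singular_set_iff_parallel[OF e has_derivative_fixed_parameter] by metis
      also have "\<dots> \<longleftrightarrow> parallel (\<chi> i. ?d $ i * \<Psi> (frame_coords e \<mu>, u) $ i + \<phi> u $ i) (\<Psi> (frame_coords e \<mu>, u))"
        using elim(3) by (simp add: z)
      also have "\<dots> \<longleftrightarrow> \<Phi> z \<in> R_G a b c e (\<phi> u)"
      proof -
        obtain D where D: "(G_fun a b c e (\<phi> u) has_derivative D) (at (\<Phi> z))"
          "\<And>i. D (e i) = ?d $ i * (\<Phi> z \<bullet> e i) + \<phi> u $ i"
          using G_fun_has_derivative[OF e] by blast
        have c: "frame_coords e (\<Phi> z) = \<Psi> (frame_coords e \<mu>, u)"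
          by (simp add: \<Phi>_def z frame_coords_point[OF e])
        have "\<Phi> z \<bullet> e i = \<Psi> (frame_coords e \<mu>, u) $ i" for i
          using arg_cong[OF c, of "\<lambda>x. x $ i"] by (simp add: frame_coords_def)
        then show ?thesis
          unfolding R_G_def singular_set_iff_parallel[OF e D(1)] c D(2) by simp
      qed
      finally show ?case using elim(1,2) by (simp add: z)
    qed
    then show thesis
    proof (rule near_identity_family_diffeo[OF s\<Phi> D\<Phi>])
      fix r :: real
      assume r: "r > 0" "\<And>x u. x \<in> ball 0 r \<Longrightarrow> u \<in> ball 0 r \<Longrightarrow>
          (P (x, u) \<and> smooth_at \<phi> (snd (x, u)) \<and>
            (fst (x, u) \<in> singular_set (\<lambda>\<mu>. h (\<mu>, snd (x, u))) \<longleftrightarrow> \<Phi> (x, u) \<in> R_G a b c e (\<phi> (snd (x, u))))) \<and>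
          smooth_at \<Phi> (x, u)"
        "\<And>u. u \<in> ball 0 r \<Longrightarrow> diffeo_onto_image (ball 0 r) (\<lambda>x. \<Phi> (x, u))"
      show thesis
      proof (rule that[where r = r and \<phi> = \<phi> and \<Phi> = \<Phi>, OF r(1) \<Psi>(4) _ r(3)])
        fix \<mu> u assume "\<mu> \<in> ball (0::real^3) r" "u \<in> ball (0::'p) r"
        from r(2)[OF this] show "P (\<mu>, u) \<and> smooth_at \<Phi> (\<mu>, u) \<and> smooth_at \<phi> u \<and>
          (\<mu> \<in> singular_set (\<lambda>\<mu>. h (\<mu>, u)) \<longleftrightarrow> \<Phi> (\<mu>, u) \<in> R_G a b c e (\<phi> u))" by simp
      qed
    qed
  qed
qed

section \<open>The reduced Hamiltonian in a chart and the critical branch\<close>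

lemma smooth_on_open_imp_smooth_at:
  assumes "open X" "x \<in> X" "smooth_on X f"
  shows "smooth_at f x"
proof -
  obtain W g where W: "open W" "x \<in> W" "\<forall>k. Ck_on W g k" "\<forall>y\<in>X \<inter> W. g y = f y"
    using assms unfolding smooth_on_def by blast
  have "smooth_at g x" using W by (intro smooth_atI) auto
  moreover have "\<forall>\<^sub>F y in nhds x. y \<in> X \<inter> W"
    by (rule eventually_nhds_in_open) (use W assms in auto)
  then have "\<forall>\<^sub>F y in nhds x. g y = f y" by eventually_elim (use W in auto)
  ultimately show ?thesis by (rule smooth_at_cong)
qed

lemma smooth_on_if_local_extension:
  assumes "\<And>x. x \<in> X \<Longrightarrow> \<exists>g. smooth_at g x \<and> (\<forall>\<^sub>F y in nhds x. y \<in> X \<longrightarrow> g y = f y)"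
  shows "smooth_on X f"
  unfolding smooth_on_def
proof
  fix x assume "x \<in> X"
  then obtain g where g: "smooth_at g x" "\<forall>\<^sub>F y in nhds x. y \<in> X \<longrightarrow> g y = f y" using assms by blast
  obtain W where W: "open W" "x \<in> W" "\<And>k. Ck_on W g k"
    using smooth_atE[OF g(1)] by metis
  obtain O1 where O1: "open O1" "x \<in> O1" "\<And>y. y \<in> O1 \<Longrightarrow> y \<in> X \<longrightarrow> g y = f y"
    using g(2) unfolding eventually_nhds by blast
  show "\<exists>W g. open W \<and> x \<in> W \<and> (\<forall>k. Ck_on W g k) \<and> (\<forall>y\<in>X \<inter> W. g y = f y)"
    by (rule exI[of _ "W \<inter> O1"], rule exI[of _ g]) (use W O1 Ck_mono[OF W(3)] in auto)
qed

lemma smooth_on_local_extension: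
  assumes "smooth_on X f" "x \<in> X"
  obtains g where "smooth_at g x" "\<forall>\<^sub>F y in nhds x. y \<in> X \<longrightarrow> g y = f y"
proof -
  obtain W g where W: "open W" "x \<in> W" "\<forall>k. Ck_on W g k" "\<forall>y\<in>X \<inter> W. g y = f y"
    using assms unfolding smooth_on_def by blast
  have "smooth_at g x" using W by (intro smooth_atI) auto
  moreover have "\<forall>\<^sub>F y in nhds x. y \<in> X \<longrightarrow> g y = f y"
    using eventually_nhds_in_open[OF W(1,2)] by eventually_elim (use W(4) in auto)
  ultimately show thesis by (rule that)
qed

lemma continuous_on_eventually_in_open:
  assumes "continuous_on S f" "x \<in> S" "open B" "f x \<in> B"
  shows "\<forall>\<^sub>F y in nhds x. y \<in> S \<longrightarrow> f y \<in> B"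
proof -
  obtain T where "open T" "x \<in> T" "\<forall>y\<in>S. y \<in> T \<longrightarrow> f y \<in> B"
    using assms(1)[unfolded continuous_on_topological, rule_format, OF assms(2-4)] by auto
  then show ?thesis unfolding eventually_nhds by (intro exI[of _ T]) simp
qed

lemma smooth_atlas_chart:
  assumes "smooth_atlas V A" "c \<in> A"
  shows "open (cdom c)" "\<exists>T. open T \<and> cimg c = V \<inter> T" "continuous_on (cimg c) (cinv c)"
    "s \<in> cdom c \<Longrightarrow> cinv c (cmap c s) = s" "x \<in> cimg c \<Longrightarrow> cmap c (cinv c x) = x \<and> cinv c x \<in> cdom c"
    "cimg c \<subseteq> V" "subspace V"
proof -
  have *: "open (cdom c)" "openin (top_of_set V) (cimg c)" "homeomorphism (cdom c) (cimg c) (cmap c) (cinv c)"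
    "subspace V"
    using assms unfolding smooth_atlas_def by auto
  show "open (cdom c)" "subspace V" by (fact *)+
  show ex: "\<exists>T. open T \<and> cimg c = V \<inter> T" using *(2) unfolding openin_open by auto
  then show "cimg c \<subseteq> V" by auto
  show "continuous_on (cimg c) (cinv c)"
    "s \<in> cdom c \<Longrightarrow> cinv c (cmap c s) = s" "x \<in> cimg c \<Longrightarrow> cmap c (cinv c x) = x \<and> cinv c x \<in> cdom c"
    using *(3) unfolding homeomorphism_def by auto
qed

lemma mat_1_in_SO3: "mat 1 \<in> SO3"
  by (simp add: SO3_def orthogonal_matrix_def transpose_mat)

text \<open>The reduced Hamiltonian in a chart is defined only for \<open>x\<close> in the subspace \<open>V\<close>.  Smoothness on
  the chart image provides a smooth function \<open>f\<close> on a full neighbourhood that agrees with it there, and the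
  implicit function theorem can be applied to \<open>f\<close>.\<close>

lemma reduced_chart_representation:
  fixes V :: "'e::euclidean_space set"
    and A :: "('s::topological_space, 'e) chart set"
    and U :: "(real^'d) set"
  assumes "smooth_atlas V A" "phase_space P s\<^sub>e" "open U" "0 \<in> U" "invariant_family A P U H"
    and c: "c \<in> A" "s\<^sub>e \<in> cdom c"
  obtains f :: "(real^3) \<times> 'e \<times> (real^'d) \<Rightarrow> real" where
    "smooth_at f (0, cmap c s\<^sub>e, 0)"
    "\<forall>\<^sub>F (\<mu>, x, u) in nhds (0, cmap c s\<^sub>e, 0). x \<in> cimg c \<longrightarrow>
      u \<in> U \<and> (\<mu>, cinv c x) \<in> reduced_space P \<and> reduced H u \<mu> (cinv c x) = f (\<mu>, x, u)"
proof -
  note ch = smooth_atlas_chart[OF assms(1) c(1)]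
  let ?x = "cmap c s\<^sub>e"
  let ?X = "{(g, \<rho>, x, u). x \<in> cimg c \<and> (g, \<rho>, cinv c x) \<in> P \<and> u \<in> U}"
  let ?F = "\<lambda>(g, \<rho>, x, u). H u (g, \<rho>, cinv c x)"
  have x: "?x \<in> cimg c" "cinv c ?x = s\<^sub>e" using c(2) ch(4) by auto
  have P0: "(mat 1, 0, s\<^sub>e) \<in> P" using assms(2) mat_1_in_SO3 unfolding phase_space_def by blast
  have "smooth_on ?X ?F" using assms(5) c(1) unfolding invariant_family_def by blast
  moreover have "(mat 1, 0, ?x, 0) \<in> ?X" using x P0 assms(4) by simp
  ultimately show thesis
  proof (rule smooth_on_local_extension)
    fix G assume G: "smooth_at G (mat 1, 0, ?x, 0)"
      "\<forall>\<^sub>F y in nhds (mat 1, 0, ?x, 0). y \<in> ?X \<longrightarrow> G y = ?F y"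
    let ?i = "\<lambda>z :: (real^3) \<times> 'e \<times> (real^'d). (mat 1 :: real^3^3, z)"
    have si: "smooth_at ?i (0, ?x, 0)" by (intro smooth_intros)
    have "openin (top_of_set (SO3 \<times> UNIV \<times> UNIV)) P" using assms(2) by (simp add: phase_space_def)
    then obtain T where T: "open T" "P = (SO3 \<times> UNIV \<times> UNIV) \<inter> T" unfolding openin_open by blast
    have "(mat 1, 0, s\<^sub>e) \<in> T" using P0 T(2) by blast
    with T(1) obtain T1 T2 where T12: "open T1" "open T2" "(mat 1, 0, s\<^sub>e) \<in> T1 \<times> T2" "T1 \<times> T2 \<subseteq> T"
      by (rule open_prod_elim)
    have "(0, s\<^sub>e) \<in> T2" using T12(3) by simp
    with T12(2) obtain B1 B2 where B: "open B1" "open B2" "(0, s\<^sub>e) \<in> B1 \<times> B2" "B1 \<times> B2 \<subseteq> T2"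
      by (rule open_prod_elim)
    have PB: "(mat 1, \<mu>, s) \<in> P" if "\<mu> \<in> B1" "s \<in> B2" for \<mu> s
      using that B T12 T(2) mat_1_in_SO3 by auto
    have s1: "smooth_at fst (0 :: real^3, ?x, 0 :: real^'d)" by (rule smooth_at_bounded_linear[OF bounded_linear_fst])
    have s2: "smooth_at (\<lambda>z. fst (snd z)) (0 :: real^3, ?x, 0 :: real^'d)" by (intro smooth_intros)
    have s3: "smooth_at (\<lambda>z. snd (snd z)) (0 :: real^3, ?x, 0 :: real^'d)" by (intro smooth_intros)
    have "\<forall>\<^sub>F z in nhds (0 :: real^3, ?x, 0 :: real^'d). fst z \<in> B1"
      using smooth_at_eventually[OF s1, of "\<lambda>y. y \<in> B1"] eventually_nhds_in_open[OF B(1)] B(3) by simp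
    moreover have "\<forall>\<^sub>F y in nhds ?x. y \<in> cimg c \<longrightarrow> cinv c y \<in> B2"
      by (rule continuous_on_eventually_in_open[OF ch(3) x(1) B(2)]) (use x B in auto)
    then have "\<forall>\<^sub>F z in nhds (0 :: real^3, ?x, 0 :: real^'d). fst (snd z) \<in> cimg c \<longrightarrow> cinv c (fst (snd z)) \<in> B2"
      using smooth_at_eventually[OF s2, of "\<lambda>y. y \<in> cimg c \<longrightarrow> cinv c y \<in> B2"] by simp
    moreover have "\<forall>\<^sub>F z in nhds (0 :: real^3, ?x, 0). snd (snd z) \<in> U"
      using smooth_at_eventually[OF s3, of "\<lambda>y. y \<in> U"] eventually_nhds_in_open[OF assms(3,4)] by simp
    moreover have "\<forall>\<^sub>F z in nhds (0, ?x, 0). (mat 1, z) \<in> ?X \<longrightarrow> G (mat 1, z) = ?F (mat 1, z)"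
      using smooth_at_eventually[OF si, of "\<lambda>y. y \<in> ?X \<longrightarrow> G y = ?F y"] G(2) by simp
    ultimately have "\<forall>\<^sub>F (\<mu>, x, u) in nhds (0, ?x, 0). x \<in> cimg c \<longrightarrow>
      u \<in> U \<and> (\<mu>, cinv c x) \<in> reduced_space P \<and> reduced H u \<mu> (cinv c x) = G (mat 1, \<mu>, x, u)"
    proof eventually_elim
      case (elim z)
      obtain \<mu> x u where z: "z = (\<mu>, x, u)" by (cases z)
      show ?case using elim PB[of \<mu> "cinv c x"] by (auto simp: z reduced_space_def reduced_def)
    qed
    then show thesis
      by (rule that[of "\<lambda>z. G (mat 1, z)", rotated])
        (rule smooth_at_compose[of G, OF G(1) si])
  qed
qed

lemma hfun_smooth:
  fixes V :: "'e::euclidean_space set"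
    and A :: "('s::topological_space, 'e) chart set"
    and U :: "(real^'d) set"
  assumes at: "smooth_atlas V A" and "phase_space P s\<^sub>e" "open U" "0 \<in> U" "invariant_family A P U H"
    and br: "critical_branch A P U H s\<^sub>e N s"
  shows "smooth_at (\<lambda>z. hfun H s (snd z) (fst z)) (0, 0)"
proof -
  obtain c where c: "c \<in> A" "s\<^sub>e \<in> cdom c" using at unfolding smooth_atlas_def by blast
  note ch = smooth_atlas_chart[OF at c(1)]
  have N: "open N" "(0, 0) \<in> N" "continuous_on N s" "s (0, 0) = s\<^sub>e"
    "smooth_on {p \<in> N. s p \<in> cdom c} (cmap c \<circ> s)"
    using br c(1) unfolding critical_branch_def by auto
  have o: "open {p \<in> N. s p \<in> cdom c}"
    using continuous_open_preimage[OF N(3,1) ch(1)] by (simp add: vimage_def Int_def)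
  have sx: "smooth_at (\<lambda>p. cmap c (s p)) (0, 0)"
    using smooth_on_open_imp_smooth_at[OF o _ N(5)] N(2,4) c(2) by (simp add: o_def)
  show ?thesis
  proof (rule reduced_chart_representation[OF assms(1-5) c])
    fix f assume f: "smooth_at f (0, cmap c s\<^sub>e, 0)"
      "\<forall>\<^sub>F (\<mu>, x, u) in nhds (0, cmap c s\<^sub>e, 0). x \<in> cimg c \<longrightarrow>
        u \<in> U \<and> (\<mu>, cinv c x) \<in> reduced_space P \<and> reduced H u \<mu> (cinv c x) = f (\<mu>, x, u)"
    let ?z = "\<lambda>p. (fst p, cmap c (s p), snd p)"
    have sz: "smooth_at ?z (0, 0)" by (intro smooth_intros sx)
    have z0: "?z (0, 0) = (0, cmap c s\<^sub>e, 0)" by (simp add: N(4))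
    show ?thesis
    proof (rule smooth_at_cong)
      show "smooth_at (\<lambda>p. f (?z p)) (0, 0)"
        by (rule smooth_at_compose[of f ?z, OF _ sz]) (simp only: z0 f(1))
      have "\<forall>\<^sub>F p in nhds (0, 0). p \<in> {p \<in> N. s p \<in> cdom c}"
        by (rule eventually_nhds_in_open[OF o]) (use N c in auto)
      then show "\<forall>\<^sub>F p in nhds (0, 0). f (?z p) = hfun H s (snd p) (fst p)"
        using eventually_along_smooth[OF sz f(2) z0]
        by eventually_elim (auto simp: hfun_def ch(4))
    qed
  qed
qed

text \<open>A derivative within \<open>S\<close> sees \<open>L\<close> only in the directions from \<open>x\<close> to points of \<open>S\<close>.\<close>

lemma has_derivative_zero_within:
  assumes "(f has_derivative L) (at x)" "\<And>y. y \<in> S \<Longrightarrow> L (y - x) = 0"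
  shows "(f has_derivative (\<lambda>_. 0)) (at x within S)"
proof -
  have "((\<lambda>y. norm (f y - f x - L (y - x)) / norm (y - x)) \<longlongrightarrow> 0) (at x within S)"
    using has_derivative_at_withinI[OF assms(1), of S] by (simp add: has_derivative_iff_norm)
  moreover have "\<forall>\<^sub>F y in at x within S. norm (f y - f x - L (y - x)) / norm (y - x) = norm (f y - f x - 0) / norm (y - x)"
    unfolding eventually_at_filter by (rule always_eventually) (simp add: assms(2))
  ultimately have "((\<lambda>y. norm (f y - f x - 0) / norm (y - x)) \<longlongrightarrow> 0) (at x within S)"
    by (rule Lim_transform_eventually)
  then show ?thesis by (simp add: has_derivative_iff_norm)
qed

text \<open>Only derivatives of \<open>f\<close> along \<open>V\<close> are meaningful, and the solution has to stay in \<open>V\<close>.  Both are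
  achieved by one equation on the whole Euclidean space: the gradient along \<open>V\<close> plus the component of
  \<open>x - x\<^sub>e\<close> orthogonal to \<open>V\<close>.  The two summands are orthogonal, so both vanish at a solution, and the
  equation is nondegenerate because the Hessian is nondegenerate on \<open>V\<close>.  Being critical is required in every
  chart; it is carried over by the smooth transition maps.\<close>

lemma critical_branch_exists:
  fixes V :: "'e::euclidean_space set"
    and A :: "('s::topological_space, 'e) chart set"
    and U :: "(real^'d) set"
  assumes at: "smooth_atlas V A" and "phase_space P s\<^sub>e" "open U" "0 \<in> U" "invariant_family A P U H"
    and nd: "nondegenerate_rel_equilibrium V A (reduced H 0) s\<^sub>e"
  shows "\<exists>N s. critical_branch A P U H s\<^sub>e N s"
proof -
  obtain c where c: "c \<in> A" "s\<^sub>e \<in> cdom c" using at unfolding smooth_atlas_def by blast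
  note ch = smooth_atlas_chart[OF at c(1)]
  define x\<^sub>e where "x\<^sub>e = cmap c s\<^sub>e"
  have xe: "x\<^sub>e \<in> cimg c" "cinv c x\<^sub>e = s\<^sub>e" "x\<^sub>e \<in> V"
    using c(2) ch(4,6) by (auto simp: x\<^sub>e_def)
  obtain T where T: "open T" "cimg c = V \<inter> T" using ch(2) by blast
  have subV: "subspace V" by (rule ch(7))
  show ?thesis
  proof (rule reduced_chart_representation[OF assms(1-5) c, folded x\<^sub>e_def], rule orthonormal_basis_subspace[OF subV])
    fix f B
    assume f: "smooth_at f (0, x\<^sub>e, 0)"
      and rep: "\<forall>\<^sub>F (\<mu>, x, u) in nhds (0, x\<^sub>e, 0). x \<in> cimg c \<longrightarrow>
        u \<in> U \<and> (\<mu>, cinv c x) \<in> reduced_space P \<and> reduced H u \<mu> (cinv c x) = f (\<mu>, x, u)"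
      and B: "B \<subseteq> V" "pairwise orthogonal B" "\<And>x. x \<in> B \<Longrightarrow> norm x = 1" "independent B" "card B = dim V" "span B = V"
    have finB: "finite B" using B(4) by (rule independent_imp_finite)
    have oB: "b \<bullet> b' = (if b = b' then 1 else 0)" if "b \<in> B" "b' \<in> B" for b b'
      using B(2,3) that by (auto simp: pairwise_def orthogonal_def norm_eq_1)
    define pr where "pr = (\<lambda>v. \<Sum>b\<in>B. (v \<bullet> b) *\<^sub>R b)"
    have pr_in: "pr v \<in> V" for v
      unfolding pr_def using B(1) by (intro subspace_sum[OF subV] subspace_scale[OF subV]) auto
    have inner_comb: "(\<Sum>b\<in>B. k b *\<^sub>R b) \<bullet> b' = k b'" if "b' \<in> B" for k b'
      using that finB by (simp add: inner_sum_left oB if_distrib cong: if_cong)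
    have linear_eq_0: "L w = 0" if "linear L" "\<And>b. b \<in> B \<Longrightarrow> L b = 0" "w \<in> V" for L :: "'e \<Rightarrow> real" and w
      using linear_eq_0_on_span[of L B, OF that(1,2)] that(3) B(6) by blast
    define D where "D = (\<lambda>z w. frechet_derivative f (at z) (0, w, 0))"
    have dx: "((\<lambda>x. f (\<mu>, x, u)) has_derivative D (\<mu>, x, u)) (at x)" if "smooth_at f (\<mu>, x, u)" for \<mu> x u
      unfolding D_def
      by (rule has_derivative_compose[where f = "\<lambda>x. (\<mu>, x, u)" and f' = "\<lambda>v. (0, v, 0)",
            OF _ smooth_at_imp_has_derivative[OF that]])
        (auto intro!: derivative_intros)
    have linD: "linear (D (\<mu>, x, u))" if "smooth_at f (\<mu>, x, u)" for \<mu> x u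
      using dx[OF that] by (rule has_derivative_linear)
    have sD: "smooth_at (\<lambda>z. D z w) (0, x\<^sub>e, 0)" for w
      unfolding D_def by (intro smooth_at_frechet_derivative f smooth_intros)
    let ?F = "reduced H 0 0"
    have ev0: "\<forall>\<^sub>F x in nhds x\<^sub>e. smooth_at f (0, x, 0) \<and> (x \<in> cimg c \<longrightarrow> ?F (cinv c x) = f (0, x, 0))"
    proof -
      have i: "smooth_at (\<lambda>x. (0 :: real^3, x, 0 :: real^'d)) x\<^sub>e" by (intro smooth_intros)
      show ?thesis
        using smooth_at_eventually[OF i rep] smooth_at_eventually[OF i eventually_smooth_at[OF f]]
        by eventually_elim auto
    qed
    obtain T0 where T0: "open T0" "x\<^sub>e \<in> T0"
      "\<And>x. x \<in> T0 \<Longrightarrow> smooth_at f (0, x, 0)" "\<And>x. x \<in> T0 \<Longrightarrow> x \<in> cimg c \<Longrightarrow> ?F (cinv c x) = f (0, x, 0)"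
      using ev0 unfolding eventually_nhds by blast
    have nbhd: "\<forall>\<^sub>F t in nhds 0. x + t *\<^sub>R w \<in> cimg c \<inter> T0" if "x \<in> cimg c \<inter> T0" "w \<in> V" for x w
    proof -
      have "smooth_at (\<lambda>t. x + t *\<^sub>R w) 0" by (intro smooth_intros)
      from smooth_at_eventually[OF this, of "\<lambda>y. y \<in> T \<inter> T0"]
      have "\<forall>\<^sub>F t in nhds 0. x + t *\<^sub>R w \<in> T \<inter> T0"
        using eventually_nhds_in_open[OF open_Int[OF T(1) T0(1)], of x] that(1) T(2) by simp
      then show ?thesis
        by eventually_elim (use that T(2) subspace_add[OF subV] subspace_scale[OF subV] in auto)
    qed
    have slope: "((\<lambda>r. f (0, x + r *\<^sub>R w, 0)) has_real_derivative D (0, x, 0) w) (at 0)"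
      if "x \<in> T0" for x w
    proof -
      have "((\<lambda>r. f (0, x + r *\<^sub>R w, 0)) has_derivative (\<lambda>s. D (0, x, 0) (s *\<^sub>R w))) (at 0)"
        by (rule has_derivative_compose[where f = "\<lambda>r. x + r *\<^sub>R w" and g = "\<lambda>x. f (0, x, 0)"])
          (auto intro!: derivative_eq_intros dx T0(3) that)
      then show ?thesis
        unfolding has_field_derivative_def
        by (rule has_derivative_eq_rhs) (simp add: fun_eq_iff linear_cmul[OF linD[OF T0(3)[OF that]]] mult.commute)
    qed
    have slope_F: "deriv (\<lambda>r. ?F (cinv c (x + r *\<^sub>R w))) 0 = D (0, x, 0) w"
      if "x \<in> cimg c \<inter> T0" "w \<in> V" for x w
    proof -
      have "\<forall>\<^sub>F r in nhds 0. ?F (cinv c (x + r *\<^sub>R w)) = f (0, x + r *\<^sub>R w, 0)"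
        using nbhd[OF that] by eventually_elim (use T0(4) in auto)
      then have "deriv (\<lambda>r. ?F (cinv c (x + r *\<^sub>R w))) 0 = deriv (\<lambda>r. f (0, x + r *\<^sub>R w, 0)) 0"
        by (rule deriv_cong_ev) simp
      also have "\<dots> = D (0, x, 0) w" using slope[of x w] that(1) by (intro DERIV_imp_deriv) auto
      finally show ?thesis .
    qed
    have xeT0: "x\<^sub>e \<in> cimg c \<inter> T0" using xe T0 by auto
    have crit: "D (0, x\<^sub>e, 0) w = 0" if w: "w \<in> V" for w
    proof -
      obtain S where S: "open S" "0 \<in> S" "\<And>t. t \<in> S \<Longrightarrow> x\<^sub>e + t *\<^sub>R w \<in> cimg c \<inter> T0"
        using nbhd[OF xeT0 w] unfolding eventually_nhds by blast
      have "((\<lambda>x. ?F (cinv c x)) has_derivative (\<lambda>_. 0)) (at (x\<^sub>e + 0 *\<^sub>R w) within cimg c)"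
        using nd c unfolding nondegenerate_rel_equilibrium_def zero_momentum_rel_equilibrium_def critical_point_def
        by (simp add: x\<^sub>e_def)
      then have "((\<lambda>x. ?F (cinv c x)) has_derivative (\<lambda>_. 0)) (at (x\<^sub>e + 0 *\<^sub>R w) within (\<lambda>t. x\<^sub>e + t *\<^sub>R w) ` S)"
        by (rule has_derivative_subset) (use S(3) in auto)
      then have "((\<lambda>t. ?F (cinv c (x\<^sub>e + t *\<^sub>R w))) has_derivative (\<lambda>_. 0)) (at 0 within S)"
        by (rule has_derivative_in_compose[rotated, where f' = "\<lambda>s. s *\<^sub>R w"]) (auto intro!: derivative_eq_intros)
      then have "((\<lambda>t. ?F (cinv c (x\<^sub>e + t *\<^sub>R w))) has_derivative (\<lambda>_. 0)) (at 0)"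
        using at_within_open[OF S(2,1)] by simp
      then have "((\<lambda>t. ?F (cinv c (x\<^sub>e + t *\<^sub>R w))) has_real_derivative 0) (at 0)"
        unfolding has_field_derivative_def by (rule has_derivative_eq_rhs) (simp add: fun_eq_iff)
      from DERIV_imp_deriv[OF this] show ?thesis using slope_F[OF xeT0 w] by simp
    qed
    let ?z = "\<lambda>z. (fst (snd z), fst z, snd (snd z))"
    let ?E = "\<lambda>z. (\<Sum>b\<in>B. D (?z z) b *\<^sub>R b) + ((fst z - x\<^sub>e) - pr (fst z - x\<^sub>e))"
    show ?thesis
    proof (rule smooth_implicit_function[of ?E x\<^sub>e "(0, 0)"])
      have sz: "smooth_at ?z (x\<^sub>e, 0, 0)" by (intro smooth_intros)
      have "smooth_at (\<lambda>z. D (?z z) w) (x\<^sub>e, 0, 0)" for w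
        by (rule smooth_at_compose[of "\<lambda>z. D z w" ?z, OF _ sz]) (simp add: sD)
      then show "smooth_at ?E (x\<^sub>e, 0, 0)" unfolding pr_def by (intro smooth_intros)
      show "?E (x\<^sub>e, 0, 0) = 0" using crit B(1) by (simp add: pr_def subset_eq)
    next
      fix v
      assume asm: "((\<lambda>t. ?E (x\<^sub>e + t *\<^sub>R v, 0, 0)) has_vector_derivative 0) (at 0)"
      define \<delta> where "\<delta> = (\<lambda>w. frechet_derivative (\<lambda>t. D (0, x\<^sub>e + t *\<^sub>R v, 0) w) (at 0) 1)"
      have d\<delta>: "((\<lambda>t. D (0, x\<^sub>e + t *\<^sub>R v, 0) w) has_real_derivative \<delta> w) (at 0)" for w
      proof -
        have "smooth_at (\<lambda>t. D (0, x\<^sub>e + t *\<^sub>R v, 0) w) 0"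
          by (rule smooth_at_compose[of "\<lambda>z. D z w"]) (auto intro!: smooth_intros sD)
        note d = smooth_at_imp_has_derivative[OF this]
        have "frechet_derivative (\<lambda>t. D (0, x\<^sub>e + t *\<^sub>R v, 0) w) (at 0) s = \<delta> w * s" for s
          using linear_cmul[OF has_derivative_linear[OF d], of s 1] by (simp add: \<delta>_def mult.commute)
        then have "frechet_derivative (\<lambda>t. D (0, x\<^sub>e + t *\<^sub>R v, 0) w) (at 0) = (*) (\<delta> w)"
          by (rule ext)
        then show ?thesis using d unfolding has_field_derivative_def by simp
      qed
      have "((\<lambda>t. ?E (x\<^sub>e + t *\<^sub>R v, 0, 0)) has_vector_derivative ((\<Sum>b\<in>B. \<delta> b *\<^sub>R b) + (v - pr v))) (at 0)"
      proof -
        have "((\<lambda>t. pr (t *\<^sub>R v)) has_vector_derivative pr v) (at 0)"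
        proof -
          have "pr (t *\<^sub>R v) = t *\<^sub>R pr v" for t by (simp add: pr_def scaleR_sum_right)
          then show ?thesis by (auto intro!: derivative_eq_intros)
        qed
        moreover have "((\<lambda>t. D (0, x\<^sub>e + t *\<^sub>R v, 0) b *\<^sub>R b) has_vector_derivative \<delta> b *\<^sub>R b) (at 0)" for b
          using bounded_linear.has_vector_derivative[OF bounded_linear_scaleR_left, of _ "\<delta> b"] d\<delta>[of b]
          by (simp add: has_real_derivative_iff_has_vector_derivative)
        ultimately show ?thesis
          by (auto intro!: has_vector_derivative_add has_vector_derivative_diff has_vector_derivative_sum derivative_eq_intros d\<delta>)
      qed
      then have "(\<Sum>b\<in>B. \<delta> b *\<^sub>R b) + (v - pr v) = 0"
        using vector_derivative_unique_at[OF asm] by simp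
      then have eq: "v - pr v = - (\<Sum>b\<in>B. \<delta> b *\<^sub>R b)" by (simp add: eq_neg_iff_add_eq_0 add.commute)
      have \<delta>0: "\<delta> b = 0" if "b \<in> B" for b
      proof -
        have "(v - pr v) \<bullet> b = 0" unfolding pr_def by (simp add: inner_diff_left inner_comb[OF that])
        then show ?thesis unfolding eq by (simp add: inner_comb[OF that])
      qed
      then have "v = pr v" using eq by simp
      then have vV: "v \<in> V" using pr_in[of v] by simp
      have "hessian c ?F s\<^sub>e v w = 0" if w: "w \<in> V" for w
      proof -
        have "hessian c ?F s\<^sub>e v w = deriv (\<lambda>t. D (0, x\<^sub>e + t *\<^sub>R v, 0) w) 0"
          unfolding hessian_def x\<^sub>e_def[symmetric]
        proof (rule deriv_cong_ev[OF _ refl])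
          show "\<forall>\<^sub>F t in nhds 0. deriv (\<lambda>r. ?F (cinv c (x\<^sub>e + t *\<^sub>R v + r *\<^sub>R w))) 0 = D (0, x\<^sub>e + t *\<^sub>R v, 0) w"
            using nbhd[OF xeT0 vV] by eventually_elim (rule slope_F[OF _ w])
        qed
        also have "\<dots> = \<delta> w" by (rule DERIV_imp_deriv[OF d\<delta>])
        also have "\<delta> w = 0"
        proof (rule linear_eq_0[OF _ \<delta>0 w])
          have ev: "\<forall>\<^sub>F t in nhds 0. linear (D (0, x\<^sub>e + t *\<^sub>R v, 0))"
            using nbhd[OF xeT0 vV] by eventually_elim (use linD T0(3) in auto)
          show "linear \<delta>"
          proof (rule linearI)
            fix w1 w2 :: 'e and k :: real
            have "((\<lambda>t. D (0, x\<^sub>e + t *\<^sub>R v, 0) w1 + D (0, x\<^sub>e + t *\<^sub>R v, 0) w2) has_real_derivative \<delta> (w1 + w2)) (at 0)"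
              by (rule DERIV_cong_ev[THEN iffD1, OF refl _ refl d\<delta>[of "w1 + w2"]])
                (use ev in \<open>eventually_elim, simp add: linear_add\<close>)
            then show "\<delta> (w1 + w2) = \<delta> w1 + \<delta> w2" using DERIV_add[OF d\<delta> d\<delta>] by (rule DERIV_unique)
            have "((\<lambda>t. k * D (0, x\<^sub>e + t *\<^sub>R v, 0) w1) has_real_derivative \<delta> (k *\<^sub>R w1)) (at 0)"
              by (rule DERIV_cong_ev[THEN iffD1, OF refl _ refl d\<delta>[of "k *\<^sub>R w1"]])
                (use ev in \<open>eventually_elim, simp add: linear_cmul\<close>)
            then show "\<delta> (k *\<^sub>R w1) = k *\<^sub>R \<delta> w1" using DERIV_cmult[OF d\<delta>, of k w1] DERIV_unique by fastforce
          qed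
        qed
        finally show ?thesis .
      qed
      then show "v = 0"
        using nd c vV unfolding nondegenerate_rel_equilibrium_def nondegenerate_hessian_def by blast
    next
      fix x
      assume x: "smooth_at x (0, 0)" "x (0, 0) = x\<^sub>e" "\<forall>\<^sub>F p in nhds (0, 0). ?E (x p, p) = 0"
      let ?y = "\<lambda>p. (fst p, x p, snd p)"
      have sy: "smooth_at ?y (0, 0)" by (intro smooth_intros x(1))
      have y0: "?y (0, 0) = (0, x\<^sub>e, 0)" by (simp add: x(2))
      let ?rep = "\<lambda>(\<mu>, x, u). x \<in> cimg c \<longrightarrow>
        u \<in> U \<and> (\<mu>, cinv c x) \<in> reduced_space P \<and> reduced H u \<mu> (cinv c x) = f (\<mu>, x, u)"
      have good: "\<forall>\<^sub>F p in nhds (0, 0). smooth_at x p \<and> x p \<in> cimg c \<and>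
        smooth_at f (?y p) \<and> (\<forall>w\<in>V. D (?y p) w = 0) \<and> (\<forall>\<^sub>F z in nhds (?y p). ?rep z)"
      proof -
        have "\<forall>\<^sub>F p in nhds (0, 0). x p \<in> T"
          using smooth_at_eventually[OF x(1), of "\<lambda>x. x \<in> T"] eventually_nhds_in_open[OF T(1)] xe(1) T(2) x(2) by simp
        moreover have "\<forall>\<^sub>F p in nhds (0, 0). \<forall>\<^sub>F z in nhds (?y p). ?rep z"
          by (rule eventually_along_smooth[OF sy _ y0, of "\<lambda>y. \<forall>\<^sub>F z in nhds y. ?rep z"])
            (simp only: eventually_eventually rep)
        ultimately show ?thesis
          using eventually_smooth_at[OF x(1)] eventually_along_smooth[OF sy eventually_smooth_at[OF f] y0] x(3)
        proof eventually_elim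
          case (elim p)
          have E: "(\<Sum>b\<in>B. D (?y p) b *\<^sub>R b) + ((x p - x\<^sub>e) - pr (x p - x\<^sub>e)) = 0" using elim(5) by simp
          have Db: "D (?y p) b = 0" if "b \<in> B" for b
          proof -
            have "((x p - x\<^sub>e) - pr (x p - x\<^sub>e)) \<bullet> b = 0"
              unfolding pr_def by (simp add: inner_diff_left inner_comb[OF that])
            then show ?thesis
              using arg_cong[OF E, of "\<lambda>v. v \<bullet> b"] by (simp add: inner_add_left inner_comb[OF that])
          qed
          then have "x p - x\<^sub>e = pr (x p - x\<^sub>e)" using E by simp
          then have "x p - x\<^sub>e \<in> V" using pr_in[of "x p - x\<^sub>e"] by simp
          then have "x p \<in> V" using subspace_add[OF subV _ xe(3), of "x p - x\<^sub>e"] by simp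
          then have "x p \<in> cimg c" using elim(1) T(2) by simp
          moreover have "D (?y p) w = 0" if "w \<in> V" for w
            using linear_eq_0[OF linD[OF elim(4)] Db that] .
          ultimately show ?case using elim by blast
        qed
      qed
      obtain N where N: "open N" "(0, 0) \<in> N"
        "\<And>p. p \<in> N \<Longrightarrow> smooth_at x p \<and> x p \<in> cimg c \<and>
          smooth_at f (?y p) \<and> (\<forall>w\<in>V. D (?y p) w = 0) \<and> (\<forall>\<^sub>F z in nhds (?y p). ?rep z)"
        using good unfolding eventually_nhds by blast
      let ?s = "\<lambda>p. cinv c (x p)"
      have contx: "continuous_on N x"
        using N(3) smooth_at_imp_isCont by (intro continuous_at_imp_continuous_on) blast
      have "critical_branch A P U H s\<^sub>e N ?s"
        unfolding critical_branch_def
      proof (intro conjI ballI)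
        show "open N" "(0, 0) \<in> N" by (fact N)+
        show "continuous_on N ?s"
          by (rule continuous_on_compose2[OF ch(3) contx]) (use N(3) in auto)
        show "cinv c (x (0, 0)) = s\<^sub>e" by (simp add: x(2) xe)
      next
        fix c' assume c': "c' \<in> A"
        show "smooth_on {p \<in> N. cinv c (x p) \<in> cdom c'} (cmap c' \<circ> ?s)"
        proof (rule smooth_on_if_local_extension)
          fix p assume p: "p \<in> {p \<in> N. cinv c (x p) \<in> cdom c'}"
          have tr: "smooth_on (cmap c ` (cdom c \<inter> cdom c')) (cmap c' \<circ> cinv c)"
            using at c(1) c' unfolding smooth_atlas_def by blast
          have mem: "x p \<in> cmap c ` (cdom c \<inter> cdom c')" if "p \<in> {p \<in> N. cinv c (x p) \<in> cdom c'}" for p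
            using that N(3)[of p] ch(5)[of "x p"] by (intro image_eqI[of _ _ "cinv c (x p)"]) auto
          from tr mem[OF p]
          show "\<exists>g. smooth_at g p \<and> (\<forall>\<^sub>F q in nhds p. q \<in> {p \<in> N. cinv c (x p) \<in> cdom c'} \<longrightarrow> g q = (cmap c' \<circ> ?s) q)"
          proof (rule smooth_on_local_extension)
            fix g assume g: "smooth_at g (x p)"
              "\<forall>\<^sub>F y in nhds (x p). y \<in> cmap c ` (cdom c \<inter> cdom c') \<longrightarrow> g y = (cmap c' \<circ> cinv c) y"
            have sx: "smooth_at x p" using N(3) p by blast
            show ?thesis
            proof (intro exI conjI)
              show "smooth_at (\<lambda>p. g (x p)) p" by (rule smooth_at_compose[OF g(1) sx])
              show "\<forall>\<^sub>F q in nhds p. q \<in> {p \<in> N. cinv c (x p) \<in> cdom c'} \<longrightarrow> g (x q) = (cmap c' \<circ> ?s) q"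
                using smooth_at_eventually[OF sx g(2)] by eventually_elim (use mem in auto)
            qed
          qed
        qed
      next
        fix p assume p: "p \<in> N"
        obtain \<mu> u where pu: "p = (\<mu>, u)" by (cases p)
        note Np = N(3)[OF p]
        have r0: "u \<in> U \<and> (\<mu>, ?s p) \<in> reduced_space P"
          using eventually_nhds_x_imp_x[of ?rep "?y p"] Np by (auto simp: pu)
        have "critical_point A (reduced H u \<mu>) (?s p)"
          unfolding critical_point_def
        proof (intro ballI impI)
          fix c' assume c': "c' \<in> A" "?s p \<in> cdom c'"
          note ch' = smooth_atlas_chart[OF at c'(1)]
          let ?S = "cmap c' ` (cdom c' \<inter> cdom c)"
          define y where "y = cmap c' (?s p)"
          have yinv: "cinv c' y = ?s p" using ch'(4)[OF c'(2)] by (simp add: y_def)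
          have yimg: "y \<in> cimg c'" using c'(2) by (simp add: y_def)
          have sp: "?s p \<in> cdom c" using ch(5) Np by blast
          have yS: "y \<in> ?S" using c'(2) sp by (simp add: y_def)
          have S_mem: "cinv c' y' \<in> cdom c" "cmap c (cinv c' y') \<in> cimg c" "y' \<in> cimg c'" if "y' \<in> ?S" for y'
            using that ch'(4) by auto
          have tr: "smooth_on ?S (cmap c \<circ> cinv c')"
            using at c(1) c' unfolding smooth_atlas_def by blast
          from tr yS show "((\<lambda>y. reduced H u \<mu> (cinv c' y)) has_derivative (\<lambda>_. 0)) (at (cmap c' (?s p)) within cimg c')"
            unfolding y_def[symmetric]
          proof (rule smooth_on_local_extension)
            fix g assume g: "smooth_at g y" "\<forall>\<^sub>F y' in nhds y. y' \<in> ?S \<longrightarrow> g y' = (cmap c \<circ> cinv c') y'"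
            have gy: "g y = x p"
              using eventually_nhds_x_imp_x[OF g(2)] yS yinv ch(5)[of "x p"] Np by auto
            have evrep: "\<forall>\<^sub>F y' in nhds y. ?rep (\<mu>, g y', u)"
            proof -
              have "smooth_at (\<lambda>y'. (\<mu>, g y', u)) y" by (intro smooth_intros g(1))
              from eventually_along_smooth[OF this, of ?rep "?y p"] show ?thesis using Np by (simp add: pu gy)
            qed
            have evS: "\<forall>\<^sub>F y' in nhds y. y' \<in> cimg c' \<longrightarrow> y' \<in> ?S"
            proof -
              have "\<forall>\<^sub>F y' in nhds y. y' \<in> cimg c' \<longrightarrow> cinv c' y' \<in> cdom c"
                by (rule continuous_on_eventually_in_open[OF ch'(3) yimg ch(1)]) (simp add: yinv sp)
              then show ?thesis
              proof eventually_elim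
                case (elim y')
                show ?case
                proof
                  assume y': "y' \<in> cimg c'"
                  then show "y' \<in> ?S" using elim ch'(5)[OF y'] by (intro image_eqI[of _ _ "cinv c' y'"]) auto
                qed
              qed
            qed
            obtain O1 where O1: "open O1" "y \<in> O1"
              "\<And>y'. y' \<in> O1 \<Longrightarrow> y' \<in> cimg c' \<Longrightarrow>
                cmap c (cinv c' y') = g y' \<and> g y' \<in> cimg c \<and> reduced H u \<mu> (cinv c' y') = f (\<mu>, g y', u)"
            proof -
              have "\<forall>\<^sub>F y' in nhds y. y' \<in> cimg c' \<longrightarrow>
                cmap c (cinv c' y') = g y' \<and> g y' \<in> cimg c \<and> reduced H u \<mu> (cinv c' y') = f (\<mu>, g y', u)"
                using evrep evS g(2)
              proof eventually_elim
                case (elim y')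
                show ?case
                proof
                  assume "y' \<in> cimg c'"
                  then have y'S: "y' \<in> ?S" using elim(2) by blast
                  then have gy': "g y' = cmap c (cinv c' y')" using elim(3) by simp
                  have "cinv c (g y') = cinv c' y'" using ch(4) S_mem(1)[OF y'S] by (simp add: gy')
                  then show "cmap c (cinv c' y') = g y' \<and> g y' \<in> cimg c \<and> reduced H u \<mu> (cinv c' y') = f (\<mu>, g y', u)"
                    using elim(1) S_mem(2)[OF y'S] gy' by auto
                qed
              qed
              then show thesis using that unfolding eventually_nhds by auto
            qed
            let ?C = "cimg c' \<inter> O1"
            \<comment> \<open>The extension \<open>g\<close> of the transition map sends chart points into \<open>V\<close>, where \<open>f\<close> is stationary.\<close>
            have "((\<lambda>x. f (\<mu>, x, u)) has_derivative (\<lambda>_. 0)) (at (g y) within V)"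
              unfolding gy
            proof (rule has_derivative_zero_within[OF dx])
              show "smooth_at f (\<mu>, x p, u)" using Np by (simp add: pu)
              show "D (\<mu>, x p, u) (y - x p) = 0" if "y \<in> V" for y
                using Np that subspace_diff[OF subV, of y "x p"] ch(6) by (auto simp: pu)
            qed
            then have "((\<lambda>x. f (\<mu>, x, u)) has_derivative (\<lambda>_. 0)) (at (g y) within g ` ?C)"
              by (rule has_derivative_subset) (use O1(3) ch(6) in auto)
            then have "((\<lambda>y. f (\<mu>, g y, u)) has_derivative (\<lambda>_. 0)) (at y within ?C)"
              by (rule has_derivative_in_compose[OF has_derivative_at_withinI[OF smooth_at_imp_has_derivative[OF g(1)]]])
            then have "((\<lambda>y. reduced H u \<mu> (cinv c' y)) has_derivative (\<lambda>_. 0)) (at y within ?C)"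
              by (rule has_derivative_transform[rotated 2]) (use O1 yimg in auto)
            moreover have "at y within ?C = at y within cimg c'"
              by (rule at_within_nhd[OF O1(2,1)]) auto
            ultimately show "((\<lambda>y. reduced H u \<mu> (cinv c' y)) has_derivative (\<lambda>_. 0)) (at y within cimg c')" by simp
          qed
        qed
        with r0 show "case p of (\<mu>, u) \<Rightarrow> u \<in> U \<and> (\<mu>, cinv c (x (\<mu>, u))) \<in> reduced_space P \<and>
            critical_point A (reduced H u \<mu>) (cinv c (x (\<mu>, u)))"
          by (simp add: pu)
      qed
      then show ?thesis by blast
    qed
  qed
qed

section \<open>The unfolding theorem\<close>

theorem theorem2p1:
  fixes V :: "'e::euclidean_space set"
    and A :: "('s::{t2_space, second_countable_topology}, 'e) chart set"
    and \<omega> :: "('s, 'e) chart \<Rightarrow> 'e \<Rightarrow> 'e \<Rightarrow> 'e \<Rightarrow> real"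
    and P :: "((real^3^3) \<times> (real^3) \<times> 's) set"
    and U :: "(real^'d) set"
    and H :: "real^'d \<Rightarrow> (real^3^3) \<times> (real^3) \<times> 's \<Rightarrow> real"
    and s\<^sub>e :: 's
    and a b c :: real
    and e :: "3 \<Rightarrow> real^3"
  assumes "smooth_atlas V A"
    and "symplectic_form V A \<omega>"
    and "phase_space P s\<^sub>e"
    and "open U" and "0 \<in> U"
    and "invariant_family A P U H"
    and "nondegenerate_rel_equilibrium V A (reduced H 0) s\<^sub>e"
    and "zero_momentum_equilibrium A (reduced H 0) s\<^sub>e"
    and "a > b" and "b > c"
    and "orthonormal_frame e"
  shows "(\<exists>N s. critical_branch A P U H s\<^sub>e N s) \<and>
    (\<forall>N s. critical_branch A P U H s\<^sub>e N s \<longrightarrow>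
      (\<exists>k. (\<lambda>\<mu>. hfun H s 0 \<mu> - k - quadratic_part a b c e \<mu>) \<in> O[at 0](\<lambda>\<mu>. norm \<mu> ^ 3)) \<longrightarrow>
      (\<exists>U' M \<Phi>\<^sub>1 \<phi>.
        open U' \<and> 0 \<in> U' \<and> U' \<subseteq> U \<and> open M \<and> 0 \<in> M \<and> M \<times> U' \<subseteq> N \<and>
        smooth_on (M \<times> U') (\<lambda>(\<mu>, u). (\<Phi>\<^sub>1 \<mu> u, \<phi> u)) \<and>
        \<phi> 0 = 0 \<and>
        (\<forall>\<mu>\<in>M. \<forall>u\<in>U'. (\<mu>, u) \<in> R_H_family H N s \<longleftrightarrow> (\<Phi>\<^sub>1 \<mu> u, \<phi> u) \<in> R_G_family a b c e) \<and>
        (\<forall>u\<in>U'. diffeo_onto_image M (\<lambda>\<mu>. \<Phi>\<^sub>1 \<mu> u) \<and>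
           (\<lambda>\<mu>. \<Phi>\<^sub>1 \<mu> u) ` (R_H H N s u \<inter> M) = R_G a b c e (\<phi> u) \<inter> (\<lambda>\<mu>. \<Phi>\<^sub>1 \<mu> u) ` M)))"
proof (intro conjI allI impI)
  show "\<exists>N s. critical_branch A P U H s\<^sub>e N s"
    by (rule critical_branch_exists) (use assms in auto)
next
  fix N s
  assume br: "critical_branch A P U H s\<^sub>e N s"
    and "\<exists>k. (\<lambda>\<mu>. hfun H s 0 \<mu> - k - quadratic_part a b c e \<mu>) \<in> O[at 0](\<lambda>\<mu>. norm \<mu> ^ 3)"
  then obtain k where k: "(\<lambda>\<mu>. hfun H s 0 \<mu> - k - quadratic_part a b c e \<mu>) \<in> O[at 0](\<lambda>\<mu>. norm \<mu> ^ 3)"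
    by blast
  have N: "open N" "(0, 0) \<in> N" "\<And>\<mu> u. (\<mu>, u) \<in> N \<Longrightarrow> u \<in> U"
    using br unfolding critical_branch_def by auto
  let ?h = "\<lambda>z. hfun H s (snd z) (fst z)"
  have sm: "smooth_at ?h (0, 0)"
    using assms(1,3-6) br by (rule hfun_smooth)
  have evN: "\<forall>\<^sub>F z in nhds (0, 0). z \<in> N" using N(1,2) by (rule eventually_nhds_in_open)
  show "\<exists>U' M \<Phi>\<^sub>1 \<phi>.
        open U' \<and> 0 \<in> U' \<and> U' \<subseteq> U \<and> open M \<and> 0 \<in> M \<and> M \<times> U' \<subseteq> N \<and>
        smooth_on (M \<times> U') (\<lambda>(\<mu>, u). (\<Phi>\<^sub>1 \<mu> u, \<phi> u)) \<and>
        \<phi> 0 = 0 \<and>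
        (\<forall>\<mu>\<in>M. \<forall>u\<in>U'. (\<mu>, u) \<in> R_H_family H N s \<longleftrightarrow> (\<Phi>\<^sub>1 \<mu> u, \<phi> u) \<in> R_G_family a b c e) \<and>
        (\<forall>u\<in>U'. diffeo_onto_image M (\<lambda>\<mu>. \<Phi>\<^sub>1 \<mu> u) \<and>
           (\<lambda>\<mu>. \<Phi>\<^sub>1 \<mu> u) ` (R_H H N s u \<inter> M) = R_G a b c e (\<phi> u) \<inter> (\<lambda>\<mu>. \<Phi>\<^sub>1 \<mu> u) ` M)"
  proof (rule singular_set_unfolding[where P = "\<lambda>z. z \<in> N" and k = k, OF sm assms(11,9,10) _ evN])
    show "(\<lambda>\<mu>. ?h (\<mu>, 0) - k - quadratic_part a b c e \<mu>) \<in> O[at 0](\<lambda>\<mu>. norm \<mu> ^ 3)"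
      using k by simp
  next
    fix r :: real and \<Phi> and \<phi> :: "real^'d \<Rightarrow> real^3"
    assume r: "r > 0" "\<phi> 0 = 0"
      "\<And>\<mu> u. \<mu> \<in> ball 0 r \<Longrightarrow> u \<in> ball 0 r \<Longrightarrow> (\<mu>, u) \<in> N \<and> smooth_at \<Phi> (\<mu>, u) \<and> smooth_at \<phi> u \<and>
        (\<mu> \<in> singular_set (\<lambda>\<mu>. ?h (\<mu>, u)) \<longleftrightarrow> \<Phi> (\<mu>, u) \<in> R_G a b c e (\<phi> u))"
      "\<And>u. u \<in> ball 0 r \<Longrightarrow> diffeo_onto_image (ball 0 r) (\<lambda>\<mu>. \<Phi> (\<mu>, u))"
    have R: "\<mu> \<in> R_H H N s u \<longleftrightarrow> \<Phi> (\<mu>, u) \<in> R_G a b c e (\<phi> u)"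
      if "\<mu> \<in> ball 0 r" "u \<in> ball 0 r" for \<mu> u
      using r(3)[OF that] by (simp add: R_H_def)
    show ?thesis
    proof (intro exI[of _ "ball 0 r"] exI[of _ "\<lambda>\<mu> u. \<Phi> (\<mu>, u)"] exI[of _ \<phi>] conjI ballI)
      show "ball 0 r \<subseteq> U"
      proof
        fix u :: "real^'d" assume "u \<in> ball 0 r"
        then show "u \<in> U" using r(3)[of 0 u] r(1) N(3) by auto
      qed
      show "ball 0 r \<times> ball 0 r \<subseteq> N" using r(3) by blast
      show "smooth_on (ball 0 r \<times> ball 0 r) (\<lambda>(\<mu>, u). (\<Phi> (\<mu>, u), \<phi> u))"
      proof (rule smooth_on_if_smooth_at)
        fix z :: "(real^3) \<times> (real^'d)" assume "z \<in> ball 0 r \<times> ball 0 r"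
        then have z: "smooth_at \<Phi> z" "smooth_at \<phi> (snd z)" using r(3)[of "fst z" "snd z"] by auto
        have "smooth_at (\<lambda>z. \<phi> (snd z)) z"
          by (rule smooth_at_compose[of \<phi> snd, OF z(2)]) (rule smooth_at_bounded_linear[OF bounded_linear_snd])
        then show "smooth_at (\<lambda>(\<mu>, u). (\<Phi> (\<mu>, u), \<phi> u)) z"
          using smooth_at_Pair[OF z(1)] by (simp add: case_prod_unfold)
      qed
      show "(\<mu>, u) \<in> R_H_family H N s \<longleftrightarrow> (\<Phi> (\<mu>, u), \<phi> u) \<in> R_G_family a b c e"
        if "\<mu> \<in> ball 0 r" "u \<in> ball 0 r" for \<mu> u
        using R[OF that] by (simp add: R_H_family_def R_G_family_def)
      show "(\<lambda>\<mu>. \<Phi> (\<mu>, u)) ` (R_H H N s u \<inter> ball 0 r) = R_G a b c e (\<phi> u) \<inter> (\<lambda>\<mu>. \<Phi> (\<mu>, u)) ` ball 0 r"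
        if "u \<in> ball 0 r" for u
        using R[OF _ that] by (auto simp del: mem_ball)
    qed (use r in auto)
  qed
qed

end
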